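(* Let $r\ge 0$ be a real number and let $\mathbf{K}_{\mathbf{x}}$ be a fixed $N_A\times N_A$ covariance matrix (Hermitian positive semidefinite). If the ergodic channel $\mathbf{H}$ is uniformly less noisy than the ergodic channel $\mathbf{G}$, then among all input distributions $p_{(u,\mathbf{x})}$ with $\mathrm{cov}[\mathbf{x}]=\mathbf{K}_{\mathbf{x}}$, the secrecy outage probability $\mathrm{SOP}(r)$ is minimized by the one for which $u\equiv\mathbf{x}$ and $\mathbf{x}$ is a (circularly symmetric) complex Gaussian vector with covariance $\mathbf{K}_{\mathbf{x}}$, and $$\min_{\substack{p_{(u,\mathbf{x})}\\ \mathrm{cov}[\mathbf{x}]=\mathbf{K}_{\mathbf{x}}}}\mathrm{SOP}(r)=\mathbb{P}\left[\log\left(\frac{\det(\mathbf{I}+\mathbf{H}\mathbf{K}_{\mathbf{x}}\mathbf{H}^\dagger)}{\det(\mathbf{I}+\mathbf{G}\mathbf{K}_{\mathbf{x}}\mathbf{G}^\dagger)}\right)<r\right].$$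
   Context: Channel model (MIMOME). Let $N_A,N_B,N_E\ge 1$ be integers. A message $u$, a random variable in an arbitrary set $\mathcal{U}$, is encoded into a random vector $\mathbf{x}\in\mathbb{C}^{N_A}$; the joint law $p_{(u,\mathbf{x})}$ is the input distribution (the set $\mathcal U$, the law of $u$ and the conditional law of $\mathbf{x}$ given $u$ are all free). The legitimate receiver observes $\mathbf{y}=\mathbf{H}\mathbf{x}+\mathbf{w}_B\in\mathbb{C}^{N_B}$ and the eavesdropper observes $\mathbf{z}=\mathbf{G}\mathbf{x}+\mathbf{w}_E\in\mathbb{C}^{N_E}$, where $\mathbf{H}\in\mathbb{C}^{N_B\times N_A}$ and $\mathbf{G}\in\mathbb{C}^{N_E\times N_A}$ are random matrices (with given distributions, the channel statistics) independent of $(u,\mathbf{x})$, and $\mathbf{w}_B,\mathbf{w}_E$ are circularly symmetric complex Gaussian noise vectors with identity covariance, independent of each other and of everything else. $\dagger$ is the conjugate transpose; $\log$ is base 2; $I(\cdot;\cdot)$ is Shannon mutual information in bits. Instantaneous quantities: $I(u;\mathbf{y})$ and $I(u;\mathbf{z})$ denote the mutual informations for the instantaneous channel states, i.e. $I(u;\mathbf{y}\mid\mathbf{H}=\mathbf{H}_0)$ evaluated at $\mathbf{H}_0=\mathbf{H}$ and $I(u;\mathbf{z}\mid\mathbf{G}=\mathbf{G}_0)$ evaluated at $\mathbf{G}_0=\mathbf{G}$; they are thus random variables, functions of $(\mathbf{H},\mathbf{G})$. The secrecy outage probability is $\mathrm{SOP}(r)=\mathbb{P}[I(u;\mathbf{y})-I(u;\mathbf{z})<r]$,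 the probability being over $(\mathbf{H},\mathbf{G})$. Uniformly less noisy: $\mathbf{H}$ is uniformly less noisy than $\mathbf{G}$ if for every possible pair of instantaneous channels $(\mathbf{H}_0,\mathbf{G}_0)$ and every input distribution $p_{(u,\mathbf{x})}$ (every channel $u\to\mathbf{x}$), $I(u;\mathbf{y}\mid\mathbf{H}=\mathbf{H}_0)\ge I(u;\mathbf{z}\mid\mathbf{G}=\mathbf{G}_0)$. The notation $u\equiv\mathbf{x}$ means that $u$ is identified with $\mathbf{x}$ (no precoding). *)

theory Defs
  imports "HOL-Probability.Probability"
begin

section \<open>Complex matrices\<close>

definition ctranspose :: "complex^'m^'n \<Rightarrow> complex^'n^'m"  ("_\<^sup>H" [1000] 999)
  where "A\<^sup>H = map_matrix cnj (transpose A)"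

definition hermitian_psd :: "complex^'n^'n \<Rightarrow> bool" where
  "hermitian_psd K \<longleftrightarrow>
     K\<^sup>H = K \<and> (\<forall>v. 0 \<le> Re (\<Sum>i\<in>UNIV. cnj (v $ i) * (K *v v) $ i))"

section \<open>Complex Gaussian vectors\<close>

text \<open>
  Zero mean, identity covariance: real and imaginary part of each of the \<open>n\<close> components are
  independent with variance \<open>1/2\<close>, hence the normalisation \<open>\<pi>\<^sup>n\<close>.
\<close>

definition std_complex_gaussian :: "(complex^'n) measure" where
  "std_complex_gaussian =
     density lborel (\<lambda>w :: complex^'n. ennreal (exp (- (norm w)\<^sup>2) / pi ^ CARD('n)))"

text \<open>
  The circularly symmetric Gaussian law with covariance \<open>K\<close>, also for singular \<open>K\<close>: the law of
  \<open>A w\<close> with \<open>w\<close> standard and \<open>A A\<^sup>H = K\<close>. Such an \<open>A\<close> exists for every positive semidefinite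
  \<open>K\<close>, and the law does not depend on which one is picked.
\<close>

definition complex_gaussian :: "complex^'n^'n \<Rightarrow> (complex^'n) measure" where
  "complex_gaussian K =
     distr std_complex_gaussian borel ((*v) (SOME A :: complex^'n^'n. A ** A\<^sup>H = K))"

section \<open>Mutual information\<close>

text \<open>
  The library's \<open>mutual_information\<close> is a Bochner integral and thus \<open>0\<close> when the integral
  diverges. Since the negative part of the information density is always integrable, divergence
  means that the mutual information is infinite; likewise if the joint law is not absolutely
  continuous with respect to the product of the marginals.
\<close>

definition mutual_info ::
  "'w measure \<Rightarrow> 's measure \<Rightarrow> 't measure \<Rightarrow> ('w \<Rightarrow> 's) \<Rightarrow> ('w \<Rightarrow> 't) \<Rightarrow> ereal" where
  "mutual_info M S T X Y =
     (let P = distr M (S \<Otimes>\<^sub>M T) (\<lambda>\<omega>. (X \<omega>, Y \<omega>));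
          Q = distr M S X \<Otimes>\<^sub>M distr M T Y
      in if absolutely_continuous Q P \<and> integrable P (entropy_density 2 Q P)
         then ereal (prob_space.mutual_information M 2 S T X Y)
         else \<infinity>)"

section \<open>Inputs\<close>

text \<open>
  An input is a pair \<open>(U, p)\<close>: the measurable space \<open>U\<close> is the message alphabet (an arbitrary
  set with an arbitrary sigma-algebra; the measure part of \<open>U\<close> is irrelevant) and \<open>p\<close> is the
  joint law of the message \<open>u\<close> and the channel input \<open>x\<close>.
\<close>

type_synonym ('u, 'a) input = "'u measure \<times> ('u \<times> (complex^'a)) measure"

definition input_distribution :: "('u, 'a::finite) input \<Rightarrow> bool" where
  "input_distribution = (\<lambda>(U, p). prob_space p \<and> sets p = sets (U \<Otimes>\<^sub>M borel))"

definition has_covariance :: "'w measure \<Rightarrow> ('w \<Rightarrow> complex^'n) \<Rightarrow> complex^'n^'n \<Rightarrow> bool" where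
  "has_covariance M X K \<longleftrightarrow>
     integrable M (\<lambda>\<omega>. (norm (X \<omega>))\<^sup>2) \<and>
     (\<forall>i j. (\<integral>\<omega>. (X \<omega> $ i - (\<integral>\<omega>'. X \<omega>' $ i \<partial>M)) * cnj (X \<omega> $ j - (\<integral>\<omega>'. X \<omega>' $ j \<partial>M)) \<partial>M)
            = K $ i $ j)"

definition inputs_with_cov :: "complex^'a^'a \<Rightarrow> ('u, 'a::finite) input set" where
  "inputs_with_cov K = {(U, p). input_distribution (U, p) \<and> has_covariance p snd K}"

text \<open>
  The input with \<open>u\<close> identified with \<open>x\<close>, \<open>x\<close> Gaussian. The injection \<open>\<iota>\<close> embeds the vectors
  \<open>x\<close> in the type of messages.
\<close>

definition gaussian_input :: "(complex^'a \<Rightarrow> 'u) \<Rightarrow> complex^'a^'a \<Rightarrow> ('u, 'a::finite) input" where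
  "gaussian_input \<iota> K =
     (embed_measure borel \<iota>,
      distr (complex_gaussian K) (embed_measure borel \<iota> \<Otimes>\<^sub>M borel) (\<lambda>x. (\<iota> x, x)))"

section \<open>The wiretap channel\<close>

text \<open>
  The information between \<open>u\<close> and the received vector \<open>A x + w\<close> for a fixed channel matrix \<open>A\<close>;
  taking the product with the noise law makes the noise independent of \<open>(u, x)\<close>.
\<close>

definition channel_info :: "('u, 'a::finite) input \<Rightarrow> complex^'a^'k \<Rightarrow> ereal" where
  "channel_info = (\<lambda>(U, p) A.
     mutual_info (p \<Otimes>\<^sub>M std_complex_gaussian) U borel
       (\<lambda>((u, x), w). u) (\<lambda>((u, x), w). A *v x + w))"

text \<open>
  The possible pairs of instantaneous channels form the support of the joint law of \<open>(H, G)\<close>,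
  so that they depend on the channel statistics only.
\<close>

definition possible_channels ::
  "'w measure \<Rightarrow> ('w \<Rightarrow> complex^'a^'b) \<Rightarrow> ('w \<Rightarrow> complex^'a^'e) \<Rightarrow>
   ((complex^'a^'b) \<times> (complex^'a^'e)) set" where
  "possible_channels M H G =
     {c. \<forall>V. open V \<and> c \<in> V \<longrightarrow> 0 < measure M {\<omega> \<in> space M. (H \<omega>, G \<omega>) \<in> V}}"

text \<open>The type argument is the type in which the message alphabets live.\<close>

definition uniformly_less_noisy ::
  "'u itself \<Rightarrow> 'w measure \<Rightarrow> ('w \<Rightarrow> complex^'a^'b) \<Rightarrow> ('w \<Rightarrow> complex^'a^'e) \<Rightarrow> bool" where
  "uniformly_less_noisy _ M H G \<longleftrightarrow>
     (\<forall>(H0, G0) \<in> possible_channels M H G. \<forall>inp :: ('u, 'a) input.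
        input_distribution inp \<longrightarrow> channel_info inp G0 \<le> channel_info inp H0)"

definition SOP ::
  "'w measure \<Rightarrow> ('w \<Rightarrow> complex^'a^'b) \<Rightarrow> ('w \<Rightarrow> complex^'a^'e) \<Rightarrow> real \<Rightarrow>
   ('u, 'a::finite) input \<Rightarrow> real" where
  "SOP M H G r inp =
     measure M {\<omega> \<in> space M. channel_info inp (H \<omega>) - channel_info inp (G \<omega>) < ereal r}"

end

theory Submission
  imports Defs
begin

text \<open>
  Gaussian inputs show that a uniformly less noisy \<open>H\<close> satisfies \<open>|G v| \<le> |H v|\<close>, hence \<open>G = C H\<close> with a
  contraction \<open>C\<close>. For \<open>\<parallel>C\<parallel> < 1\<close> the eavesdropper's output is a degraded version \<open>z = C y + D n\<close> of the
  receiver's output, with \<open>C C\<^sup>H + D D\<^sup>H = I\<close>. Comparing with the Gaussian output \<open>y\<^sub>G\<close> of the same covariance,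
  \<open>log det (I + H K H\<^sup>H) = I(u;y) + I(x;y|u) + D(y \<parallel> y\<^sub>G)\<close>, and by data processing the last two terms
  decrease when \<open>y\<close> is replaced by \<open>z\<close>; so \<open>I(u;y) - I(u;z)\<close> is at most the difference of the log
  determinants, which the Gaussian input attains. A general contraction is the limit of the strict ones
  \<open>t C\<close>, \<open>t \<rightarrow> 1\<close>. The events in the outage probabilities are measurable because mutual information is
  lower semicontinuous in the channel matrix.
\<close>

section \<open>Complex matrices and their adjoints\<close>

text \<open>Strict contractions are used because only they make \<open>D\<close> invertible, and the
  law of \<open>C w + D n\<close> is found by changing variables from \<open>n\<close> to the sum.
  The limit \<open>t \<rightarrow> 1\<close> rests on monotonicity: scaling \<open>G\<close> down
  lowers its information, so the gap for \<open>t G\<close> bounds the gap for \<open>G\<close>, and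
  continuity is used only for the log determinant.

  The alphabet of \<open>u\<close> is an arbitrary measurable space, where regular conditional laws
  may fail to exist. Hence \<open>I(x;y|u)\<close> is written as the divergence of
  \<open>(u,x,y)\<close> from a product law reweighted by a density of \<open>(u,y)\<close>; the
  delicate point is that these reweighted laws are degraded along with the channel.

  The three terms add up to the same finite number for every input with covariance \<open>K\<close>,
  since the log density is quadratic and its expectation sees only second moments. This finiteness
  makes the subtractions legitimate. The reference Gaussian carries the mean of \<open>x\<close>, as
  inputs may have nonzero mean.

  The bound \<open>|G v| \<le> |H v|\<close> comes from rank-one covariances
  \<open>v v\<^sup>H\<close>.\<close>

lemma ctranspose_nth [simp]: "A\<^sup>H $ i $ j = cnj (A $ j $ i)"
  by (simp add: ctranspose_def transpose_def)

lemma ctranspose_ctranspose [simp]: "(A\<^sup>H)\<^sup>H = A"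
  by (simp add: vec_eq_iff)

lemma ctranspose_mat_1 [simp]: "(mat 1)\<^sup>H = mat 1"
  by (auto simp: vec_eq_iff mat_def)

lemma ctranspose_mul: "(A ** B)\<^sup>H = B\<^sup>H ** A\<^sup>H"
  by (simp add: vec_eq_iff matrix_matrix_mult_def mult.commute)

lemma ctranspose_diff: "(A - B)\<^sup>H = A\<^sup>H - B\<^sup>H"
  by (simp add: vec_eq_iff)

lemma ctranspose_scaleR: "(c *\<^sub>R A)\<^sup>H = c *\<^sub>R A\<^sup>H"
  by (simp add: vec_eq_iff)

lemma det_ctranspose: "det (A\<^sup>H) = cnj (det A)" for A :: "complex^'n^'n"
proof -
  have "det (map_matrix cnj B) = cnj (det B)" for B :: "complex^'n^'n"
    by (simp add: det_def)
  then show ?thesis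
    by (simp add: ctranspose_def)
qed

lemma det_mul_ctranspose: "det (A ** A\<^sup>H) = of_real ((cmod (det A))\<^sup>2)" for A :: "complex^'n^'n"
  by (simp add: det_mul det_ctranspose complex_norm_square del: of_real_power)

text \<open>Linear in the first argument. The real part is the real inner product
  \<open>\<bullet>\<close>, so norms and orthogonality use the real theory and \<open>cinner\<close>
  enters where complex coefficients matter.\<close>

definition cinner :: "complex^'n \<Rightarrow> complex^'n \<Rightarrow> complex" where
  "cinner v w = (\<Sum>i\<in>UNIV. v $ i * cnj (w $ i))"

lemma Re_cinner: "Re (cinner v w) = v \<bullet> w"
  by (simp add: cinner_def inner_vec_def inner_complex_def)

lemma cinner_commute: "cinner w v = cnj (cinner v w)"
  by (simp add: cinner_def mult.commute)

lemma cinner_scale: "cinner (c *s v) w = c * cinner v w"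
  by (simp add: cinner_def sum_distrib_left mult.assoc)

lemma cinner_self: "cinner v v = of_real ((norm v)\<^sup>2)"
proof -
  have "Im (cinner v v) = 0"
    by (simp add: cinner_def)
  then show ?thesis
    using Re_cinner[of v v] by (simp add: complex_eq_iff power2_norm_eq_inner)
qed

lemma cinner_matrix_adjoint: "cinner (A *v x) y = cinner x (A\<^sup>H *v y)"
proof -
  have "cinner (A *v x) y = (\<Sum>i\<in>UNIV. \<Sum>j\<in>UNIV. A $ i $ j * x $ j * cnj (y $ i))"
    by (simp add: cinner_def matrix_vector_mult_def sum_distrib_right)
  also have "\<dots> = (\<Sum>j\<in>UNIV. \<Sum>i\<in>UNIV. A $ i $ j * x $ j * cnj (y $ i))"
    by (rule sum.swap)
  also have "\<dots> = cinner x (A\<^sup>H *v y)"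
    by (simp add: cinner_def matrix_vector_mult_def sum_distrib_left ac_simps)
  finally show ?thesis .
qed

lemma inner_matrix_adjoint: "(A *v x) \<bullet> y = x \<bullet> (A\<^sup>H *v y)"
  by (simp add: cinner_matrix_adjoint flip: Re_cinner)

lemma inner_matrix_adjoint': "x \<bullet> (A *v y) = (A\<^sup>H *v x) \<bullet> y"
  by (simp add: inner_matrix_adjoint)

lemma hermitian_psd_iff: "hermitian_psd K \<longleftrightarrow> K\<^sup>H = K \<and> (\<forall>v. 0 \<le> v \<bullet> (K *v v))"
proof -
  have "Re (\<Sum>i\<in>UNIV. cnj (v $ i) * (K *v v) $ i) = v \<bullet> (K *v v)" for v
    by (simp add: inner_vec_def inner_complex_def)
  then show ?thesis
    by (simp add: hermitian_psd_def)
qed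

lemma matrix_mult_distribs:
  "(A + B) ** C = A ** C + B ** C" "A ** (D + E) = A ** D + A ** E"
  "(A - B) ** C = A ** C - B ** C" "A ** (D - E) = A ** D - A ** E"
  for A B :: "complex^'n^'m"
  by (simp_all add: vec_eq_iff matrix_matrix_mult_def algebra_simps sum.distrib sum_subtractf)

lemma matrix_vector_mult_scale: "A *v (c *s x) = c *s (A *v x)" for A :: "complex^'n^'m"
  by (simp add: vec_eq_iff matrix_vector_mult_def sum_distrib_left algebra_simps)

lemma matrix_axis_nth: "(A *v axis j 1) $ i = A $ i $ j" for A :: "complex^'n^'m"
  by (simp add: matrix_vector_mult_def axis_def if_distrib cong: if_cong)

lemma scaleR_matrix_mult: "(c *\<^sub>R A) ** (d *\<^sub>R B) = (c * d) *\<^sub>R (A ** B)" for A :: "complex^'n^'m"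
  by (simp add: vec_eq_iff matrix_matrix_mult_def scaleR_sum_right mult.commute)

lemma scaleR_matrix_vector: "(c *\<^sub>R A) *v x = c *\<^sub>R (A *v x)" for A :: "complex^'n^'m"
  by (simp add: vec_eq_iff matrix_vector_mult_def scaleR_sum_right)

section \<open>Rank-one matrices\<close>

definition outer :: "complex^'m \<Rightarrow> complex^'n \<Rightarrow> complex^'n^'m" where
  "outer v w = (\<chi> i j. v $ i * cnj (w $ j))"

lemma outer_nth [simp]: "outer v w $ i $ j = v $ i * cnj (w $ j)"
  by (simp add: outer_def)

lemma ctranspose_outer [simp]: "(outer v w)\<^sup>H = outer w v"
  by (simp add: vec_eq_iff)

lemma outer_mult_vec: "outer v w *v x = cinner x w *s v"
  by (simp add: vec_eq_iff matrix_vector_mult_def cinner_def sum_distrib_left sum_distrib_right algebra_simps)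

lemma matrix_mult_outer: "A ** outer v w = outer (A *v v) w"
  by (simp add: vec_eq_iff matrix_matrix_mult_def matrix_vector_mult_def sum_distrib_left ac_simps)

lemma outer_matrix_mult: "outer v w ** A = outer v (A\<^sup>H *v w)"
  by (simp add: vec_eq_iff matrix_matrix_mult_def matrix_vector_mult_def sum_distrib_left ac_simps)

lemma hermitian_psd_outer: "hermitian_psd (outer v v)"
proof -
  have "x \<bullet> (outer v v *v x) = (cmod (cinner x v))\<^sup>2" for x
  proof -
    have "cinner (cinner x v *s v) x = cinner x v * cinner v x"
      by (rule cinner_scale)
    then have "(outer v v *v x) \<bullet> x = Re (cinner x v * cnj (cinner x v))"
      by (simp add: outer_mult_vec flip: Re_cinner cinner_commute)
    then show ?thesis
      by (simp add: inner_commute complex_norm_square[symmetric] del: of_real_power)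
  qed
  then show ?thesis
    by (simp add: hermitian_psd_iff)
qed

section \<open>Factorisation of positive semidefinite matrices\<close>

lemma hermitian_psd_diag_Re:
  assumes "hermitian_psd K"
  shows "K $ i $ i = of_real (Re (K $ i $ i))" "0 \<le> Re (K $ i $ i)"
proof -
  have "cnj (K $ i $ i) = K $ i $ i"
    using assms by (metis ctranspose_nth hermitian_psd_def)
  then show "K $ i $ i = of_real (Re (K $ i $ i))"
    by (simp add: complex_eq_iff)
  have "axis i 1 \<bullet> (K *v axis i 1) = Re (K $ i $ i)"
    by (simp add: inner_axis' matrix_axis_nth inner_complex_def)
  then show "0 \<le> Re (K $ i $ i)"
    using assms unfolding hermitian_psd_iff by (metis)
qed

text \<open>Minimising the quadratic form over \<open>x - s e\<^sub>i\<close> gives the Schur complement.\<close>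

lemma hermitian_psd_cauchy_schwarz:
  fixes K :: "complex^'n^'n"
  assumes K: "hermitian_psd K"
  shows "(cmod ((K *v x) $ i))\<^sup>2 \<le> Re (K $ i $ i) * (x \<bullet> (K *v x))"
proof -
  define a where "a = (K *v x) $ i"
  define d where "d = Re (K $ i $ i)"
  have herm: "K\<^sup>H = K" and psd: "\<And>v. 0 \<le> v \<bullet> (K *v v)"
    using K by (auto simp: hermitian_psd_iff)
  have quad: "0 \<le> x \<bullet> (K *v x) - 2 * t * (cmod a)\<^sup>2 + t\<^sup>2 * (cmod a)\<^sup>2 * d" for t :: real
  proof -
    \<comment> \<open>The multiple of the basis vector has the phase of \<open>a\<close>, so that
      each cross term becomes the real number \<open>t * (cmod a)\<^sup>2\<close>.\<close>
    define e :: "complex^'n" where "e = axis i (of_real t * a)"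
    have e: "e = (of_real t * a) *s axis i 1"
      by (simp add: e_def vec_eq_iff axis_def)
    have Ke: "(K *v e) $ i = of_real (t * d) * a"
      unfolding e matrix_vector_mult_scale using hermitian_psd_diag_Re(1)[OF K, of i]
      by (simp add: matrix_axis_nth d_def algebra_simps)
    have "0 \<le> (x - e) \<bullet> (K *v (x - e))"
      by (rule psd)
    also have "\<dots> = x \<bullet> (K *v x) - x \<bullet> (K *v e) - e \<bullet> (K *v x) + e \<bullet> (K *v e)"
      by (simp add: algebra_simps inner_diff_left inner_diff_right)
    also have "x \<bullet> (K *v e) = e \<bullet> (K *v x)"
      by (metis herm inner_commute inner_matrix_adjoint)
    also have "e \<bullet> (K *v x) = t * (cmod a)\<^sup>2"
      by (simp add: e_def inner_axis' inner_complex_def a_def[symmetric] cmod_power2)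
         (simp add: power2_eq_square algebra_simps)
    also have "e \<bullet> (K *v e) = (of_real t * a) \<bullet> (of_real (t * d) * a)"
      by (metis Ke e_def inner_axis')
    also have "\<dots> = t\<^sup>2 * (cmod a)\<^sup>2 * d"
      by (simp add: inner_complex_def cmod_power2) (simp add: power2_eq_square algebra_simps)
    finally show ?thesis
      by (simp add: algebra_simps)
  qed
  have d: "0 \<le> d"
    unfolding d_def by (rule hermitian_psd_diag_Re(2)[OF K])
  show ?thesis
  proof (cases "d = 0")
    case True
    have "cmod a = 0"
    proof (rule ccontr)
      assume "cmod a \<noteq> 0"
      \<comment> \<open>For \<open>d = 0\<close> the quadratic in \<open>t\<close> is affine, and at
        the \<open>t\<close> inserted here it would equal \<open>-1\<close>.\<close>
      then show False
        using quad[of "(x \<bullet> (K *v x) + 1) / (2 * (cmod a)\<^sup>2)"] True by simp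
    qed
    then show ?thesis
      using True by (simp add: a_def d_def)
  next
    case False
    \<comment> \<open>The quadratic is minimal at \<open>t = 1 / d\<close>.\<close>
    then show ?thesis
      using quad[of "1 / d"] d
      by (simp add: a_def[symmetric] d_def[symmetric] power2_eq_square field_simps)
  qed
qed

text \<open>Cholesky factorisation by induction on the set \<open>F\<close> of indices whose rows
  may be nonzero: subtracting \<open>outer v v\<close> clears row \<open>i\<close> and leaves the
  Schur complement. Requiring the columns of the factor outside \<open>F\<close> to vanish keeps
  column \<open>i\<close> free to receive \<open>v\<close>.\<close>

lemma hermitian_psd_factor_supported:
  assumes "finite F"
  shows "hermitian_psd K \<Longrightarrow> (\<And>i j. i \<notin> F \<Longrightarrow> K $ i $ j = 0) \<Longrightarrow>
    \<exists>A :: complex^'n^'n. A ** A\<^sup>H = K \<and> (\<forall>j. j \<notin> F \<longrightarrow> column j A = 0)"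
  using assms
proof (induction arbitrary: K rule: finite_induct)
  case empty
  then show ?case
    by (intro exI[of _ 0]) (simp add: vec_eq_iff column_def matrix_matrix_mult_def)
next
  case (insert i F)
  define d where "d = Re (K $ i $ i)"
  have herm: "K\<^sup>H = K" and Kd: "K $ i $ i = of_real d" and d: "0 \<le> d"
    using insert.prems(1) hermitian_psd_diag_Re[OF insert.prems(1)]
    by (auto simp: hermitian_psd_iff d_def)
  have cnj_K: "cnj (K $ j $ k) = K $ k $ j" for j k
    by (metis ctranspose_nth herm)
  \<comment> \<open>For \<open>d = 0\<close> the Cauchy-Schwarz inequality makes row \<open>i\<close> vanish, and then \<open>v = 0\<close> since \<open>x / 0 = 0\<close>.\<close>
  define v where "v = (\<chi> j. K $ j $ i / of_real (sqrt d))"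
  have row0: "K $ i $ j = 0" if "d = 0" for j
  proof -
    have "(cmod ((K *v axis j 1) $ i))\<^sup>2 \<le> d * (axis j 1 \<bullet> (K *v axis j 1))"
      unfolding d_def by (rule hermitian_psd_cauchy_schwarz[OF insert.prems(1)])
    then show ?thesis
      using that by (simp add: matrix_axis_nth)
  qed
  have vv: "v $ j * cnj (v $ k) = K $ j $ i * K $ i $ k / of_real d" for j k
    using d by (simp add: v_def cnj_K del: of_real_mult flip: of_real_mult)
  have row: "K $ i $ j = v $ i * cnj (v $ j)" for j
    using row0 by (cases "d = 0") (auto simp: vv Kd)
  define K' where "K' = K - outer v v"
  \<comment> \<open>Positivity of the Schur complement is the Cauchy-Schwarz inequality above
    divided by \<open>d\<close>; for \<open>d = 0\<close> the subtracted term is zero because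
    \<open>x / 0 = 0\<close>.\<close>
  have "hermitian_psd K'"
    unfolding hermitian_psd_iff
  proof (intro conjI allI)
    show "K'\<^sup>H = K'"
      by (simp add: K'_def ctranspose_diff herm)
    fix x
    have "cinner x v = (K *v x) $ i / of_real (sqrt d)"
      by (simp add: cinner_def v_def cnj_K matrix_vector_mult_def sum_divide_distrib algebra_simps)
    then have "(cmod (cinner x v))\<^sup>2 = (cmod ((K *v x) $ i))\<^sup>2 / d"
      using d by (simp add: norm_divide power_divide)
    also have "\<dots> \<le> x \<bullet> (K *v x)"
    proof (cases "d = 0")
      case True
      then show ?thesis
        using insert.prems(1) by (simp add: hermitian_psd_iff)
    next
      case False
      then show ?thesis
        using hermitian_psd_cauchy_schwarz[OF insert.prems(1), of x i] d
        by (simp add: d_def[symmetric] field_simps)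
    qed
    also have "(cmod (cinner x v))\<^sup>2 = x \<bullet> (outer v v *v x)"
    proof -
      have "x \<bullet> (outer v v *v x) = Re (cinner (cinner x v *s v) x)"
        by (simp add: outer_mult_vec Re_cinner inner_commute)
      also have "cinner (cinner x v *s v) x = cinner x v * cnj (cinner x v)"
        by (subst cinner_commute[symmetric]) (rule cinner_scale)
      finally show ?thesis
        by (simp add: complex_norm_square[symmetric] del: of_real_power)
    qed
    finally show "0 \<le> x \<bullet> (K' *v x)"
      by (simp add: K'_def algebra_simps inner_diff_right)
  qed
  moreover have "K' $ j $ k = 0" if "j \<notin> F" for j k
  proof (cases "j = i")
    case True
    then show ?thesis
      by (simp add: K'_def row)
  next
    case False
    then show ?thesis
      using that insert.prems(2)[of j] by (simp add: K'_def v_def)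
  qed
  ultimately obtain A :: "complex^'n^'n" where A: "A ** A\<^sup>H = K'" "\<And>j. j \<notin> F \<Longrightarrow> column j A = 0"
    using insert.IH[of K'] by blast
  define B where "B = (\<chi> j k. if k = i then v $ j else A $ j $ k)"
  have col_i: "A $ j $ i = 0" for j
    using A(2)[OF insert.hyps(2)] by (simp add: column_def vec_eq_iff)
  have "(B ** B\<^sup>H) $ j $ k = K $ j $ k" for j k
  proof -
    have "(B ** B\<^sup>H) $ j $ k = (\<Sum>l\<in>UNIV. A $ j $ l * cnj (A $ k $ l) + (if l = i then v $ j * cnj (v $ k) else 0))"
      unfolding matrix_matrix_mult_def by (auto simp: B_def col_i intro!: sum.cong)
    also have "\<dots> = (A ** A\<^sup>H) $ j $ k + v $ j * cnj (v $ k)"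
      by (simp add: sum.distrib matrix_matrix_mult_def)
    finally show ?thesis
      by (simp add: A K'_def)
  qed
  moreover have "column j B = 0" if "j \<notin> insert i F" for j
    using that A(2)[of j] by (simp add: B_def column_def vec_eq_iff)
  ultimately show ?case
    by (intro exI[of _ B]) (simp add: vec_eq_iff)
qed

lemma hermitian_psd_factor:
  assumes "hermitian_psd (K :: complex^'n^'n)"
  obtains A :: "complex^'n^'n" where "A ** A\<^sup>H = K"
  using hermitian_psd_factor_supported[of UNIV K] assms by auto

lemma inner_mul_ctranspose: "x \<bullet> ((A ** A\<^sup>H) *v x) = (norm (A\<^sup>H *v x))\<^sup>2"
  by (simp add: inner_matrix_adjoint' power2_norm_eq_inner flip: matrix_vector_mul_assoc)

lemma hermitian_mul_ctranspose [simp]: "(A ** A\<^sup>H)\<^sup>H = A ** A\<^sup>H"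
  by (simp add: ctranspose_mul)

section \<open>Contractions\<close>

lemma contraction_adjoint:
  fixes C :: "complex^'n^'m"
  assumes "\<And>y. norm (C *v y) \<le> norm y"
  shows "norm (C\<^sup>H *v z) \<le> norm z"
proof -
  have "(norm (C\<^sup>H *v z))\<^sup>2 = (C *v (C\<^sup>H *v z)) \<bullet> z"
    by (simp add: power2_norm_eq_inner inner_matrix_adjoint)
  also have "\<dots> \<le> norm (C *v (C\<^sup>H *v z)) * norm z"
    by (rule norm_cauchy_schwarz)
  also have "\<dots> \<le> norm (C\<^sup>H *v z) * norm z"
    by (intro mult_right_mono assms) simp
  finally show ?thesis
    by (cases "C\<^sup>H *v z = 0") (simp_all add: power2_eq_square)
qed

text \<open>For \<open>t < 1\<close> the matrix \<open>1 - t\<^sup>2 C C\<^sup>H\<close> is bounded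
  below by the positive constant \<open>1 - t\<^sup>2\<close>, so its factor \<open>D\<close> has
  trivial kernel. Invertibility of \<open>D\<close> is what \<open>gaussian_combination\<close> asks
  for.\<close>

lemma strict_contraction_complement:
  fixes C :: "complex^'n^'m"
  assumes C: "\<And>y. norm (C *v y) \<le> norm y" and t: "0 \<le> t" "t < 1"
  obtains D :: "complex^'m^'m"
    where "invertible D" "(t *\<^sub>R C) ** (t *\<^sub>R C)\<^sup>H + D ** D\<^sup>H = mat 1"
proof -
  let ?K = "mat 1 - (t *\<^sub>R C) ** (t *\<^sub>R C)\<^sup>H"
  have lower: "(1 - t\<^sup>2) * (norm x)\<^sup>2 \<le> x \<bullet> (?K *v x)" for x
  proof -
    have "(norm (C\<^sup>H *v x))\<^sup>2 \<le> (norm x)\<^sup>2"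
      by (intro power_mono contraction_adjoint C) simp
    then have "t\<^sup>2 * (norm (C\<^sup>H *v x))\<^sup>2 \<le> t\<^sup>2 * (norm x)\<^sup>2"
      by (intro mult_left_mono) auto
    moreover have "x \<bullet> (?K *v x) = (norm x)\<^sup>2 - t\<^sup>2 * (norm (C\<^sup>H *v x))\<^sup>2"
      by (simp add: matrix_vector_mult_diff_rdistrib inner_diff_right inner_mul_ctranspose ctranspose_scaleR scaleR_matrix_mult
          scaleR_matrix_vector power2_eq_square[of t] power2_norm_eq_inner[symmetric])
    ultimately show ?thesis
      by (simp add: algebra_simps)
  qed
  have t2: "0 < 1 - t\<^sup>2"
    using t by (simp add: power_less_one_iff)
  have "hermitian_psd ?K"
    unfolding hermitian_psd_iff
  proof (intro conjI allI)
    show "?K\<^sup>H = ?K"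
      unfolding ctranspose_diff hermitian_mul_ctranspose by simp
    show "0 \<le> x \<bullet> (?K *v x)" for x
      using lower[of x] t2 by (meson dual_order.trans less_imp_le mult_nonneg_nonneg zero_le_power2)
  qed
  then obtain D :: "complex^'m^'m" where D: "D ** D\<^sup>H = ?K"
    by (rule hermitian_psd_factor)
  have "x = 0" if "D\<^sup>H *v x = 0" for x
  proof -
    have "(1 - t\<^sup>2) * (norm x)\<^sup>2 \<le> 0"
      using lower[of x] inner_mul_ctranspose[of x D] that by (simp add: D)
    then show ?thesis
      using t2 by (simp add: mult_le_0_iff)
  qed
  then have "invertible (D\<^sup>H)"
    by (simp add: invertible_left_inverse matrix_left_invertible_ker)
  then have "invertible D"
    by (simp add: invertible_det_nz det_ctranspose)
  then show thesis
    by (intro that[of D]) (auto simp: D)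
qed

lemma scale_eq_Re_Im: "c *s z = Re c *\<^sub>R z + \<i> *s (Im c *\<^sub>R z)" for z :: "complex^'n"
  by (simp add: vec_eq_iff complex_eq_iff)

lemma inner_scale_ii: "(\<i> *s x) \<bullet> y = - (x \<bullet> (\<i> *s y))" for x y :: "complex^'n"
  by (simp add: inner_vec_def inner_complex_def sum_negf[symmetric] algebra_simps)

text \<open>\<open>C\<close> is the map \<open>H x \<mapsto> G x\<close> on the range of \<open>H\<close>, precomposed with the orthogonal projection.\<close>

lemma contraction_factor:
  fixes H :: "complex^'a^'b" and G :: "complex^'a^'e"
  assumes le: "\<And>v. norm (G *v v) \<le> norm (H *v v)"
  obtains C :: "complex^'b^'e" where "C ** H = G" "\<And>y. norm (C *v y) \<le> norm y"
proof -
  let ?S = "range ((*v) H)"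
  have sub: "subspace ?S"
    by (rule linear_subspace_image) auto
  then have span: "span ?S = ?S"
    by (rule span_eq_iff[THEN iffD2])
  \<comment> \<open>\<open>H *v x\<close> is the orthogonal projection of \<open>y\<close> onto the
    range of \<open>H\<close>, with respect to the real inner product. Such an \<open>x\<close> is
    not unique, but \<open>uniq\<close> shows that \<open>G *v x\<close> is.\<close>
  define P where "P y x \<longleftrightarrow> (\<forall>v. (y - H *v x) \<bullet> (H *v v) = 0)" for y x
  have ex: "\<exists>x. P y x" for y
  proof -
    obtain p q where "p \<in> span ?S" "\<And>w. w \<in> span ?S \<Longrightarrow> orthogonal q w" "y = p + q"
      using orthogonal_subspace_decomp_exists[of ?S y] by blast
    then show ?thesis
      unfolding P_def span orthogonal_def by (auto simp: image_iff) (metis add_diff_cancel_left')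
  qed
  have uniq: "G *v x = G *v x'" if "P y x" "P y x'" for y x x'
  proof -
    have "(H *v (x' - x)) \<bullet> (H *v (x' - x)) = 0"
      using that[unfolded P_def, rule_format, of "x' - x"]
      by (simp add: algebra_simps inner_diff_left inner_diff_right)
    then have "H *v (x' - x) = 0"
      by simp
    then have "G *v (x' - x) = 0"
      using le[of "x' - x"] by simp
    then show ?thesis
      by (simp add: algebra_simps)
  qed
  define f where "f y = G *v (SOME x. P y x)" for y
  have f: "f y = G *v x" if "P y x" for x y
    unfolding f_def using that ex[of y] uniq by (metis someI_ex)
  have add: "P (y + y') (x + x')" if "P y x" "P y' x'" for x x' y y'
    using that unfolding P_def by (simp add: algebra_simps inner_diff_left inner_add_left)
  \<comment> \<open>The range of \<open>H\<close> is stable under multiplication by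
    \<open>\<i>\<close>, hence so is real orthogonality to it; this upgrades the real linear
    projection to a complex linear one.\<close>
  have orth_ii: "P (\<i> *s y) (\<i> *s x)" if "P y x" for x y
    unfolding P_def
  proof
    fix v
    have "(\<i> *s y - H *v (\<i> *s x)) \<bullet> (H *v v) = (\<i> *s (y - H *v x)) \<bullet> (H *v v)"
      by (simp add: matrix_vector_mult_scale vector_ssub_ldistrib)
    also have "\<dots> = - ((y - H *v x) \<bullet> (H *v (\<i> *s v)))"
      by (simp only: inner_scale_ii matrix_vector_mult_scale)
    finally show "(\<i> *s y - H *v (\<i> *s x)) \<bullet> (H *v v) = 0"
      using that by (simp add: P_def)
  qed
  have real: "P (c *\<^sub>R y) (c *\<^sub>R x)" if "P y x" for c x y
    using that unfolding P_def by (simp add: linear_scale[OF matrix_vector_mul_linear] flip: scaleR_diff_right)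
  have scale: "P (c *s y) (c *s x)" if "P y x" for c x y
  proof -
    show ?thesis
      using add[OF real[OF that, of "Re c"] orth_ii[OF real[OF that, of "Im c"]]]
      by (simp only: scale_eq_Re_Im[of c, symmetric])
  qed
  have lin: "Vector_Spaces.linear (*s) (*s) f"
  proof (rule Vector_Spaces.linear_iff[THEN iffD2], intro conjI allI)
    show "f (x + y) = f x + f y" for x y
    proof -
      obtain a b where "P x a" "P y b"
        using ex by blast
      then show ?thesis
        by (simp add: f[OF add] f[of x a] f[of y b] matrix_vector_right_distrib)
    qed
    show "f (c *s x) = c *s f x" for c x
    proof -
      obtain a where "P x a"
        using ex by blast
      then show ?thesis
        by (simp add: f[OF scale] f[of x a] matrix_vector_mult_scale)
    qed
  qed (rule vec.vector_space_axioms)+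
  have fC: "matrix f *v y = f y" for y
    using lin by (rule matrix_works)
  have "matrix f ** H = G"
    unfolding matrix_eq
  proof
    fix x
    have "P (H *v x) x"
      by (simp add: P_def)
    then show "(matrix f ** H) *v x = G *v x"
      using f[of "H *v x" x] by (simp add: fC flip: matrix_vector_mul_assoc)
  qed
  moreover have "norm (matrix f *v y) \<le> norm y" for y
  proof -
    obtain x where x: "P y x"
      using ex by blast
    have "norm (f y) \<le> norm (H *v x)"
      using f[OF x] le by simp
    also have "(norm (H *v x))\<^sup>2 \<le> (norm y)\<^sup>2"
    proof -
      have "(norm y)\<^sup>2 = (norm (H *v x))\<^sup>2 + (norm (y - H *v x))\<^sup>2"
        using x[unfolded P_def, rule_format, of x]
        by (simp add: power2_norm_eq_inner inner_diff_left inner_diff_right inner_commute)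
      then show ?thesis
        by simp
    qed
    then have "norm (H *v x) \<le> norm y"
      by (rule power2_le_imp_le) simp
    finally show ?thesis
      by (simp add: fC)
  qed
  ultimately show thesis
    by (rule that)
qed

section \<open>Lebesgue measure under complex linear maps\<close>

text \<open>Change of variables for nonnegative integrands with the Jacobian factor \<open>c\<close>
  left open: its existence follows from translation invariance, and its value is identified
  separately in \<open>det_scaling\<close>.\<close>

definition lebesgue_scaling :: "complex^'n^'n \<Rightarrow> real \<Rightarrow> bool" where
  "lebesgue_scaling T c \<longleftrightarrow> 0 < c \<and> (\<forall>g. g \<in> borel_measurable borel \<longrightarrow>
     (\<integral>\<^sup>+v. g v \<partial>lborel) = ennreal c * (\<integral>\<^sup>+v. g (T *v v) \<partial>lborel))"

lemma lebesgue_scalingD: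
  "lebesgue_scaling T c \<Longrightarrow> g \<in> borel_measurable borel \<Longrightarrow>
     (\<integral>\<^sup>+v. g v \<partial>lborel) = ennreal c * (\<integral>\<^sup>+v. g (T *v v) \<partial>lborel)"
  by (simp add: lebesgue_scaling_def)

lemma lebesgue_scaling_pos: "lebesgue_scaling T c \<Longrightarrow> 0 < c"
  by (simp add: lebesgue_scaling_def)

lemma borel_measurable_matrix_vector [measurable]:
  fixes A :: "complex^'n^'m"
  assumes [measurable]: "f \<in> M \<rightarrow>\<^sub>M borel"
  shows "(\<lambda>x. A *v f x) \<in> M \<rightarrow>\<^sub>M borel"
proof -
  have "(*v) A \<in> borel \<rightarrow>\<^sub>M borel"
    by (intro borel_measurable_continuous_onI linear_continuous_on linear_conv_bounded_linear[THEN iffD1]) auto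
  from measurable_compose[OF assms this] show ?thesis .
qed

lemma nn_integral_lborel_translate:
  fixes a :: "'a::euclidean_space"
  assumes [measurable]: "g \<in> borel_measurable borel"
  shows "(\<integral>\<^sup>+v. g (a + v) \<partial>lborel) = (\<integral>\<^sup>+v. g v \<partial>lborel)"
  by (subst lborel_distr_plus[of a, symmetric], subst nn_integral_distr) auto

lemma nn_integral_lborel_uminus:
  assumes [measurable]: "g \<in> borel_measurable borel"
  shows "(\<integral>\<^sup>+v. g (- v) \<partial>lborel) = (\<integral>\<^sup>+v. g (v :: 'a::euclidean_space) \<partial>lborel)"
  by (subst (2) lborel_affine[of "-1" 0], simp, subst nn_integral_density, auto simp: nn_integral_distr)

text \<open>
  Uniqueness of translation-invariant measures, by Fubini: with \<open>\<nu> = T\<^sub>* \<lambda>\<close> one has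
  \<open>\<integral>f d\<nu> \<integral>g d\<lambda> = \<integral>\<integral> f(x) g(x + y) d\<nu>(x) d\<lambda>(y) = \<integral>\<integral> f(x - y) g(x) d\<nu>(x) d\<lambda>(y) = \<integral>f d\<lambda> \<integral>g d\<nu>\<close>.
\<close>

lemma nn_integral_lborel_linear_exchange:
  fixes T :: "complex^'n^'n"
  assumes "invertible T"
    and f [measurable]: "f \<in> borel_measurable borel" and g [measurable]: "g \<in> borel_measurable borel"
  shows "(\<integral>\<^sup>+v. f (T *v v) \<partial>lborel) * (\<integral>\<^sup>+v. g v \<partial>lborel) = (\<integral>\<^sup>+v. f v \<partial>lborel) * (\<integral>\<^sup>+v. g (T *v v) \<partial>lborel)"
proof -
  obtain N where N: "T ** N = mat 1"
    using assms(1) by (auto simp: invertible_def)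
  have TN: "T *v (N *v y) = y" for y
    by (simp add: matrix_vector_mul_assoc N)
  have "(\<integral>\<^sup>+v. f (T *v v) \<partial>lborel) * (\<integral>\<^sup>+v. g v \<partial>lborel)
      = (\<integral>\<^sup>+v. f (T *v v) * (\<integral>\<^sup>+y. g (T *v v + y) \<partial>lborel) \<partial>lborel)"
    by (simp add: nn_integral_multc nn_integral_lborel_translate)
  also have "\<dots> = (\<integral>\<^sup>+v. (\<integral>\<^sup>+y. f (T *v v) * g (T *v v + y) \<partial>lborel) \<partial>lborel)"
    by (simp add: nn_integral_cmult)
  also have "\<dots> = (\<integral>\<^sup>+y. (\<integral>\<^sup>+v. f (T *v v) * g (T *v v + y) \<partial>lborel) \<partial>lborel)"
    by (rule lborel_pair.Fubini') auto
  also have "\<dots> = (\<integral>\<^sup>+y. (\<integral>\<^sup>+v. f (T *v v - y) * g (T *v v) \<partial>lborel) \<partial>lborel)"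
  proof (rule nn_integral_cong)
    fix y
    show "(\<integral>\<^sup>+v. f (T *v v) * g (T *v v + y) \<partial>lborel) = (\<integral>\<^sup>+v. f (T *v v - y) * g (T *v v) \<partial>lborel)"
      by (subst nn_integral_lborel_translate[of _ "- (N *v y)", symmetric])
         (auto simp: matrix_vector_right_distrib matrix_vector_mult_diff_distrib linear_neg[OF matrix_vector_mul_linear] TN)
  qed
  also have "\<dots> = (\<integral>\<^sup>+v. (\<integral>\<^sup>+y. f (T *v v - y) * g (T *v v) \<partial>lborel) \<partial>lborel)"
    by (rule lborel_pair.Fubini') auto
  also have "\<dots> = (\<integral>\<^sup>+v. (\<integral>\<^sup>+y. f y \<partial>lborel) * g (T *v v) \<partial>lborel)"
  proof (rule nn_integral_cong)
    fix v
    have "(\<integral>\<^sup>+y. f (T *v v - y) \<partial>lborel) = (\<integral>\<^sup>+y. f (T *v v + y) \<partial>lborel)"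
      by (subst nn_integral_lborel_uminus[symmetric]) auto
    then show "(\<integral>\<^sup>+y. f (T *v v - y) * g (T *v v) \<partial>lborel) = (\<integral>\<^sup>+y. f y \<partial>lborel) * g (T *v v)"
      by (simp add: nn_integral_multc nn_integral_lborel_translate)
  qed
  also have "\<dots> = (\<integral>\<^sup>+v. f v \<partial>lborel) * (\<integral>\<^sup>+v. g (T *v v) \<partial>lborel)"
    by (simp add: nn_integral_cmult)
  finally show ?thesis .
qed

text \<open>The exchange formula is applied with the indicator of the unit ball \<open>U\<close> as
  second function. \<open>U\<close> and its preimage \<open>V\<close> are bounded open
  neighbourhoods of 0, hence of positive finite measure, and \<open>c\<close> is the ratio of these
  measures.\<close>

lemma lebesgue_scaling_exists:
  fixes T :: "complex^'n^'n"
  assumes T: "invertible T"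
  obtains c where "lebesgue_scaling T c"
proof -
  define U where "U = ball (0 :: complex^'n) 1"
  obtain N where N: "T ** N = mat 1" "N ** T = mat 1"
    using T by (auto simp: invertible_def)
  have inv: "T *v (N *v y) = y" "N *v (T *v y) = y" for y
    by (simp_all add: matrix_vector_mul_assoc N)
  have bl: "bounded_linear ((*v) A)" for A :: "complex^'n^'n"
    by (rule linear_conv_bounded_linear[THEN iffD1]) auto
  define V where "V = {v. T *v v \<in> U}"
  have V_eq: "V = (*v) N ` U"
    unfolding V_def image_def using inv by auto (metis inv)
  have "open V"
    unfolding V_def U_def using bl[of T] by (intro open_Collect_less continuous_intros linear_continuous_on open_vimage[unfolded vimage_def]) (auto)
  have "bounded V"
    unfolding V_eq U_def by (intro bounded_linear_image bounded_ball bl)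
  have pos: "0 < emeasure lborel W \<and> emeasure lborel W < \<infinity>"
    if "open W" "bounded W" "0 \<in> W" for W :: "(complex^'n) set"
  proof
    show "0 < emeasure lborel W"
    proof (rule ccontr)
      assume "\<not> 0 < emeasure lborel W"
      then have "W \<in> null_sets lborel"
        using that(1) by (auto simp: null_sets_def)
      then have "negligible W"
        by (simp add: negligible_iff_null_sets null_sets_completionI)
      then show False
        using that open_not_negligible by blast
    qed
    show "emeasure lborel W < \<infinity>"
      using that(2) by (rule emeasure_bounded_finite)
  qed
  have U: "0 < emeasure lborel U" "emeasure lborel U < \<infinity>"
    using pos[of U] by (auto simp: U_def)
  have V: "0 < emeasure lborel V" "emeasure lborel V < \<infinity>"
    using pos[OF \<open>open V\<close> \<open>bounded V\<close>] by (auto simp: V_def U_def)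
  have [measurable]: "U \<in> sets borel" "V \<in> sets borel"
    using \<open>open V\<close> by (auto simp: U_def)
  define c where "c = measure lborel U / measure lborel V"
  have mU: "emeasure lborel U = ennreal (measure lborel U)" and mV: "emeasure lborel V = ennreal (measure lborel V)"
    using U V by (auto simp: emeasure_eq_ennreal_measure)
  have posm: "0 < measure lborel U" "0 < measure lborel V"
    using U(1) V(1) unfolding mU mV by auto
  have "lebesgue_scaling T c"
    unfolding lebesgue_scaling_def
  proof (intro conjI allI impI)
    show "0 < c"
      using posm by (simp add: c_def)
    fix g :: "complex^'n \<Rightarrow> ennreal"
    assume [measurable]: "g \<in> borel_measurable borel"
    have "(\<integral>\<^sup>+v. g (T *v v) \<partial>lborel) * (\<integral>\<^sup>+v. indicator U v \<partial>lborel)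
      = (\<integral>\<^sup>+v. g v \<partial>lborel) * (\<integral>\<^sup>+v. indicator U (T *v v) \<partial>lborel)"
      by (rule nn_integral_lborel_linear_exchange[OF T]) auto
    also have "(\<lambda>v. indicator U (T *v v)) = (indicator V :: _ \<Rightarrow> ennreal)"
      by (auto simp: V_def fun_eq_iff split: split_indicator)
    finally have eq: "(\<integral>\<^sup>+v. g (T *v v) \<partial>lborel) * ennreal (measure lborel U)
        = (\<integral>\<^sup>+v. g v \<partial>lborel) * ennreal (measure lborel V)"
      by (simp add: mU mV)
    have "ennreal c * (\<integral>\<^sup>+v. g (T *v v) \<partial>lborel)
        = (\<integral>\<^sup>+v. g (T *v v) \<partial>lborel) * ennreal (measure lborel U) * ennreal (1 / measure lborel V)"
    proof -
      have "ennreal c = ennreal (measure lborel U) * ennreal (1 / measure lborel V)"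
        using posm by (simp add: c_def flip: ennreal_mult)
      then show ?thesis
        by (simp add: ac_simps)
    qed
    also have "\<dots> = (\<integral>\<^sup>+v. g v \<partial>lborel) * (ennreal (measure lborel V) * ennreal (1 / measure lborel V))"
      by (simp add: eq mult.assoc)
    also have "ennreal (measure lborel V) * ennreal (1 / measure lborel V) = 1"
      using posm by (simp flip: ennreal_mult)
    finally show "(\<integral>\<^sup>+v. g v \<partial>lborel) = ennreal c * (\<integral>\<^sup>+v. g (T *v v) \<partial>lborel)"
      by simp
  qed
  then show thesis
    by (rule that)
qed

lemma lebesgue_scaling_mult:
  assumes S: "lebesgue_scaling S c" and T: "lebesgue_scaling T d"
  shows "lebesgue_scaling (S ** T) (c * d)"
  unfolding lebesgue_scaling_def
proof (intro conjI allI impI)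
  have pos: "0 < c" "0 < d"
    using S T by (auto dest: lebesgue_scaling_pos)
  then show "0 < c * d"
    by simp
  fix g :: "complex^'a \<Rightarrow> ennreal"
  assume [measurable]: "g \<in> borel_measurable borel"
  have "(\<integral>\<^sup>+v. g v \<partial>lborel) = ennreal c * (\<integral>\<^sup>+v. g (S *v v) \<partial>lborel)"
    by (rule lebesgue_scalingD[OF S]) auto
  also have "(\<integral>\<^sup>+v. g (S *v v) \<partial>lborel) = ennreal d * (\<integral>\<^sup>+v. g (S *v (T *v v)) \<partial>lborel)"
    by (rule lebesgue_scalingD[OF T]) auto
  finally show "(\<integral>\<^sup>+v. g v \<partial>lborel) = ennreal (c * d) * (\<integral>\<^sup>+v. g (S ** T *v v) \<partial>lborel)"
    using pos by (simp add: ennreal_mult matrix_vector_mul_assoc mult.assoc)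
qed

section \<open>The standard Gaussian vector\<close>

abbreviation "\<gamma> \<equiv> std_complex_gaussian"

abbreviation "gaussian_pdf w \<equiv> exp (- (norm (w :: complex^'n))\<^sup>2) / pi ^ CARD('n)"

lemma Basis_vec_complex:
  "(Basis :: (complex^'n) set) = (\<lambda>i. axis i 1) ` UNIV \<union> (\<lambda>i. axis i \<i>) ` UNIV"
  by (auto simp: Basis_vec_def Basis_complex_def)

lemma norm_squared_Basis: "(norm (w::'a::euclidean_space))\<^sup>2 = (\<Sum>b\<in>Basis. (w \<bullet> b)\<^sup>2)"
  by (simp only: power2_norm_eq_inner euclidean_inner[of w w]) (simp add: power2_eq_square)

lemma nn_integral_exp_square: "(\<integral>\<^sup>+(x::real). ennreal (exp (- x\<^sup>2)) \<partial>lborel) = ennreal (sqrt pi)"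
proof -
  have "has_bochner_integral lborel (\<lambda>x::real. exp (- x\<^sup>2)) (2 *\<^sub>R (sqrt pi / 2))"
    by (rule has_bochner_integral_even_function[OF gaussian_moment_0]) auto
  then show ?thesis
    by (subst nn_integral_eq_integral) (auto simp: has_bochner_integral_iff)
qed

lemma nn_integral_square_exp_square: "(\<integral>\<^sup>+(x::real). ennreal (x\<^sup>2 * exp (- x\<^sup>2)) \<partial>lborel) = ennreal (sqrt pi / 2)"
proof -
  have "has_bochner_integral lborel (\<lambda>x::real. exp (- x\<^sup>2) * x ^ (2 * 1)) (2 *\<^sub>R (sqrt pi / 2 * (fact (2 * 1) / (2 ^ (2 * 1) * fact 1))))"
    by (rule has_bochner_integral_even_function[OF gaussian_moment_even_pos[of 1]]) auto
  then have "has_bochner_integral lborel (\<lambda>x::real. x\<^sup>2 * exp (- x\<^sup>2)) (sqrt pi / 2)"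
    by (simp add: mult.commute)
  then show ?thesis
    by (subst nn_integral_eq_integral) (auto simp: has_bochner_integral_iff)
qed

lemma nn_integral_exp_norm:
  "(\<integral>\<^sup>+(w::complex^'n). ennreal (exp (- (norm w)\<^sup>2)) \<partial>lborel) = ennreal (pi ^ CARD('n))"
proof -
  have "(\<integral>\<^sup>+(w::complex^'n). ennreal (exp (- (norm w)\<^sup>2)) \<partial>lborel)
      = (\<integral>\<^sup>+(w::complex^'n). (\<Prod>b\<in>Basis. ennreal (exp (- (w \<bullet> b)\<^sup>2))) \<partial>lborel)"
    by (simp add: norm_squared_Basis exp_sum prod_ennreal sum_negf[symmetric])
  also have "\<dots> = (\<Prod>b\<in>(Basis :: (complex^'n) set). \<integral>\<^sup>+x. ennreal (exp (- x\<^sup>2)) \<partial>lborel)"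
    by (rule nn_integral_lborel_prod) auto
  also have "\<dots> = ennreal (pi ^ CARD('n))"
    by (simp add: nn_integral_exp_square ennreal_power power_mult)
      (simp add: power2_eq_square flip: power_mult_distrib)
  finally show ?thesis .
qed

lemma sets_std_complex_gaussian [measurable_cong, simp]: "sets \<gamma> = sets borel"
  by (simp add: std_complex_gaussian_def)

lemma space_std_complex_gaussian [simp]: "space \<gamma> = UNIV"
  by (simp add: std_complex_gaussian_def)

lemma nn_integral_gaussian:
  assumes [measurable]: "g \<in> borel_measurable borel"
  shows "(\<integral>\<^sup>+w. g w \<partial>\<gamma>) = (\<integral>\<^sup>+w. ennreal (gaussian_pdf w) * g w \<partial>lborel)"
  unfolding std_complex_gaussian_def by (rule nn_integral_density) auto

lemma nn_integral_gaussian_pdf: "(\<integral>\<^sup>+(w::complex^'n). ennreal (gaussian_pdf w) \<partial>lborel) = 1"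
  by (simp add: divide_ennreal[symmetric] nn_integral_divide nn_integral_exp_norm ennreal_divide_self)

lemma prob_space_gaussian: "prob_space (\<gamma> :: (complex^'n) measure)"
  by (rule prob_spaceI) (simp add: std_complex_gaussian_def emeasure_density nn_integral_gaussian_pdf)

interpretation gaussian: prob_space "\<gamma> :: (complex^'n) measure"
  by (rule prob_space_gaussian)

text \<open>The Gaussian density depends on the norm only, so it is unchanged by \<open>U\<close>,
  and its integral 1 cancels on both sides of the change of variables.\<close>

lemma norm_isometry_scaling:
  fixes U :: "complex^'n^'n"
  assumes "lebesgue_scaling U c" "\<And>v. norm (U *v v) = norm v"
  shows "c = 1"
proof -
  have "(\<integral>\<^sup>+(w::complex^'n). ennreal (gaussian_pdf w) \<partial>lborel) = ennreal c * (\<integral>\<^sup>+(w::complex^'n). ennreal (gaussian_pdf (U *v w)) \<partial>lborel)"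
    by (rule lebesgue_scalingD[OF assms(1)]) auto
  then show ?thesis
    using lebesgue_scaling_pos[OF assms(1)] by (simp add: assms(2) nn_integral_gaussian_pdf)
qed

text \<open>
  Completing the square makes the density of \<open>C w + D w'\<close> proportional to the standard one; both
  being probability densities, they agree.
\<close>

lemma gaussian_combination:
  fixes C :: "complex^'m^'n" and D :: "complex^'n^'n"
  assumes D: "invertible D" and CD: "C ** C\<^sup>H + D ** D\<^sup>H = mat 1"
    and g [measurable]: "g \<in> borel_measurable borel"
  shows "(\<integral>\<^sup>+w. (\<integral>\<^sup>+w'. g (C *v w + D *v w') \<partial>\<gamma>) \<partial>\<gamma>)
    = (\<integral>\<^sup>+w. g w \<partial>\<gamma>)"
proof -
  obtain N where N: "D ** N = mat 1" "N ** D = mat 1"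
    using D by (auto simp: invertible_def)
  have DN: "D *v (N *v y) = y" "N *v (D *v y) = y" for y
    by (simp_all add: matrix_vector_mul_assoc N)
  have "invertible N"
    using N by (auto simp: invertible_def)
  then obtain c where c: "lebesgue_scaling N c"
    by (rule lebesgue_scaling_exists)
  have c0: "0 < c"
    using c by (rule lebesgue_scaling_pos)
  \<comment> \<open>What remains of the exponent once the density of \<open>z = C w + D w'\<close>
    has been split off: up to a constant, the density of the deviation of \<open>w\<close> from its
    conditional mean \<open>C\<^sup>H z\<close> given \<open>z\<close>.\<close>
  define \<psi> where "\<psi> v = exp (- (norm (v :: complex^'m))\<^sup>2 - (norm (N *v (C *v v)))\<^sup>2) / pi ^ CARD('m)" for v
  have [measurable]: "\<psi> \<in> borel_measurable borel"
    unfolding \<psi>_def[abs_def] by measurable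
  have square: "gaussian_pdf w * gaussian_pdf (N *v (z - C *v w)) = gaussian_pdf z * \<psi> (- (C\<^sup>H *v z) + w)" for w z
  proof -
    define v where "v = w - C\<^sup>H *v z"
    have w: "w = v + C\<^sup>H *v z"
      by (simp add: v_def)
    have CCz: "C *v (C\<^sup>H *v z) = z - D *v (D\<^sup>H *v z)"
      by (simp add: eq_diff_eq matrix_vector_mul_assoc CD flip: matrix_vector_mult_add_rdistrib)
    have "N *v (z - C *v w) = D\<^sup>H *v z - N *v (C *v v)"
      by (simp add: w matrix_vector_right_distrib matrix_vector_mult_diff_distrib CCz DN algebra_simps)
    moreover have "(norm z)\<^sup>2 = (norm (C\<^sup>H *v z))\<^sup>2 + (norm (D\<^sup>H *v z))\<^sup>2"
      by (subst (2 3) power2_norm_eq_inner) (simp add: inner_matrix_adjoint CCz inner_diff_right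
          power2_norm_eq_inner flip: inner_matrix_adjoint')
    moreover have "(N *v (C *v v)) \<bullet> (D\<^sup>H *v z) = v \<bullet> (C\<^sup>H *v z)"
      by (simp add: DN flip: inner_matrix_adjoint)
    ultimately have "(norm w)\<^sup>2 + (norm (N *v (z - C *v w)))\<^sup>2
        = (norm z)\<^sup>2 + ((norm v)\<^sup>2 + (norm (N *v (C *v v)))\<^sup>2)"
      unfolding w by (simp add: power2_norm_eq_inner inner_add_left inner_add_right inner_diff_left
          inner_diff_right inner_commute)
    then have "exp (- (norm w)\<^sup>2) * exp (- (norm (N *v (z - C *v w)))\<^sup>2)
        = exp (- (norm z)\<^sup>2) * exp (- (norm v)\<^sup>2 - (norm (N *v (C *v v)))\<^sup>2)"
      by (simp flip: exp_add)
    then show ?thesis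
      by (simp add: \<psi>_def v_def)
  qed
  \<comment> \<open>The constant is left uncomputed: it is the same for all \<open>h\<close>, and
    \<open>h = 1\<close> shows that it is 1.\<close>
  define k where "k = ennreal c * (\<integral>\<^sup>+v. ennreal (\<psi> v) \<partial>lborel)"
  have main: "(\<integral>\<^sup>+w. (\<integral>\<^sup>+w'. h (C *v w + D *v w') \<partial>\<gamma>) \<partial>\<gamma>)
    = k * (\<integral>\<^sup>+w. h w \<partial>\<gamma>)"
    if [measurable]: "h \<in> borel_measurable borel" for h
  proof -
    have inner: "(\<integral>\<^sup>+w'. h (C *v w + D *v w') \<partial>\<gamma>)
        = ennreal c * (\<integral>\<^sup>+z. ennreal (gaussian_pdf (N *v (z - C *v w))) * h z \<partial>lborel)" for w
    proof -
      have "(\<integral>\<^sup>+w'. h (C *v w + D *v w') \<partial>\<gamma>)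
        = (\<integral>\<^sup>+w'. ennreal (gaussian_pdf w') * h (C *v w + D *v w') \<partial>lborel)"
        by (rule nn_integral_gaussian) measurable
      also have "\<dots> = ennreal c * (\<integral>\<^sup>+z. ennreal (gaussian_pdf (N *v z)) * h (C *v w + D *v (N *v z)) \<partial>lborel)"
        by (rule lebesgue_scalingD[OF c]) measurable
      also have "(\<integral>\<^sup>+z. ennreal (gaussian_pdf (N *v z)) * h (C *v w + D *v (N *v z)) \<partial>lborel)
          = (\<integral>\<^sup>+z. ennreal (gaussian_pdf (N *v (- (C *v w) + z))) * h (C *v w + (- (C *v w) + z)) \<partial>lborel)"
        unfolding DN by (rule nn_integral_lborel_translate[symmetric]) measurable
      finally show ?thesis
        by simp
    qed
    have "(\<integral>\<^sup>+w. (\<integral>\<^sup>+w'. h (C *v w + D *v w') \<partial>\<gamma>) \<partial>\<gamma>)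
      = (\<integral>\<^sup>+w. ennreal (gaussian_pdf w) * (ennreal c * (\<integral>\<^sup>+z. ennreal (gaussian_pdf (N *v (z - C *v w))) * h z \<partial>lborel)) \<partial>lborel)"
      unfolding inner by (rule nn_integral_gaussian) measurable
    also have "\<dots> = ennreal c * (\<integral>\<^sup>+w. (\<integral>\<^sup>+z. ennreal (gaussian_pdf w * gaussian_pdf (N *v (z - C *v w))) * h z \<partial>lborel) \<partial>lborel)"
    proof -
      have "ennreal (gaussian_pdf w) * (ennreal c * (\<integral>\<^sup>+z. ennreal (gaussian_pdf (N *v (z - C *v w))) * h z \<partial>lborel))
        = ennreal c * (\<integral>\<^sup>+z. ennreal (gaussian_pdf w * gaussian_pdf (N *v (z - C *v w))) * h z \<partial>lborel)" for w
      proof -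
        have "(\<integral>\<^sup>+z. ennreal (gaussian_pdf w * gaussian_pdf (N *v (z - C *v w))) * h z \<partial>lborel)
          = (\<integral>\<^sup>+z. ennreal (gaussian_pdf w) * (ennreal (gaussian_pdf (N *v (z - C *v w))) * h z) \<partial>lborel)"
          by (intro nn_integral_cong, subst ennreal_mult, simp, simp, simp only: mult.assoc)
        also have "\<dots> = ennreal (gaussian_pdf w) * (\<integral>\<^sup>+z. ennreal (gaussian_pdf (N *v (z - C *v w))) * h z \<partial>lborel)"
          by (rule nn_integral_cmult) measurable
        finally show ?thesis
          by (simp only: mult.left_commute)
      qed
      then show ?thesis
        by (simp only:) (rule nn_integral_cmult, measurable)
    qed
    also have "\<dots> = ennreal c * (\<integral>\<^sup>+z. (\<integral>\<^sup>+w. ennreal (gaussian_pdf w * gaussian_pdf (N *v (z - C *v w))) * h z \<partial>lborel) \<partial>lborel)"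
      by (subst lborel_pair.Fubini', measurable)
    also have "\<dots> = ennreal c * (\<integral>\<^sup>+z. (\<integral>\<^sup>+v. ennreal (\<psi> v) \<partial>lborel) * (ennreal (gaussian_pdf z) * h z) \<partial>lborel)"
    proof -
      have "(\<integral>\<^sup>+w. ennreal (gaussian_pdf w * gaussian_pdf (N *v (z - C *v w))) * h z \<partial>lborel)
        = (\<integral>\<^sup>+w. ennreal (\<psi> (- (C\<^sup>H *v z) + w)) * (ennreal (gaussian_pdf z) * h z) \<partial>lborel)" for z
        unfolding square by (intro nn_integral_cong, subst ennreal_mult, simp, simp add: \<psi>_def, simp only: ac_simps)
      also have "\<dots> z = (\<integral>\<^sup>+w. ennreal (\<psi> w) \<partial>lborel) * (ennreal (gaussian_pdf z) * h z)" for z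
        by (subst nn_integral_multc, measurable) (subst nn_integral_lborel_translate, measurable)
      finally show ?thesis
        by simp
    qed
    also have "\<dots> = k * (\<integral>\<^sup>+w. h w \<partial>\<gamma>)"
      by (simp add: nn_integral_gaussian k_def nn_integral_cmult mult.assoc)
    finally show ?thesis .
  qed
  have "k = 1"
    using main[of "\<lambda>_. 1"] by (simp add: gaussian.emeasure_space_1 gaussian.emeasure_space_1[simplified])
  then show ?thesis
    using main[OF g] by simp
qed

section \<open>Determinants and Lebesgue measure\<close>

text \<open>As a real linear map in dimension \<open>2 * CARD('n)\<close>, a complex matrix has
  Jacobian determinant \<open>(cmod (det T))\<^sup>2\<close>. The predicate is closed under
  products, so it is proved for unitary and simple diagonal matrices and then for whatever they
  generate.\<close>

definition det_scaling :: "complex^'n^'n \<Rightarrow> bool" where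
  "det_scaling T \<longleftrightarrow> invertible T \<and> lebesgue_scaling T ((cmod (det T))\<^sup>2)"

lemma det_scaling_mult: "det_scaling S \<Longrightarrow> det_scaling T \<Longrightarrow> det_scaling (S ** T)"
  using lebesgue_scaling_mult[of S "(cmod (det S))\<^sup>2" T "(cmod (det T))\<^sup>2"]
  by (auto simp: det_scaling_def invertible_mult det_mul norm_mult power_mult_distrib)

lemma norm_unitary:
  assumes "U\<^sup>H ** U = mat 1"
  shows "norm (U *v v) = norm v"
proof -
  have "(norm (U *v v))\<^sup>2 = (norm v)\<^sup>2"
    by (simp add: power2_norm_eq_inner inner_matrix_adjoint matrix_vector_mul_assoc assms)
  then show ?thesis
    by simp
qed

lemma unitary_cmod_det:
  fixes U :: "complex^'n^'n"
  assumes "U\<^sup>H ** U = mat 1"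
  shows "cmod (det U) = 1"
proof -
  have "of_real ((cmod (det U))\<^sup>2) = (1 :: complex)"
    by (metis assms det_I det_mul det_mul_ctranspose mult.commute)
  then have "(cmod (det U))\<^sup>2 = 1"
    by (simp only: of_real_eq_1_iff)
  then show ?thesis
    by (metis norm_ge_zero one_power2 power2_eq_imp_eq zero_le_one)
qed

lemma unitary_invertible: "U\<^sup>H ** U = mat 1 \<Longrightarrow> invertible U" for U :: "complex^'n^'n"
  using invertible_left_inverse by blast

lemma det_scaling_unitary:
  fixes U :: "complex^'n^'n"
  assumes U: "U\<^sup>H ** U = mat 1"
  shows "det_scaling U"
proof -
  obtain c where c: "lebesgue_scaling U c"
    using lebesgue_scaling_exists[OF unitary_invertible[OF U]] .
  moreover have "c = 1"
    using c norm_unitary[OF U] by (rule norm_isometry_scaling)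
  ultimately show ?thesis
    using unitary_invertible[OF U] by (simp add: det_scaling_def unitary_cmod_det[OF U])
qed

definition diag_at :: "'n \<Rightarrow> real \<Rightarrow> complex^'n^'n" where
  "diag_at i d = (\<chi> j k. if j = k then (if j = i then of_real d else 1) else 0)"

lemma diag_at_mult_nth: "(diag_at i d *v x) $ j = (if j = i then of_real d else 1) * x $ j"
  by (simp add: diag_at_def matrix_vector_mult_def if_distrib[of "\<lambda>a. a * _"] cong: if_cong)

lemma det_diag_at: "det (diag_at i d) = of_real d"
  by (subst det_diagonal) (auto simp: diag_at_def)

lemma ctranspose_diag_at [simp]: "(diag_at i d)\<^sup>H = diag_at i d"
  by (auto simp: vec_eq_iff diag_at_def)

lemma diag_at_mult: "diag_at i d ** diag_at i e = diag_at i (d * e)"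
  by (auto simp: matrix_eq diag_at_mult_nth vec_eq_iff simp flip: matrix_vector_mul_assoc)

lemma det_scaling_diag_at:
  fixes i :: "'n::finite"
  assumes d: "0 < d"
  shows "det_scaling (diag_at i d)"
proof -
  \<comment> \<open>The complex coordinate \<open>i\<close> is a pair of real ones, along
    \<open>axis i 1\<close> and \<open>axis i \<i>\<close>; both are scaled, whence the factor
    \<open>d\<^sup>2\<close>.\<close>
  define c :: "complex^'n \<Rightarrow> real" where "c b = (if b = axis i 1 \<or> b = axis i \<i> then d else 1)" for b
  have T: "diag_at i d *v x = 0 + (\<Sum>j\<in>Basis. (c j * (x \<bullet> j)) *\<^sub>R j)" for x
  proof (rule euclidean_eqI)
    fix b :: "complex^'n" assume b: "b \<in> Basis"
    then have "(diag_at i d *v x) \<bullet> b = c b * (x \<bullet> b)"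
      by (auto simp: Basis_vec_complex inner_axis c_def diag_at_mult_nth axis_eq_axis inner_complex_def)
    then show "(diag_at i d *v x) \<bullet> b = (0 + (\<Sum>j\<in>Basis. (c j * (x \<bullet> j)) *\<^sub>R j)) \<bullet> b"
      using b by (simp add: inner_sum_left_Basis)
  qed
  have "(\<Prod>b\<in>Basis. \<bar>c b\<bar>) = (\<Prod>b\<in>(\<lambda>i. axis i 1) ` UNIV. c b) * (\<Prod>b\<in>(\<lambda>i. axis i \<i>) ` UNIV. c b)"
    using d unfolding Basis_vec_complex
    by (subst prod.union_disjoint) (auto simp: axis_eq_axis complex_eq_iff c_def intro!: arg_cong2[where f="(*)"] prod.cong)
  also have "(\<Prod>b\<in>(\<lambda>i. axis i (1::complex)) ` UNIV. c b) = d"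
    by (subst prod.reindex) (auto simp: inj_on_def axis_eq_axis c_def o_def complex_eq_iff)
  also have "(\<Prod>b\<in>(\<lambda>i. axis i \<i>) ` UNIV. c b) = d"
    by (subst prod.reindex) (auto simp: inj_on_def axis_eq_axis c_def o_def complex_eq_iff)
  finally have prod: "(\<Prod>b\<in>Basis. \<bar>c b\<bar>) = d\<^sup>2"
    by (simp add: power2_eq_square)
  have lborel_eq: "lborel = density (distr lborel borel ((*v) (diag_at i d))) (\<lambda>_. ennreal (d\<^sup>2))"
    using lborel_affine_euclidean[of c 0] d unfolding T[symmetric] prod by (simp add: c_def)
  have "(\<integral>\<^sup>+v. g v \<partial>lborel) = ennreal (d\<^sup>2) * (\<integral>\<^sup>+v. g (diag_at i d *v v) \<partial>lborel)"
    if [measurable]: "g \<in> borel_measurable borel" for g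
  proof -
    have "(\<integral>\<^sup>+v. g v \<partial>lborel) = (\<integral>\<^sup>+v. g v \<partial>density (distr lborel borel ((*v) (diag_at i d))) (\<lambda>_. ennreal (d\<^sup>2)))"
      by (rule arg_cong[OF lborel_eq])
    also have "\<dots> = ennreal (d\<^sup>2) * (\<integral>\<^sup>+v. g (diag_at i d *v v) \<partial>lborel)"
      by (simp add: nn_integral_density nn_integral_distr nn_integral_cmult)
    finally show ?thesis .
  qed
  then have "lebesgue_scaling (diag_at i d) (d\<^sup>2)"
    unfolding lebesgue_scaling_def using d by (intro conjI allI impI zero_less_power)
  then show ?thesis
    using d by (simp add: det_scaling_def det_diag_at invertible_det_nz)
qed

section \<open>Factors of the identity plus a positive semidefinite matrix\<close>

lemma norm_axis: "norm (axis i a :: complex^'n) = norm a"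
  by (simp add: norm_eq_sqrt_inner inner_axis')

lemma cinner_diff: "cinner (x - y) v = cinner x v - cinner y v"
  by (simp add: cinner_def left_diff_distrib sum_subtractf)

text \<open>A Householder reflection: the phase of \<open>e\<close> makes \<open>cinner g e\<close> real.\<close>

lemma unitary_to_axis:
  fixes g :: "complex^'n"
  obtains U :: "complex^'n^'n" and \<theta> :: complex
  where "U\<^sup>H = U" "U ** U = mat 1" "cmod \<theta> = 1" "U *v g = axis i (of_real (norm g) * \<theta>)"
proof -
  \<comment> \<open>The phase of entry \<open>i\<close> of \<open>g\<close>. If that entry vanishes,
    any phase makes \<open>cinner g e\<close> real, and 1 is taken.\<close>
  define \<theta> where "\<theta> = (if g $ i = 0 then 1 else g $ i / of_real (cmod (g $ i)))"
  have \<theta>: "cmod \<theta> = 1"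
    by (simp add: \<theta>_def norm_divide)
  define e :: "complex^'n" where "e = axis i (of_real (norm g) * \<theta>)"
  have "g $ i * cnj \<theta> = of_real (cmod (g $ i))"
    by (simp add: \<theta>_def complex_norm_square[symmetric] power2_eq_square del: of_real_power)
  then have ge: "cinner g e = of_real (norm g * cmod (g $ i))"
    by (simp add: cinner_def e_def axis_def if_distrib[of cnj] if_distrib[of "\<lambda>a. _ * a"] mult.left_commute cong: if_cong)
  have ee: "norm e = norm g"
    by (simp add: e_def norm_axis norm_mult \<theta>)
  then have ee2: "e \<bullet> e = g \<bullet> g"
    by (simp add: norm_eq_sqrt_inner)
  define v where "v = g - e"
  \<comment> \<open>With this value the coefficient \<open>2 * cinner g v / (norm v)\<^sup>2\<close>
    of the reflection is 1, so \<open>g\<close> is sent to \<open>g - v = e\<close>.\<close>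
  have vg: "cinner g v = of_real ((norm v)\<^sup>2 / 2)"
  proof -
    have "(norm v)\<^sup>2 = 2 * (norm g)\<^sup>2 - 2 * Re (cinner g e)"
      by (simp add: v_def Re_cinner power2_norm_eq_inner inner_diff_left inner_diff_right inner_commute ee2)
    moreover have "cinner g v = cinner g g - cinner g e"
      by (simp add: v_def cinner_def algebra_simps sum_subtractf)
    ultimately show ?thesis
      by (simp add: cinner_self ge complex_eq_iff)
  qed
  show thesis
  proof (cases "v = 0")
    case True
    then show thesis
      using \<theta> by (intro that[of "mat 1" \<theta>]) (auto simp: v_def e_def)
  next
    case False
    define s where "s = 2 / (norm v)\<^sup>2"
    define U where "U = mat 1 - s *\<^sub>R outer v v"
    have Ux: "U *v x = x - (of_real s * cinner x v) *s v" for x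
      by (simp add: U_def matrix_vector_mult_diff_rdistrib scaleR_matrix_vector outer_mult_vec)
         (simp add: vec_eq_iff scaleR_conv_of_real[where 'a=complex])
    have "U *v (U *v x) = x" for x
    proof -
      have 1: "cinner (U *v x) v = - cinner x v"
      proof -
        have "cinner (U *v x) v = cinner x v - of_real s * cinner x v * cinner v v"
          by (simp add: Ux cinner_diff cinner_scale)
        also have "of_real s * cinner x v * cinner v v = 2 * cinner x v"
          using False by (simp add: s_def cinner_self)
        finally show ?thesis
          by simp
      qed
      have "U *v (U *v x) = U *v x - (of_real s * cinner (U *v x) v) *s v"
        by (rule Ux)
      also have "\<dots> = x"
        unfolding 1 by (simp add: Ux vec_eq_iff)
      finally show ?thesis .
    qed
    then have "U ** U = mat 1"
      by (simp add: matrix_eq flip: matrix_vector_mul_assoc)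
    moreover have "U *v g = e"
      unfolding Ux vg using False by (simp add: v_def s_def vec_eq_iff)
    moreover have "U\<^sup>H = U"
      by (simp add: U_def ctranspose_diff ctranspose_scaleR)
    ultimately show thesis
      using \<theta> by (intro that[of U \<theta>]) (auto simp: e_def)
  qed
qed

text \<open>A unitary \<open>U\<close> carries \<open>g\<close> to a multiple \<open>e\<close> of a
  basis vector. Then \<open>mat 1 + outer e e\<close> is diagonal with at most one entry,
  \<open>1 + (norm g)\<^sup>2\<close>, different from 1; its square root is \<open>d\<close>, and
  \<open>U\<close> carries the factorisation back.\<close>

lemma rank_one_factor:
  fixes g :: "complex^'n"
  obtains R :: "complex^'n^'n"
  where "det_scaling R" "R ** R\<^sup>H = mat 1 + outer g g" "(cmod (det R))\<^sup>2 = 1 + (norm g)\<^sup>2"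
proof -
  fix i :: 'n
  obtain U :: "complex^'n^'n" and \<theta> :: complex
    where U: "U\<^sup>H = U" "U ** U = mat 1" and \<theta>: "cmod \<theta> = 1" and Ug: "U *v g = axis i (of_real (norm g) * \<theta>)"
    by (rule unitary_to_axis)
  define e :: "complex^'n" where "e = axis i (of_real (norm g) * \<theta>)"
  define d where "d = sqrt (1 + (norm g)\<^sup>2)"
  have d: "0 < d" "d\<^sup>2 = 1 + (norm g)\<^sup>2"
    by (simp_all add: d_def add_pos_nonneg)
  have unit: "U\<^sup>H ** U = mat 1"
    by (simp add: U)
  have "\<theta> * cnj \<theta> = 1"
    using \<theta> by (simp add: complex_norm_square[symmetric])
  then have e2: "of_real (norm g) * \<theta> * cnj (of_real (norm g) * \<theta>) = of_real ((norm g)\<^sup>2)"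
    by (simp add: complex_norm_square[symmetric] norm_mult \<theta> power_mult_distrib del: complex_cnj_mult)
  have "d * d = 1 + (norm g)\<^sup>2"
    using d(2) by (simp add: power2_eq_square)
  then have "diag_at i d ** diag_at i d = diag_at i (1 + (norm g)\<^sup>2)"
    by (simp only: diag_at_mult)
  also have "\<dots> = mat 1 + outer e e"
    using e2 by (auto simp: vec_eq_iff diag_at_def mat_def e_def axis_def)
  finally have "diag_at i d ** diag_at i d = mat 1 + outer e e" .
  moreover have "U *v e = g"
    unfolding e_def Ug[symmetric] by (simp add: matrix_vector_mul_assoc U)
  ultimately have "U ** diag_at i d ** (U ** diag_at i d)\<^sup>H = mat 1 + outer g g"
    by (simp add: ctranspose_mul U)
      (metis (no_types, opaque_lifting) U matrix_mult_distribs(1,2) matrix_mul_assoc matrix_mul_rid matrix_mult_outer outer_matrix_mult)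
  moreover have "det_scaling (U ** diag_at i d)"
    by (intro det_scaling_mult det_scaling_unitary det_scaling_diag_at unit d)
  moreover have "(cmod (det (U ** diag_at i d)))\<^sup>2 = 1 + (norm g)\<^sup>2"
    by (simp add: det_mul det_diag_at norm_mult unitary_cmod_det[OF unit] d)
  ultimately show thesis
    using that by blast
qed

lemma det_one_plus_outer:
  fixes g :: "complex^'n"
  shows "det (mat 1 + outer g g) = of_real (1 + (norm g)\<^sup>2)"
  by (rule rank_one_factor[of g]) (metis det_mul_ctranspose)

lemma mul_ctranspose_eq_sum_outer:
  "B ** B\<^sup>H = (\<Sum>k\<in>UNIV. outer (column k B) (column k B))"
  by (simp add: vec_eq_iff matrix_matrix_mult_def column_def)

text \<open>One column \<open>b\<close> of \<open>B\<close> at a time: if \<open>T g = b\<close>,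
  then \<open>T T\<^sup>H + b b\<^sup>H = T (1 + g g\<^sup>H) T\<^sup>H\<close>, so \<open>T\<close>
  is multiplied by a rank-one factor. The product stays in \<open>det_scaling\<close>, which ties
  its Jacobian factor to the determinant.\<close>

lemma one_plus_factor:
  fixes B :: "complex^'k^'n"
  obtains T :: "complex^'n^'n" where "det_scaling T" "T ** T\<^sup>H = mat 1 + B ** B\<^sup>H"
proof -
  have "\<exists>T. det_scaling T \<and> T ** T\<^sup>H = mat 1 + (\<Sum>k\<in>F. outer (column k B) (column k B))"
    if "finite F" for F
    using that
  proof induction
    case empty
    then show ?case
      by (intro exI[of _ "mat 1"]) (simp add: det_scaling_unitary)
  next
    case (insert k F)
    then obtain T where T: "det_scaling T" "T ** T\<^sup>H = mat 1 + (\<Sum>k\<in>F. outer (column k B) (column k B))"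
      by blast
    obtain N where N: "T ** N = mat 1"
      using T(1) by (auto simp: det_scaling_def invertible_def)
    define g where "g = N *v column k B"
    have Tg: "T *v g = column k B"
      by (simp add: g_def matrix_vector_mul_assoc N)
    obtain R where R: "det_scaling R" "R ** R\<^sup>H = mat 1 + outer g g"
      by (rule rank_one_factor[of g]) auto
    have "T ** R ** (T ** R)\<^sup>H = T ** (R ** R\<^sup>H) ** T\<^sup>H"
      by (simp add: ctranspose_mul matrix_mul_assoc)
    also have "\<dots> = T ** T\<^sup>H + outer (T *v g) (T *v g)"
      by (simp add: R matrix_mult_distribs matrix_mult_outer outer_matrix_mult)
    finally show ?case
      using insert.hyps det_scaling_mult[OF T(1) R(1)]
      by (intro exI[of _ "T ** R"]) (simp add: T Tg algebra_simps)
  qed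
  from this[of UNIV] show thesis
    using that by (auto simp: mul_ctranspose_eq_sum_outer)
qed

section \<open>Moments\<close>

lemma borel_measurable_vec_nth_complex [measurable]:
  fixes X :: "'w \<Rightarrow> complex^'n"
  assumes "X \<in> borel_measurable M"
  shows "(\<lambda>\<omega>. X \<omega> $ i) \<in> borel_measurable M"
proof -
  have "(\<lambda>x :: complex^'n. x $ i) \<in> borel_measurable borel"
    by (intro borel_measurable_continuous_onI continuous_intros)
  from measurable_compose[OF assms this] show ?thesis .
qed

lemma borel_measurable_cnj [measurable]:
  assumes "f \<in> borel_measurable M"
  shows "(\<lambda>x. cnj (f x)) \<in> borel_measurable M"
proof -
  have "cnj \<in> borel_measurable borel"
    by (intro borel_measurable_continuous_onI continuous_intros)
  from measurable_compose[OF assms this] show ?thesis .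
qed

lemma integrable_norm_square_nth:
  fixes X :: "'w \<Rightarrow> complex^'n"
  assumes "prob_space M" and [measurable]: "X \<in> borel_measurable M"
    and sq: "integrable M (\<lambda>\<omega>. (norm (X \<omega>))\<^sup>2)"
  shows "integrable M (\<lambda>\<omega>. X \<omega> $ i)" "integrable M (\<lambda>\<omega>. X \<omega> $ i * cnj (X \<omega> $ j))"
proof -
  interpret prob_space M by fact
  have n1: "norm (X \<omega>) \<le> 1 + (norm (X \<omega>))\<^sup>2" for \<omega>
    using sum_squares_bound[of 1 "norm (X \<omega>)"] norm_ge_zero[of "X \<omega>"] unfolding power_one by linarith
  have "integrable M X"
    by (rule Bochner_Integration.integrable_bound[of _ "\<lambda>\<omega>. 1 + (norm (X \<omega>))\<^sup>2"]) (auto simp: sq n1)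
  then show "integrable M (\<lambda>\<omega>. X \<omega> $ i)"
    by (rule Bochner_Integration.integrable_bound) (auto simp: Finite_Cartesian_Product.norm_nth_le)
  show "integrable M (\<lambda>\<omega>. X \<omega> $ i * cnj (X \<omega> $ j))"
    by (rule Bochner_Integration.integrable_bound[OF sq])
       (auto simp: norm_mult power2_eq_square Finite_Cartesian_Product.norm_nth_le intro!: mult_mono)
qed

lemma norm_matrix_vector_bound:
  fixes A :: "complex^'n^'m"
  obtains B where "0 \<le> B" "\<And>x. norm (A *v x) \<le> B * norm x"
proof -
  have "bounded_linear ((*v) A)"
    by (rule linear_conv_bounded_linear[THEN iffD1]) auto
  then obtain B where "0 \<le> B" "\<And>x. norm (A *v x) \<le> norm x * B"
    using bounded_linear.nonneg_bounded by blast
  then show thesis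
    by (intro that[of B]) (auto simp: mult.commute)
qed

lemma has_covariance_matrix_vector:
  fixes X :: "'w \<Rightarrow> complex^'n" and A :: "complex^'n^'m"
  assumes M: "prob_space M" and X [measurable]: "X \<in> borel_measurable M" and cov: "has_covariance M X K"
  shows "has_covariance M (\<lambda>\<omega>. A *v X \<omega>) (A ** K ** A\<^sup>H)"
proof -
  interpret prob_space M by fact
  have sq: "integrable M (\<lambda>\<omega>. (norm (X \<omega>))\<^sup>2)"
    using cov by (simp add: has_covariance_def)
  note int = integrable_norm_square_nth[OF M X sq]
  define m where "m i = (\<integral>\<omega>. X \<omega> $ i \<partial>M)" for i
  have K: "(\<integral>\<omega>. (X \<omega> $ i - m i) * cnj (X \<omega> $ j - m j) \<partial>M) = K $ i $ j" for i j
    using cov by (simp add: has_covariance_def m_def)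
  have intK: "integrable M (\<lambda>\<omega>. (X \<omega> $ i - m i) * cnj (X \<omega> $ j - m j))" for i j
    unfolding complex_cnj_diff left_diff_distrib right_diff_distrib
    by (intro Bochner_Integration.integrable_diff integrable_mult_right integrable_mult_left integrable_cnj int) auto
  obtain B where B: "0 \<le> B" "\<And>x. norm (A *v x) \<le> B * norm x"
    using norm_matrix_vector_bound[of A] by blast
  have "integrable M (\<lambda>\<omega>. (norm (A *v X \<omega>))\<^sup>2)"
  proof (rule Bochner_Integration.integrable_bound[of _ "\<lambda>\<omega>. B\<^sup>2 * (norm (X \<omega>))\<^sup>2"])
    show "AE \<omega> in M. norm ((norm (A *v X \<omega>))\<^sup>2) \<le> norm (B\<^sup>2 * (norm (X \<omega>))\<^sup>2)"
      using power_mono[OF B(2), of _ 2] by (auto simp: power_mult_distrib)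
  qed (use sq in auto)
  moreover have mean: "(\<integral>\<omega>. (A *v X \<omega>) $ i \<partial>M) = (\<Sum>k\<in>UNIV. A $ i $ k * m k)" for i
    unfolding matrix_vector_mult_def m_def using int by simp
  moreover have "(\<integral>\<omega>. ((A *v X \<omega>) $ i - (\<Sum>k\<in>UNIV. A $ i $ k * m k)) *
      cnj ((A *v X \<omega>) $ j - (\<Sum>k\<in>UNIV. A $ j $ k * m k)) \<partial>M) = (A ** K ** A\<^sup>H) $ i $ j" for i j
  proof -
    have "((A *v X \<omega>) $ i - (\<Sum>k\<in>UNIV. A $ i $ k * m k)) *
      cnj ((A *v X \<omega>) $ j - (\<Sum>k\<in>UNIV. A $ j $ k * m k))
      = (\<Sum>l\<in>UNIV. \<Sum>k\<in>UNIV. A $ i $ k * ((X \<omega> $ k - m k) * cnj (X \<omega> $ l - m l)) * cnj (A $ j $ l))" for \<omega>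
    proof -
      have diff: "(A *v X \<omega>) $ i - (\<Sum>k\<in>UNIV. A $ i $ k * m k) = (\<Sum>k\<in>UNIV. A $ i $ k * (X \<omega> $ k - m k))" for i
        by (simp add: matrix_vector_mult_def sum_subtractf right_diff_distrib)
      show ?thesis
        unfolding diff cnj_sum sum_product
        by (subst sum.swap) (simp add: mult.assoc mult.commute mult.left_commute)
    qed
    then have "(\<integral>\<omega>. ((A *v X \<omega>) $ i - (\<Sum>k\<in>UNIV. A $ i $ k * m k)) *
      cnj ((A *v X \<omega>) $ j - (\<Sum>k\<in>UNIV. A $ j $ k * m k)) \<partial>M)
      = (\<Sum>l\<in>UNIV. \<Sum>k\<in>UNIV. (\<integral>\<omega>. A $ i $ k * ((X \<omega> $ k - m k) * cnj (X \<omega> $ l - m l)) * cnj (A $ j $ l) \<partial>M))"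
      by (simp only:) (subst Bochner_Integration.integral_sum, intro Bochner_Integration.integrable_sum integrable_mult_left integrable_mult_right intK,
        subst Bochner_Integration.integral_sum, intro integrable_mult_left integrable_mult_right intK, rule refl)
    also have "\<dots> = (\<Sum>l\<in>UNIV. \<Sum>k\<in>UNIV. A $ i $ k * K $ k $ l * cnj (A $ j $ l))"
      by (simp only: integral_mult_left_zero integral_mult_right_zero K)
    also have "\<dots> = (A ** K ** A\<^sup>H) $ i $ j"
      by (simp add: matrix_matrix_mult_def sum_distrib_right)
    finally show ?thesis .
  qed
  ultimately show ?thesis
    unfolding has_covariance_def by simp
qed

lemma expectation_norm_square:
  fixes X :: "'w \<Rightarrow> complex^'n"
  assumes M: "prob_space M" and X [measurable]: "X \<in> borel_measurable M" and cov: "has_covariance M X K"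
  defines "m \<equiv> \<chi> i. \<integral>\<omega>. X \<omega> $ i \<partial>M"
  shows "integrable M (\<lambda>\<omega>. (norm (X \<omega> - m))\<^sup>2)" "(\<integral>\<omega>. (norm (X \<omega> - m))\<^sup>2 \<partial>M) = Re (trace K)"
proof -
  interpret prob_space M by fact
  have sq: "integrable M (\<lambda>\<omega>. (norm (X \<omega>))\<^sup>2)"
    using cov by (simp add: has_covariance_def)
  note int = integrable_norm_square_nth[OF M X sq]
  have K: "(\<integral>\<omega>. (X \<omega> $ i - m $ i) * cnj (X \<omega> $ j - m $ j) \<partial>M) = K $ i $ j" for i j
    using cov by (simp add: has_covariance_def m_def)
  have intK: "integrable M (\<lambda>\<omega>. (X \<omega> $ i - m $ i) * cnj (X \<omega> $ j - m $ j))" for i j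
    unfolding complex_cnj_diff left_diff_distrib right_diff_distrib
    by (intro Bochner_Integration.integrable_diff integrable_mult_right integrable_mult_left integrable_cnj int) auto
  have eq: "(norm (X \<omega> - m))\<^sup>2 = Re (\<Sum>i\<in>UNIV. (X \<omega> $ i - m $ i) * cnj (X \<omega> $ i - m $ i))" for \<omega>
    unfolding power2_norm_eq_inner by (simp flip: Re_cinner) (simp add: cinner_def)
  show "integrable M (\<lambda>\<omega>. (norm (X \<omega> - m))\<^sup>2)"
    unfolding eq by (intro integrable_Re Bochner_Integration.integrable_sum intK)
  show "(\<integral>\<omega>. (norm (X \<omega> - m))\<^sup>2 \<partial>M) = Re (trace K)"
    unfolding eq by (subst integral_Re, intro Bochner_Integration.integrable_sum intK,
      subst Bochner_Integration.integral_sum, intro intK) (simp only: K trace_def)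
qed

lemma gaussian_unitary:
  fixes U :: "complex^'n^'n"
  assumes "U\<^sup>H ** U = mat 1"
  shows "distr \<gamma> borel ((*v) U) = \<gamma>"
proof (rule measure_eqI)
  fix A assume "A \<in> sets (distr \<gamma> borel ((*v) U))"
  then have [measurable]: "A \<in> sets borel"
    by simp
  have "U ** U\<^sup>H = mat 1"
    using assms by (simp add: matrix_left_right_inverse)
  \<comment> \<open>The case \<open>C = 0\<close>, \<open>D = U\<close> of the Gaussian combination;
    the outer integral is over a constant.\<close>
  then have "(\<integral>\<^sup>+w. (\<integral>\<^sup>+w'. indicator A ((0::complex^'n^'n) *v w + U *v w') \<partial>\<gamma>) \<partial>\<gamma>)
    = (\<integral>\<^sup>+w. indicator A w \<partial>\<gamma>)"
    by (intro gaussian_combination unitary_invertible[OF assms]) auto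
  then have "(\<integral>\<^sup>+w'. indicator A (U *v w') \<partial>\<gamma>) = emeasure \<gamma> A"
    by (simp add: gaussian.emeasure_space_1[simplified])
  then show "emeasure (distr \<gamma> borel ((*v) U)) A = emeasure \<gamma> A"
    by (simp add: nn_integral_distr flip: nn_integral_indicator)
qed simp

lemma gaussian_integral_unitary:
  fixes U :: "complex^'n^'n" and f :: "complex^'n \<Rightarrow> 'b::{banach, second_countable_topology}"
  assumes "U\<^sup>H ** U = mat 1" "f \<in> borel_measurable borel"
  shows "(\<integral>w. f (U *v w) \<partial>\<gamma>) = (\<integral>w. f w \<partial>\<gamma>)"
  by (subst (2) gaussian_unitary[OF assms(1), symmetric]) (simp add: integral_distr assms(2))

lemma gaussian_Basis_moment:
  fixes b :: "complex^'n"
  assumes b: "b \<in> Basis"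
  shows "integrable \<gamma> (\<lambda>w. (w \<bullet> b)\<^sup>2)" "(\<integral>w. (w \<bullet> b)\<^sup>2 \<partial>\<gamma>) = 1 / 2"
proof -
  have "(\<integral>\<^sup>+w. ennreal ((w \<bullet> b)\<^sup>2) \<partial>\<gamma>) = (\<integral>\<^sup>+w. ennreal (gaussian_pdf w) * ennreal ((w \<bullet> b)\<^sup>2) \<partial>lborel)"
    by (rule nn_integral_gaussian) auto
  \<comment> \<open>The moment is absorbed into the product as part of the factor at
    \<open>b\<close>, so that the integral splits over the real coordinates.\<close>
  also have "\<dots> = (\<integral>\<^sup>+w. (\<Prod>c\<in>Basis. ennreal ((if c = b then (w \<bullet> c)\<^sup>2 else 1) * exp (- (w \<bullet> c)\<^sup>2))) * ennreal (1 / pi ^ CARD('n)) \<partial>lborel)"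
  proof (rule nn_integral_cong)
    fix w :: "complex^'n"
    have "(\<Prod>c\<in>Basis. (if c = b then (w \<bullet> c)\<^sup>2 else 1) * exp (- (w \<bullet> c)\<^sup>2)) = (w \<bullet> b)\<^sup>2 * exp (- (norm w)\<^sup>2)"
      using b by (simp add: prod.distrib norm_squared_Basis exp_sum flip: sum_negf)
    then show "ennreal (gaussian_pdf w) * ennreal ((w \<bullet> b)\<^sup>2) =
      (\<Prod>c\<in>Basis. ennreal ((if c = b then (w \<bullet> c)\<^sup>2 else 1) * exp (- (w \<bullet> c)\<^sup>2))) * ennreal (1 / pi ^ CARD('n))"
      by (simp add: prod_ennreal mult.commute flip: ennreal_mult)
  qed
  also have "\<dots> = (\<integral>\<^sup>+(w::complex^'n). (\<Prod>c\<in>Basis. ennreal ((if c = b then (w \<bullet> c)\<^sup>2 else 1) * exp (- (w \<bullet> c)\<^sup>2))) \<partial>lborel) * ennreal (1 / pi ^ CARD('n))"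
    by (rule nn_integral_multc) measurable
  also have "(\<integral>\<^sup>+(w::complex^'n). (\<Prod>c\<in>Basis. ennreal ((if c = b then (w \<bullet> c)\<^sup>2 else 1) * exp (- (w \<bullet> c)\<^sup>2))) \<partial>lborel)
      = (\<Prod>c\<in>(Basis :: (complex^'n) set). \<integral>\<^sup>+x. ennreal ((if c = b then x\<^sup>2 else 1) * exp (- x\<^sup>2)) \<partial>lborel)"
    by (rule nn_integral_lborel_prod) auto
  also have "\<dots> = (\<Prod>c\<in>(Basis :: (complex^'n) set). ennreal ((if c = b then 1 / 2 else 1) * sqrt pi))"
    by (intro prod.cong) (auto simp: nn_integral_exp_square nn_integral_square_exp_square)
  also have "\<dots> = ennreal (1 / 2 * pi ^ CARD('n))"
    using b by (simp add: prod_ennreal prod.distrib power_mult)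
      (simp add: power2_eq_square flip: power_mult_distrib)
  finally have "(\<integral>\<^sup>+w. ennreal ((w \<bullet> b)\<^sup>2) \<partial>\<gamma>) = ennreal (1 / 2)"
    by (simp flip: ennreal_mult)
  then have "has_bochner_integral \<gamma> (\<lambda>w. (w \<bullet> b)\<^sup>2) (1 / 2)"
    by (intro has_bochner_integral_nn_integral) auto
  then show "integrable \<gamma> (\<lambda>w. (w \<bullet> b)\<^sup>2)" "(\<integral>w. (w \<bullet> b)\<^sup>2 \<partial>\<gamma>) = 1 / 2"
    by (simp_all add: has_bochner_integral_iff)
qed

lemma gaussian_integrable_norm_square:
  "integrable (\<gamma> :: (complex^'n) measure) (\<lambda>w. (norm w)\<^sup>2)"
  unfolding norm_squared_Basis by (intro Bochner_Integration.integrable_sum gaussian_Basis_moment)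

lemma gaussian_mean: "(\<integral>w. w $ i \<partial>(\<gamma> :: (complex^'n) measure)) = 0"
proof -
  let ?U = "(-1) *\<^sub>R mat 1 :: complex^'n^'n"
  have "?U\<^sup>H ** ?U = mat 1"
    by (simp only: ctranspose_scaleR scaleR_matrix_mult) simp
  from gaussian_integral_unitary[OF this, of "\<lambda>w. w $ i"]
  have "(\<integral>w. - (w $ i) \<partial>\<gamma>) = (\<integral>w. w $ i \<partial>\<gamma>)"
    by (simp only: scaleR_matrix_vector) simp
  then show ?thesis
    by (simp add: complex_eq_iff)
qed

lemma gaussian_has_covariance:
  "has_covariance (\<gamma> :: (complex^'n) measure) (\<lambda>w. w) (mat 1)"
proof -
  have "(\<integral>w. w $ i * cnj (w $ j) \<partial>(\<gamma> :: (complex^'n) measure)) = mat 1 $ i $ j" for i j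
  proof (cases "i = j")
    case True
    have eq: "w $ i * cnj (w $ i) = of_real ((w \<bullet> axis i 1)\<^sup>2 + (w \<bullet> axis i \<i>)\<^sup>2)" for w :: "complex^'n"
      by (simp add: inner_axis inner_complex_def complex_eq_iff power2_eq_square)
    have B: "axis i 1 \<in> (Basis :: (complex^'n) set)" "axis i \<i> \<in> (Basis :: (complex^'n) set)"
      by (auto simp: Basis_vec_complex)
    have "(\<integral>w. (w \<bullet> axis i 1)\<^sup>2 + (w \<bullet> axis i \<i>)\<^sup>2 \<partial>(\<gamma> :: (complex^'n) measure)) = 1"
      using gaussian_Basis_moment[OF B(1)] gaussian_Basis_moment[OF B(2)] by simp
    then have "(\<integral>w. w $ i * cnj (w $ i) \<partial>(\<gamma> :: (complex^'n) measure)) = 1"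
      unfolding eq integral_complex_of_real by simp
    then show ?thesis
      using True by (simp add: mat_def)
  next
    case False
    \<comment> \<open>Flipping the sign of coordinate \<open>i\<close> alone preserves the Gaussian
      law and negates the integrand.\<close>
    let ?U = "diag_at i (- 1) :: complex^'n^'n"
    have "?U\<^sup>H ** ?U = mat 1"
      by (simp add: diag_at_mult) (simp add: diag_at_def mat_def vec_eq_iff)
    from gaussian_integral_unitary[OF this, of "\<lambda>w. w $ i * cnj (w $ j)"]
    have "(\<integral>w. - (w $ i * cnj (w $ j)) \<partial>(\<gamma> :: (complex^'n) measure)) = (\<integral>w. w $ i * cnj (w $ j) \<partial>\<gamma>)"
      using False by (simp add: diag_at_mult_nth)
    then show ?thesis
      using False by (simp add: complex_eq_iff mat_def)
  qed
  then show ?thesis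
    unfolding has_covariance_def gaussian_mean using gaussian_integrable_norm_square by simp
qed

section \<open>Relative entropy\<close>

text \<open>
  The variational formula of Donsker and Varadhan (linearised by \<open>ln t \<le> t - 1\<close>), in nats. It needs no
  density, and as a supremum of simple functionals it is semicontinuous and monotone under channels.
\<close>

definition rel_ent :: "'s measure \<Rightarrow> 's measure \<Rightarrow> ereal" where
  "rel_ent P Q = (SUP g \<in> {g \<in> borel_measurable P. \<exists>B. \<forall>x. \<bar>g x\<bar> \<le> B}.
     ereal ((\<integral>x. g x \<partial>P) - (\<integral>x. exp (g x) \<partial>Q) + 1))"

lemma rel_ent_upper:
  "g \<in> borel_measurable P \<Longrightarrow> (\<And>x. \<bar>g x\<bar> \<le> B) \<Longrightarrow>
    ereal ((\<integral>x. g x \<partial>P) - (\<integral>x. exp (g x) \<partial>Q) + 1) \<le> rel_ent P Q"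
  unfolding rel_ent_def by (rule SUP_upper) auto

lemma rel_ent_least:
  "(\<And>g B. g \<in> borel_measurable P \<Longrightarrow> (\<And>x. \<bar>g x\<bar> \<le> B) \<Longrightarrow>
    ereal ((\<integral>x. g x \<partial>P) - (\<integral>x. exp (g x) \<partial>Q) + 1) \<le> D) \<Longrightarrow> rel_ent P Q \<le> D"
  unfolding rel_ent_def by (rule SUP_least) auto

lemma rel_ent_nonneg:
  assumes "prob_space P" "prob_space Q"
  shows "0 \<le> rel_ent P Q"
  using rel_ent_upper[of "\<lambda>_. 0" P 0 Q] assms by (simp add: prob_space.prob_space zero_ereal_def)

text \<open>The test functions \<open>c * indicator B\<close> cost nothing under \<open>Q\<close>,
  which does not charge \<open>B\<close>, while their gain \<open>c * measure P B\<close> is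
  unbounded in \<open>c\<close>.\<close>

lemma rel_ent_not_ac:
  assumes "prob_space P" "prob_space Q" and sets: "sets P = sets Q"
    and B: "B \<in> sets Q" "emeasure Q B = 0" "emeasure P B \<noteq> 0"
  shows "rel_ent P Q = \<infinity>"
proof -
  interpret P: prob_space P by fact
  interpret Q: prob_space Q by fact
  have pos: "0 < measure P B"
    using B(3) by (simp add: measure_eq_emeasure_eq_ennreal P.emeasure_eq_measure zero_less_measure_iff)
  have BP [measurable]: "B \<in> sets P" "B \<in> sets Q"
    using B(1) sets by auto
  have ge: "ereal (c * measure P B) \<le> rel_ent P Q" if "0 \<le> c" for c
  proof -
    have "AE x in Q. x \<notin> B"
      using B(1,2) by (intro AE_not_in) (auto simp: null_sets_def)
    then have "AE x in Q. exp (c * indicator B x) = 1"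
      by eventually_elim simp
    then have "(\<integral>x. exp (c * indicator B x) \<partial>Q) = (\<integral>x. 1 \<partial>Q)"
      by (intro integral_cong_AE) auto
    then have "(\<integral>x. c * indicator B x \<partial>P) - (\<integral>x. exp (c * indicator B x) \<partial>Q) + 1 = c * measure P B"
      by (simp add: Q.prob_space)
    moreover have "ereal ((\<integral>x. c * indicator B x \<partial>P) - (\<integral>x. exp (c * indicator B x) \<partial>Q) + 1) \<le> rel_ent P Q"
      by (rule rel_ent_upper[of _ _ c]) (use that in \<open>auto split: split_indicator\<close>)
    ultimately show ?thesis
      by simp
  qed
  show ?thesis
  proof (rule ccontr)
    assume "rel_ent P Q \<noteq> \<infinity>"
    then obtain D where D: "rel_ent P Q = ereal D" "0 \<le> D"
      using rel_ent_nonneg[OF assms(1,2)] by (cases "rel_ent P Q") auto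
    show False
      using ge[of "(D + 1) / measure P B"] D pos by simp
  qed
qed

section \<open>Relative entropy in terms of a density\<close>

locale prob_density = P: prob_space P + Q: prob_space Q for P Q :: "'s measure" +
  fixes f :: "'s \<Rightarrow> real"
  assumes f_measurable [measurable]: "f \<in> borel_measurable Q"
    and f_nonneg [simp]: "0 \<le> f x"
    and P_eq: "P = density Q (\<lambda>x. ennreal (f x))"
begin

lemma sets_P [measurable_cong, simp]: "sets P = sets Q"
  by (simp add: P_eq)

lemma AE_pos: "AE x in P. 0 < f x"
  by (subst P_eq, subst AE_density) auto

lemma integral_P: "h \<in> borel_measurable Q \<Longrightarrow> (\<integral>x. h x \<partial>P) = (\<integral>x. f x * h x \<partial>Q)" for h :: "'s \<Rightarrow> real"
  by (subst P_eq, rule integral_real_density) auto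

lemma integrable_P: "h \<in> borel_measurable Q \<Longrightarrow> integrable P h \<longleftrightarrow> integrable Q (\<lambda>x. f x * h x)" for h :: "'s \<Rightarrow> real"
  by (subst P_eq, rule integrable_real_density) auto

lemma integrable_f: "integrable Q f" and integral_f: "(\<integral>x. f x \<partial>Q) = 1"
  using integral_P[of "\<lambda>_. 1"] integrable_P[of "\<lambda>_. 1"] by (auto simp: P.prob_space)

text \<open>The inequality \<open>ln t \<le> t - 1\<close> at \<open>t = exp (g x) / f x\<close>,
  integrated against \<open>P\<close>; the density turns the integral of \<open>t\<close> under
  \<open>P\<close> into at most that of \<open>exp (g x)\<close> under \<open>Q\<close>.\<close>

lemma rel_ent_le:
  assumes int: "integrable P (\<lambda>x. ln (f x))"
  shows "rel_ent P Q \<le> ereal (\<integral>x. ln (f x) \<partial>P)"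
proof (rule rel_ent_least)
  fix g :: "'s \<Rightarrow> real" and B assume g: "g \<in> borel_measurable P" and B: "\<And>x. \<bar>g x\<bar> \<le> B"
  have [measurable]: "g \<in> borel_measurable Q"
    using g by simp
  have exp_B: "exp (g x) \<le> exp B" for x
    using B[of x] by simp
  have int_g: "integrable P g"
    by (rule P.integrable_const_bound[of _ B]) (use B g in auto)
  have int_exp: "integrable Q (\<lambda>x. exp (g x))"
    by (rule Q.integrable_const_bound[of _ "exp B"]) (use exp_B in auto)
  \<comment> \<open>An equality where \<open>0 < f x\<close>; where \<open>f x = 0\<close> the left
    side is 0 because \<open>a / 0 = 0\<close>.\<close>
  have le: "f x * (exp (g x) / f x) \<le> exp (g x)" for x
    by simp
  have int_f: "integrable Q (\<lambda>x. f x * (exp (g x) / f x))"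
    by (rule Bochner_Integration.integrable_bound[OF int_exp]) auto
  then have int_P: "integrable P (\<lambda>x. exp (g x) / f x)"
    by (subst integrable_P) auto
  have "(\<integral>x. g x - ln (f x) \<partial>P) \<le> (\<integral>x. exp (g x) / f x - 1 \<partial>P)"
  proof (rule integral_mono_AE)
    show "AE x in P. g x - ln (f x) \<le> exp (g x) / f x - 1"
      using AE_pos
    proof eventually_elim
      case (elim x)
      then have "ln (exp (g x) / f x) \<le> exp (g x) / f x - 1"
        by (intro ln_le_minus_one) auto
      then show ?case
        using elim by (simp add: ln_div)
    qed
  qed (use int int_g int_P in auto)
  also have "\<dots> = (\<integral>x. exp (g x) / f x \<partial>P) - 1"
    using int_P by (simp add: P.prob_space)
  also have "(\<integral>x. exp (g x) / f x \<partial>P) = (\<integral>x. f x * (exp (g x) / f x) \<partial>Q)"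
    by (rule integral_P) auto
  also have "\<dots> \<le> (\<integral>x. exp (g x) \<partial>Q)"
    by (rule integral_mono[OF int_f int_exp]) (rule le)
  finally show "ereal ((\<integral>x. g x \<partial>P) - (\<integral>x. exp (g x) \<partial>Q) + 1) \<le> ereal (\<integral>x. ln (f x) \<partial>P)"
    using int int_g by simp
qed

text \<open>The optimal test function \<open>ln (f x)\<close> is unbounded, so its truncations
  \<open>h n\<close> are used. The integrals of \<open>exp (h n x)\<close> tend to 1 by dominated
  convergence, those of \<open>h n\<close> are bounded through the finite relative entropy, and
  Fatou's lemma turns the bound into integrability of \<open>ln (f x)\<close>, which in turn
  dominates \<open>h n\<close>.\<close>

lemma rel_ent_ge:
  assumes fin: "rel_ent P Q < \<infinity>"
  shows "integrable P (\<lambda>x. ln (f x))" "ereal (\<integral>x. ln (f x) \<partial>P) \<le> rel_ent P Q"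
proof -
  obtain D where D: "rel_ent P Q = ereal D"
    using fin rel_ent_nonneg[OF P.prob_space_axioms Q.prob_space_axioms] by (cases "rel_ent P Q") auto
  \<comment> \<open>Where \<open>f x = 0\<close> the value is \<open>- real n\<close> instead of a
    truncation of the default \<open>ln 0 = 0\<close>, so that \<open>exp (h n x)\<close> tends to
    \<open>f x\<close> there as well.\<close>
  define h where "h n x = (if f x = 0 then - real n else max (- real n) (min (real n) (ln (f x))))" for n x
  have [measurable]: "h n \<in> borel_measurable Q" for n
    unfolding h_def[abs_def] by measurable
  have h_bound: "\<bar>h n x\<bar> \<le> real n" for n x
    by (auto simp: h_def)
  have h_le: "\<bar>h n x\<bar> \<le> \<bar>ln (f x)\<bar>" if "0 < f x" for n x
    using that by (auto simp: h_def)
  have h_lim: "(\<lambda>n. h n x) \<longlonglongrightarrow> ln (f x)" if "0 < f x" for x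
  proof (rule tendsto_eventually)
    have "\<forall>\<^sub>F n in sequentially. \<bar>ln (f x)\<bar> \<le> real n"
      by (rule eventually_sequentiallyI[of "nat \<lceil>\<bar>ln (f x)\<bar>\<rceil>"]) linarith
    then show "\<forall>\<^sub>F n in sequentially. h n x = ln (f x)"
      by eventually_elim (use that in \<open>auto simp: h_def\<close>)
  qed
  have exp_lim: "(\<lambda>n. exp (h n x)) \<longlonglongrightarrow> f x" for x
  proof (cases "f x = 0")
    case True
    then have "(\<lambda>n. exp (h n x)) = (\<lambda>n. exp (- real n))"
      by (simp add: h_def fun_eq_iff)
    moreover have "(\<lambda>n. exp (- real n)) \<longlonglongrightarrow> 0"
      by (rule filterlim_compose[OF exp_at_bot]) (simp add: filterlim_uminus_at_bot filterlim_real_sequentially)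
    ultimately show ?thesis
      using True by simp
  next
    case False
    then have pos: "0 < f x"
      using f_nonneg[of x] by linarith
    show ?thesis
      using tendsto_exp[OF h_lim[OF pos]] pos by simp
  qed
  have exp_le: "exp (h n x) \<le> f x + 1" for n x
  proof (cases "0 < f x \<and> 0 \<le> ln (f x)")
    case True
    then have "h n x \<le> ln (f x)"
      by (auto simp: h_def)
    then have "exp (h n x) \<le> f x"
      using True by (metis exp_le_cancel_iff exp_ln)
    then show ?thesis
      by simp
  next
    case False
    then have "h n x \<le> 0"
    proof (cases "f x = 0")
      case True
      then show ?thesis
        by (simp add: h_def)
    next
      case nz: False
      then have "ln (f x) < 0"
        using False f_nonneg[of x] by linarith
      then show ?thesis
        using nz by (simp add: h_def)
    qed
    then have "exp (h n x) \<le> 1"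
      by simp
    then show ?thesis
      using f_nonneg[of x] by linarith
  qed
  have int_dom: "integrable Q (\<lambda>x. f x + 1)"
    using integrable_f by simp
  have int_exp: "integrable Q (\<lambda>x. exp (h n x))" for n
    by (rule Bochner_Integration.integrable_bound[OF int_dom]) (use exp_le in auto)
  have int_h: "integrable P (h n)" for n
    by (rule P.integrable_const_bound[of _ "real n"]) (use h_bound in auto)
  have lim_exp: "(\<lambda>n. \<integral>x. exp (h n x) \<partial>Q) \<longlonglongrightarrow> 1"
    unfolding integral_f[symmetric]
    by (rule integral_dominated_convergence[where w="\<lambda>x. f x + 1"])
       (use exp_lim exp_le int_dom in auto)
  have upper: "(\<integral>x. h n x \<partial>P) \<le> D + (\<integral>x. exp (h n x) \<partial>Q) - 1" for n
    using rel_ent_upper[of "h n" P "real n" Q] h_bound by (simp add: D)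
  have exp2: "(\<integral>x. exp (h n x) \<partial>Q) \<le> 2" for n
  proof -
    have "(\<integral>x. exp (h n x) \<partial>Q) \<le> (\<integral>x. f x + 1 \<partial>Q)"
      by (rule integral_mono[OF int_exp int_dom exp_le])
    then show ?thesis
      using integrable_f by (simp add: integral_f Q.prob_space)
  qed
  \<comment> \<open>The negative part of the log density is integrable under \<open>P\<close> in
    every case, since \<open>f x * neg x \<le> 1\<close>; an upper bound on the integrals of
    \<open>h n\<close> therefore bounds those of \<open>\<bar>h n x\<bar>\<close>.\<close>
  define neg where "neg x = max 0 (- ln (f x))" for x
  have [measurable]: "neg \<in> borel_measurable Q"
    unfolding neg_def[abs_def] by measurable
  have "f x * neg x \<le> 1" for x
  proof (cases "0 < f x \<and> f x < 1")
    case True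
    have "- ln (f x) = ln (1 / f x)"
      using True by (simp add: ln_div)
    also have "\<dots> \<le> 1 / f x - 1"
      using True by (intro ln_le_minus_one) auto
    finally have "f x * (- ln (f x)) \<le> f x * (1 / f x - 1)"
      using True by (intro mult_left_mono) auto
    then show ?thesis
      using True by (simp add: neg_def right_diff_distrib)
  next
    case False
    then have "f x = 0 \<or> neg x = 0"
      using f_nonneg[of x] by (auto simp: neg_def less_le)
    then show ?thesis
      by auto
  qed
  moreover have neg0: "0 \<le> neg x" for x
    by (simp add: neg_def)
  ultimately have int_neg: "integrable P neg"
    by (subst integrable_P) (auto intro!: Q.integrable_const_bound[of _ 1])
  have abs_h: "\<bar>h n x\<bar> \<le> h n x + 2 * neg x" if "0 < f x" for n x
    using that by (auto simp: h_def neg_def)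
  have bound: "(\<integral>\<^sup>+x. ennreal \<bar>h n x\<bar> \<partial>P) \<le> ennreal (D + 1 + 2 * (\<integral>x. neg x \<partial>P))" for n
  proof -
    have "(\<integral>\<^sup>+x. ennreal \<bar>h n x\<bar> \<partial>P) = ennreal (\<integral>x. \<bar>h n x\<bar> \<partial>P)"
      using int_h by (intro nn_integral_eq_integral) auto
    also have "(\<integral>x. \<bar>h n x\<bar> \<partial>P) \<le> (\<integral>x. h n x + 2 * neg x \<partial>P)"
      by (rule integral_mono_AE) (use AE_pos int_h int_neg abs_h in auto)
    also have "\<dots> = (\<integral>x. h n x \<partial>P) + 2 * (\<integral>x. neg x \<partial>P)"
      using int_h int_neg by simp
    also have "\<dots> \<le> D + 1 + 2 * (\<integral>x. neg x \<partial>P)"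
      using upper[of n] exp2[of n] by simp
    finally show ?thesis
      by (simp add: ennreal_leI)
  qed
  have "(\<integral>\<^sup>+x. ennreal \<bar>ln (f x)\<bar> \<partial>P) = (\<integral>\<^sup>+x. liminf (\<lambda>n. ennreal \<bar>h n x\<bar>) \<partial>P)"
  proof (rule nn_integral_cong_AE)
    show "AE x in P. ennreal \<bar>ln (f x)\<bar> = liminf (\<lambda>n. ennreal \<bar>h n x\<bar>)"
      using AE_pos
      by eventually_elim (intro lim_imp_Liminf[symmetric] tendsto_ennrealI tendsto_rabs h_lim, auto)
  qed
  also have "\<dots> \<le> liminf (\<lambda>n. \<integral>\<^sup>+x. ennreal \<bar>h n x\<bar> \<partial>P)"
    by (rule nn_integral_liminf) auto
  also have "\<dots> \<le> ennreal (D + 1 + 2 * (\<integral>x. neg x \<partial>P))"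
    by (rule order_trans[OF Liminf_le_Limsup]) (auto intro!: Limsup_bounded always_eventually bound)
  finally show int: "integrable P (\<lambda>x. ln (f x))"
    by (intro integrableI_bounded) (auto simp: less_top[symmetric] top_unique)
  have "(\<lambda>n. \<integral>x. h n x \<partial>P) \<longlonglongrightarrow> (\<integral>x. ln (f x) \<partial>P)"
  proof (rule integral_dominated_convergence[where w="\<lambda>x. \<bar>ln (f x)\<bar>"])
    show "AE x in P. (\<lambda>n. h n x) \<longlonglongrightarrow> ln (f x)"
      using AE_pos by eventually_elim (rule h_lim)
    show "AE x in P. norm (h n x) \<le> \<bar>ln (f x)\<bar>" for n
      using AE_pos by eventually_elim (simp add: h_le)
  qed (use int in auto)
  moreover have "(\<lambda>n. D + (\<integral>x. exp (h n x) \<partial>Q) - 1) \<longlonglongrightarrow> D + 1 - 1"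
    by (intro tendsto_intros lim_exp)
  ultimately have "(\<integral>x. ln (f x) \<partial>P) \<le> D + 1 - 1"
    by (rule LIMSEQ_le) (use upper in auto)
  then show "ereal (\<integral>x. ln (f x) \<partial>P) \<le> rel_ent P Q"
    by (simp add: D)
qed

lemma rel_ent_eq: "integrable P (\<lambda>x. ln (f x)) \<Longrightarrow> rel_ent P Q = ereal (\<integral>x. ln (f x) \<partial>P)"
  using rel_ent_le le_less_trans[OF rel_ent_le] by (intro antisym rel_ent_ge(2)) auto

end

lemma prob_density_exists:
  assumes "prob_space P" "prob_space Q" and sets: "sets P = sets Q" and ac: "absolutely_continuous Q P"
  shows "prob_density P Q (\<lambda>x. enn2real (RN_deriv Q P x))"
proof -
  interpret P: prob_space P by fact
  interpret Q: prob_space Q by fact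
  show ?thesis
  proof unfold_locales
    have "AE x in Q. RN_deriv Q P x \<noteq> \<infinity>"
      by (rule Q.RN_deriv_finite) (use ac sets in \<open>auto intro: P.sigma_finite_measure_axioms\<close>)
    then have "density Q (\<lambda>x. ennreal (enn2real (RN_deriv Q P x))) = density Q (RN_deriv Q P)"
      by (intro density_cong) (auto simp: less_top)
    then show "P = density Q (\<lambda>x. ennreal (enn2real (RN_deriv Q P x)))"
      using Q.density_RN_deriv[OF ac sets] by simp
  qed auto
qed

lemma rel_ent_finite_imp_density:
  assumes "prob_space P" "prob_space Q" "sets P = sets Q" "rel_ent P Q < \<infinity>"
  obtains f where "prob_density P Q f"
proof -
  have "absolutely_continuous Q P"
    unfolding absolutely_continuous_def
  proof
    fix B assume "B \<in> null_sets Q"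
    then show "B \<in> null_sets P"
      using rel_ent_not_ac[OF assms(1-3), of B] assms(3,4) by (auto simp: null_sets_def)
  qed
  then show thesis
    using that prob_density_exists[OF assms(1-3)] by blast
qed

text \<open>The cases in which \<open>mutual_info\<close> is set to infinity are exactly those of
  infinite \<open>rel_ent\<close>, by \<open>rel_ent_not_ac\<close> and \<open>rel_ent_ge\<close>;
  otherwise both are the integral of the log density. Division by \<open>ln 2\<close> converts nats
  to bits.\<close>

lemma mutual_info_eq_rel_ent:
  assumes M: "prob_space M" and [measurable]: "X \<in> M \<rightarrow>\<^sub>M S" "Y \<in> M \<rightarrow>\<^sub>M T"
  shows "mutual_info M S T X Y =
    rel_ent (distr M (S \<Otimes>\<^sub>M T) (\<lambda>\<omega>. (X \<omega>, Y \<omega>))) (distr M S X \<Otimes>\<^sub>M distr M T Y) / ereal (ln 2)"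
proof -
  interpret M: prob_space M by fact
  define P where "P = distr M (S \<Otimes>\<^sub>M T) (\<lambda>\<omega>. (X \<omega>, Y \<omega>))"
  define Q where "Q = distr M S X \<Otimes>\<^sub>M distr M T Y"
  have P: "prob_space P"
    unfolding P_def by (rule M.prob_space_distr) measurable
  interpret X: prob_space "distr M S X"
    by (rule M.prob_space_distr) measurable
  interpret Y: prob_space "distr M T Y"
    by (rule M.prob_space_distr) measurable
  interpret XY: pair_prob_space "distr M S X" "distr M T Y" ..
  have Q: "prob_space Q"
    unfolding Q_def by (rule XY.prob_space_axioms)
  have sets: "sets P = sets Q"
    unfolding P_def Q_def by (simp cong: sets_pair_measure_cong)
  have mi: "prob_space.mutual_information M 2 S T X Y = (\<integral>x. entropy_density 2 Q P x \<partial>P)"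
    by (simp add: M.mutual_information_def KL_divergence_def P_def Q_def)
  show ?thesis
  proof (cases "absolutely_continuous Q P")
    case True
    then interpret prob_density P Q "\<lambda>x. enn2real (RN_deriv Q P x)"
      by (intro prob_density_exists P Q sets)
    have ed: "entropy_density 2 Q P = (\<lambda>x. ln (enn2real (RN_deriv Q P x)) / ln 2)"
      by (simp add: entropy_density_def log_def fun_eq_iff)
    show ?thesis
    proof (cases "integrable P (\<lambda>x. ln (enn2real (RN_deriv Q P x)))")
      case int: True
      then show ?thesis
        using True rel_ent_eq[OF int]
        by (simp add: mutual_info_def Let_def ed mi flip: P_def Q_def)
    next
      case False
      then have "rel_ent P Q = \<infinity>"
        using rel_ent_ge(1) by (auto simp: less_top[symmetric] top_ereal_def)
      moreover have "\<not> integrable P (entropy_density 2 Q P)"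
        using False integrable_mult_left[of "ln 2" P "entropy_density 2 Q P"] by (auto simp: ed)
      ultimately show ?thesis
        by (simp add: mutual_info_def Let_def flip: P_def Q_def)
    qed
  next
    case False
    then obtain B where "B \<in> null_sets Q" "B \<notin> null_sets P"
      by (auto simp: absolutely_continuous_def)
    then have "rel_ent P Q = \<infinity>"
      by (intro rel_ent_not_ac[OF P Q sets, of B]) (auto simp: null_sets_def sets)
    then show ?thesis
      using False by (simp add: mutual_info_def Let_def flip: P_def Q_def)
  qed
qed

section \<open>Data processing and the chain rule\<close>

lemma rel_ent_distr_le:
  fixes T :: "'a \<Rightarrow> 'b"
  assumes T: "T \<in> P \<rightarrow>\<^sub>M N" and sets: "sets Q = sets P"
  shows "rel_ent (distr P N T) (distr Q N T) \<le> rel_ent P Q"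
proof (rule rel_ent_least)
  fix g :: "'b \<Rightarrow> real" and B assume g: "g \<in> borel_measurable (distr P N T)" and B: "\<And>x. \<bar>g x\<bar> \<le> B"
  have [measurable]: "g \<in> borel_measurable N" "T \<in> P \<rightarrow>\<^sub>M N" "T \<in> Q \<rightarrow>\<^sub>M N"
    using g T sets by (auto cong: measurable_cong_sets)
  have "ereal ((\<integral>x. g (T x) \<partial>P) - (\<integral>x. exp (g (T x)) \<partial>Q) + 1) \<le> rel_ent P Q"
    by (rule rel_ent_upper[of _ _ B]) (use B in auto)
  then show "ereal ((\<integral>x. g x \<partial>distr P N T) - (\<integral>x. exp (g x) \<partial>distr Q N T) + 1) \<le> rel_ent P Q"
    by (simp add: integral_distr)
qed

text \<open>For a fixed value of the noise, the section of a test function is a test function for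
  \<open>P\<close> and \<open>Q\<close>; averaging over \<open>N\<close> keeps the bound. Together
  with \<open>rel_ent_distr_le\<close> this is data processing for a map that uses independent
  noise.\<close>

lemma rel_ent_pair_le:
  assumes "prob_space P" "prob_space Q" "prob_space N" and sets: "sets Q = sets P"
  shows "rel_ent (P \<Otimes>\<^sub>M N) (Q \<Otimes>\<^sub>M N) \<le> rel_ent P Q"
proof (cases "rel_ent P Q")
  case (real D)
  interpret P: prob_space P by fact
  interpret Q: prob_space Q by fact
  interpret N: prob_space N by fact
  interpret PN: pair_prob_space P N ..
  interpret QN: pair_prob_space Q N ..
  show ?thesis
  proof (rule rel_ent_least)
    fix g :: "'a \<times> 'b \<Rightarrow> real" and B assume g: "g \<in> borel_measurable (P \<Otimes>\<^sub>M N)" and B: "\<And>x. \<bar>g x\<bar> \<le> B"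
    have [measurable]: "g \<in> borel_measurable (P \<Otimes>\<^sub>M N)" "g \<in> borel_measurable (Q \<Otimes>\<^sub>M N)"
      using g sets by (auto cong: measurable_cong_sets sets_pair_measure_cong)
    have expB: "exp (g x) \<le> exp B" for x
      using B[of x] by simp
    have int1: "integrable (P \<Otimes>\<^sub>M N) g"
      by (rule PN.integrable_const_bound[of _ B]) (use B in auto)
    have int2: "integrable (Q \<Otimes>\<^sub>M N) (\<lambda>x. exp (g x))"
      by (rule QN.integrable_const_bound[of _ "exp B"]) (use expB in auto)
    have int3: "integrable N (\<lambda>n. \<integral>x. g (x, n) \<partial>P)"
      using PN.integrable_snd[of "\<lambda>x n. g (x, n)"] int1 by simp
    have int4: "integrable N (\<lambda>n. \<integral>x. exp (g (x, n)) \<partial>Q)"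
      using QN.integrable_snd[of "\<lambda>x n. exp (g (x, n))"] int2 by (simp add: split_beta')
    have "(\<integral>n. (\<integral>x. g (x, n) \<partial>P) - (\<integral>x. exp (g (x, n)) \<partial>Q) + 1 \<partial>N) \<le> (\<integral>n. D \<partial>N)"
    proof (rule integral_mono)
      fix n assume n: "n \<in> space N"
      have [measurable]: "(\<lambda>x. g (x, n)) \<in> borel_measurable P"
        using n by measurable
      have "ereal ((\<integral>x. g (x, n) \<partial>P) - (\<integral>x. exp (g (x, n)) \<partial>Q) + 1) \<le> rel_ent P Q"
        by (rule rel_ent_upper[of _ _ B]) (use B in auto)
      then show "(\<integral>x. g (x, n) \<partial>P) - (\<integral>x. exp (g (x, n)) \<partial>Q) + 1 \<le> D"
        by (simp add: real)
    qed (use int3 int4 in auto)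
    then have "(\<integral>n. (\<integral>x. g (x, n) \<partial>P) \<partial>N) - (\<integral>n. (\<integral>x. exp (g (x, n)) \<partial>Q) \<partial>N) + 1 \<le> D"
      using int3 int4 by (simp add: N.prob_space)
    moreover have "(\<integral>n. (\<integral>x. g (x, n) \<partial>P) \<partial>N) = (\<integral>x. g x \<partial>(P \<Otimes>\<^sub>M N))"
      using PN.integral_snd[of "\<lambda>x n. g (x, n)"] int1 by simp
    moreover have "(\<integral>n. (\<integral>x. exp (g (x, n)) \<partial>Q) \<partial>N) = (\<integral>x. exp (g x) \<partial>(Q \<Otimes>\<^sub>M N))"
      using QN.integral_snd[of "\<lambda>x n. exp (g (x, n))"] int2 by (simp add: split_beta')
    ultimately show "ereal ((\<integral>x. g x \<partial>(P \<Otimes>\<^sub>M N)) - (\<integral>x. exp (g x) \<partial>(Q \<Otimes>\<^sub>M N)) + 1) \<le> rel_ent P Q"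
      by (simp add: real)
  qed
qed (use rel_ent_nonneg[OF assms(1,2)] in auto)

text \<open>\<open>R\<close> has the \<open>T\<close>-marginal of \<open>P\<close> and the
  conditional law of \<open>Q\<close> given \<open>T\<close>, expressed by reweighting
  \<open>Q\<close> instead of by disintegration. The density of \<open>P\<close> with respect to
  \<open>R\<close> is \<open>a x / b (T x)\<close>, whose logarithm splits.\<close>

lemma rel_ent_chain:
  assumes P: "prob_space P" and Q: "prob_space Q" and sets: "sets P = sets Q"
    and T [measurable]: "T \<in> Q \<rightarrow>\<^sub>M N"
    and b: "prob_density (distr P N T) (distr Q N T) b"
    and fin: "rel_ent P Q < \<infinity>"
  defines "R \<equiv> density Q (\<lambda>x. ennreal (b (T x)))"
  shows "prob_space R" "rel_ent P Q = rel_ent P R + rel_ent (distr P N T) (distr Q N T)"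
proof -
  obtain a where "prob_density P Q a"
    using rel_ent_finite_imp_density[OF P Q sets fin] .
  then interpret a: prob_density P Q a .
  interpret b: prob_density "distr P N T" "distr Q N T" b by fact
  have TP [measurable]: "T \<in> P \<rightarrow>\<^sub>M N"
    using T by (simp cong: measurable_cong_sets add: sets)
  have [measurable]: "b \<in> borel_measurable N"
    using b.f_measurable by simp
  show R: "prob_space R"
  proof (rule prob_spaceI)
    have "emeasure R (space R) = (\<integral>\<^sup>+x. ennreal (b (T x)) \<partial>Q)"
      by (simp add: R_def emeasure_density cong: nn_integral_cong)
    also have "\<dots> = (\<integral>\<^sup>+y. ennreal (b y) \<partial>distr Q N T)"
      by (simp add: nn_integral_distr)
    also have "\<dots> = emeasure (density (distr Q N T) (\<lambda>y. ennreal (b y))) (space N)"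
      by (subst emeasure_density) (auto intro!: nn_integral_cong)
    also have "\<dots> = emeasure (distr P N T) (space N)"
      by (simp only: b.P_eq[symmetric])
    also have "\<dots> = 1"
      using b.P.emeasure_space_1 by simp
    finally show "emeasure R (space R) = 1" .
  qed
  have b_pos: "AE x in P. 0 < b (T x)"
    using b.AE_pos by (simp add: AE_distr_iff)
  then have "AE x in density Q (\<lambda>x. ennreal (a x)). 0 < b (T x)"
    by (simp only: a.P_eq[symmetric])
  \<comment> \<open>Up to a \<open>Q\<close>-null set, \<open>a x\<close> vanishes wherever
    \<open>b (T x)\<close> does, so the quotient \<open>a x / b (T x)\<close> loses no mass through
    \<open>x / 0 = 0\<close>.\<close>
  then have Q_pos: "AE x in Q. 0 < a x \<longrightarrow> 0 < b (T x)"
    by (simp add: AE_density)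
  have "P = density R (\<lambda>x. ennreal (a x / b (T x)))"
  proof -
    have "density R (\<lambda>x. ennreal (a x / b (T x))) = density Q (\<lambda>x. ennreal (b (T x)) * ennreal (a x / b (T x)))"
      unfolding R_def by (rule density_density_eq) auto
    also have "\<dots> = density Q (\<lambda>x. ennreal (a x))"
    proof (rule density_cong)
      show "AE x in Q. ennreal (b (T x)) * ennreal (a x / b (T x)) = ennreal (a x)"
        using Q_pos
      proof eventually_elim
        case (elim x)
        then show ?case
          using a.f_nonneg[of x] b.f_nonneg[of "T x"]
          by (cases "a x = 0") (auto simp flip: ennreal_mult)
      qed
    qed auto
    finally show ?thesis
      using a.P_eq by simp
  qed
  moreover have "a \<in> borel_measurable R" "(\<lambda>x. b (T x)) \<in> borel_measurable R"
    by (simp_all add: R_def)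
  ultimately interpret c: prob_density P R "\<lambda>x. a x / b (T x)"
    using P R by unfold_locales (auto intro: prob_space.emeasure_space_1 simp: prob_space_def finite_measure_def
      sigma_finite_measure_def finite_measure_axioms_def prob_space_axioms_def)
  have fin': "rel_ent (distr P N T) (distr Q N T) < \<infinity>"
    using rel_ent_distr_le[of T P N Q] fin sets by auto
  have int_a: "integrable P (\<lambda>x. ln (a x))"
    by (rule a.rel_ent_ge(1)[OF fin])
  have int_b: "integrable (distr P N T) (\<lambda>y. ln (b y))"
    by (rule b.rel_ent_ge(1)[OF fin'])
  then have int_bT: "integrable P (\<lambda>x. ln (b (T x)))"
    by (simp add: integrable_distr_eq)
  have ae: "AE x in P. ln (a x / b (T x)) = ln (a x) - ln (b (T x))"
    using b_pos a.AE_pos by eventually_elim (simp add: ln_div)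
  have [measurable]: "a \<in> borel_measurable P" "(\<lambda>x. b (T x)) \<in> borel_measurable P"
    using a.f_measurable by (simp_all cong: measurable_cong_sets add: sets)
  have int_c: "integrable P (\<lambda>x. ln (a x / b (T x)))"
    using int_a int_bT by (subst integrable_cong_AE[OF _ _ ae]) auto
  have "(\<integral>x. ln (a x / b (T x)) \<partial>P) = (\<integral>x. ln (a x) \<partial>P) - (\<integral>x. ln (b (T x)) \<partial>P)"
    using int_a int_bT by (subst integral_cong_AE[OF _ _ ae]) auto
  then show "rel_ent P Q = rel_ent P R + rel_ent (distr P N T) (distr Q N T)"
    unfolding a.rel_ent_eq[OF int_a] b.rel_ent_eq[OF int_b] c.rel_ent_eq[OF int_c]
    by (simp add: integral_distr)
qed

section \<open>Gaussian channels with side information\<close>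

lemma measure_eqI_nn_integral:
  assumes sets: "sets M = sets N"
    and eq: "\<And>f :: _ \<Rightarrow> ennreal. f \<in> borel_measurable M \<Longrightarrow> (\<integral>\<^sup>+x. f x \<partial>M) = (\<integral>\<^sup>+x. f x \<partial>N)"
  shows "M = N"
proof (rule measure_eqI[OF sets])
  fix A assume A: "A \<in> sets M"
  then show "emeasure M A = emeasure N A"
    using eq[of "indicator A"] by (simp add: borel_measurable_indicator sets)
qed

definition joint_law :: "'v measure \<Rightarrow> ('v \<times> (complex^'a)) measure \<Rightarrow> bool" where
  "joint_law V \<pi> \<longleftrightarrow> prob_space \<pi> \<and> sets \<pi> = sets (V \<Otimes>\<^sub>M borel)"

text \<open>The input \<open>x\<close> is dropped while the side information \<open>v\<close> is
  kept, so the choice of \<open>V\<close> decides what is remembered: \<open>u\<close> alone for the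
  information, \<open>(u, x)\<close> for the full divergence.\<close>

definition channel :: "'v measure \<Rightarrow> ('v \<times> (complex^'a)) measure \<Rightarrow> complex^'a^'k \<Rightarrow> ('v \<times> (complex^'k)) measure" where
  "channel V \<pi> A = distr (\<pi> \<Otimes>\<^sub>M \<gamma>) (V \<Otimes>\<^sub>M borel) (\<lambda>z. (fst (fst z), A *v snd (fst z) + snd z))"

lemma sets_channel [simp, measurable_cong]: "sets (channel V \<pi> A) = sets (V \<Otimes>\<^sub>M borel)"
  by (simp add: channel_def)

lemma channel_map_measurable:
  assumes "sets \<pi> = sets (V \<Otimes>\<^sub>M borel)"
  shows "(\<lambda>z. (fst (fst z), A *v snd (fst z) + snd z)) \<in> \<pi> \<Otimes>\<^sub>M \<gamma> \<rightarrow>\<^sub>M V \<Otimes>\<^sub>M borel"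
proof -
  have "(\<lambda>z. (fst (fst z), A *v snd (fst z) + snd z)) \<in> (V \<Otimes>\<^sub>M borel) \<Otimes>\<^sub>M \<gamma> \<rightarrow>\<^sub>M V \<Otimes>\<^sub>M borel"
    by measurable
  then show ?thesis
    by (simp cong: measurable_cong_sets sets_pair_measure_cong add: assms)
qed

lemma joint_law_channel:
  fixes A :: "complex^'a^'k"
  assumes "joint_law V \<pi>"
  shows "joint_law V (channel V \<pi> A)"
proof -
  interpret \<pi>: prob_space \<pi>
    using assms by (simp add: joint_law_def)
  interpret pair_prob_space \<pi> "\<gamma> :: (complex^'k) measure" ..
  show ?thesis
    unfolding joint_law_def channel_def
    using assms by (auto intro!: prob_space_distr channel_map_measurable simp: joint_law_def)
qed

lemma prob_space_channel: "joint_law V \<pi> \<Longrightarrow> prob_space (channel V \<pi> A)"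
  using joint_law_channel[of V \<pi>] by (simp add: joint_law_def)

lemma nn_integral_channel:
  assumes \<pi>: "joint_law V \<pi>" and f: "f \<in> borel_measurable (V \<Otimes>\<^sub>M borel)"
  shows "(\<integral>\<^sup>+z. f z \<partial>channel V \<pi> A) = (\<integral>\<^sup>+z. (\<integral>\<^sup>+w. f (fst z, A *v snd z + w) \<partial>\<gamma>) \<partial>\<pi>)"
proof -
  note m = channel_map_measurable[of \<pi> V A]
  have s: "sets \<pi> = sets (V \<Otimes>\<^sub>M borel)"
    using \<pi> by (simp add: joint_law_def)
  have "(\<lambda>z. f (fst (fst z), A *v snd (fst z) + snd z)) \<in> borel_measurable (\<pi> \<Otimes>\<^sub>M \<gamma>)"
    by (rule measurable_compose[OF m[OF s] f])
  from gaussian.nn_integral_fst[OF this] show ?thesis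
    unfolding channel_def using m[OF s] f by (subst nn_integral_distr) (simp_all add: split_beta')
qed

text \<open>The noise acts on \<open>x\<close> only, so processing the side information commutes
  with the channel. With \<open>h = fst\<close> this forgets \<open>x\<close>; for the Gaussian
  input, an \<open>h\<close> that recovers \<open>x\<close> from \<open>u\<close> adds it
  back.\<close>

lemma channel_projection:
  assumes \<pi>: "joint_law V \<pi>" and h [measurable]: "h \<in> V \<rightarrow>\<^sub>M V'"
  shows "joint_law V' (distr \<pi> (V' \<Otimes>\<^sub>M borel) (\<lambda>(v, x). (h v, x)))"
    and "distr (channel V \<pi> A) (V' \<Otimes>\<^sub>M borel) (\<lambda>(v, y). (h v, y)) =
      channel V' (distr \<pi> (V' \<Otimes>\<^sub>M borel) (\<lambda>(v, x). (h v, x))) A"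
proof -
  have s [measurable_cong]: "sets \<pi> = sets (V \<Otimes>\<^sub>M borel)"
    using \<pi> by (simp add: joint_law_def)
  interpret \<pi>: prob_space \<pi>
    using \<pi> by (simp add: joint_law_def)
  show J: "joint_law V' (distr \<pi> (V' \<Otimes>\<^sub>M borel) (\<lambda>(v, x). (h v, x)))"
    unfolding joint_law_def by (auto intro!: \<pi>.prob_space_distr)
  show "distr (channel V \<pi> A) (V' \<Otimes>\<^sub>M borel) (\<lambda>(v, y). (h v, y)) =
      channel V' (distr \<pi> (V' \<Otimes>\<^sub>M borel) (\<lambda>(v, x). (h v, x))) A" (is "?L = ?R")
  proof (rule measure_eqI_nn_integral)
    fix f :: "_ \<Rightarrow> ennreal" assume "f \<in> borel_measurable ?L"
    then have [measurable]: "f \<in> borel_measurable (V' \<Otimes>\<^sub>M borel)"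
      by simp
    have "(\<integral>\<^sup>+z. f z \<partial>?L) = (\<integral>\<^sup>+z. f (h (fst z), snd z) \<partial>channel V \<pi> A)"
      by (simp add: nn_integral_distr split_beta')
    also have "\<dots> = (\<integral>\<^sup>+z. (\<integral>\<^sup>+w. f (h (fst z), A *v snd z + w) \<partial>\<gamma>) \<partial>\<pi>)"
      by (subst nn_integral_channel[OF \<pi>]) auto
    also have "\<dots> = (\<integral>\<^sup>+z. f z \<partial>?R)"
      by (subst nn_integral_channel[OF J]) (auto simp: nn_integral_distr split_beta')
    finally show "(\<integral>\<^sup>+z. f z \<partial>?L) = (\<integral>\<^sup>+z. f z \<partial>?R)" .
  qed simp
qed

lemma rel_ent_channel_projection:
  assumes "joint_law V \<pi>" "joint_law V \<rho>" and h [measurable]: "h \<in> V \<rightarrow>\<^sub>M V'"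
  shows "rel_ent (channel V' (distr \<pi> (V' \<Otimes>\<^sub>M borel) (\<lambda>(v, x). (h v, x))) A)
      (channel V' (distr \<rho> (V' \<Otimes>\<^sub>M borel) (\<lambda>(v, x). (h v, x))) A)
    \<le> rel_ent (channel V \<pi> A) (channel V \<rho> A)"
  unfolding channel_projection(2)[OF assms(1) h, symmetric] channel_projection(2)[OF assms(2) h, symmetric]
  by (rule rel_ent_distr_le) auto

text \<open>\<open>C (H x + w) + D n\<close> is \<open>C H x\<close> plus the noise
  \<open>C w + D n\<close>, which is again standard by \<open>gaussian_combination\<close>.\<close>

lemma nn_integral_channel_degraded:
  fixes H :: "complex^'a^'b" and C :: "complex^'b^'e" and D :: "complex^'e^'e"
  assumes \<pi>: "joint_law V \<pi>" and D: "invertible D" and CD: "C ** C\<^sup>H + D ** D\<^sup>H = mat 1"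
    and f: "f \<in> borel_measurable (V \<Otimes>\<^sub>M borel)"
  shows "(\<integral>\<^sup>+z. f z \<partial>channel V \<pi> (C ** H)) =
    (\<integral>\<^sup>+z. (\<integral>\<^sup>+n. f (fst z, C *v snd z + D *v n) \<partial>\<gamma>) \<partial>channel V \<pi> H)"
proof -
  have [measurable]: "f \<in> borel_measurable (V \<Otimes>\<^sub>M borel)"
    by fact
  have s: "sets \<pi> = sets (V \<Otimes>\<^sub>M borel)"
    using \<pi> by (simp add: joint_law_def)
  have "(\<integral>\<^sup>+w. (\<integral>\<^sup>+n. f (fst z, C *v (H *v snd z + w) + D *v n) \<partial>\<gamma>) \<partial>\<gamma>)
      = (\<integral>\<^sup>+w. f (fst z, (C ** H) *v snd z + w) \<partial>\<gamma>)" if "z \<in> space \<pi>" for z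
  proof -
    have "fst z \<in> space V"
      using that sets_eq_imp_space_eq[OF s] by (auto simp: space_pair_measure)
    then have [measurable]: "(\<lambda>y. f (fst z, (C ** H) *v snd z + y)) \<in> borel_measurable borel"
      by measurable
    show ?thesis
      using gaussian_combination[OF D CD, of "\<lambda>y. f (fst z, (C ** H) *v snd z + y)"]
      by (simp add: matrix_vector_right_distrib matrix_vector_mul_assoc add.assoc)
  qed
  then have "(\<integral>\<^sup>+z. (\<integral>\<^sup>+w. f (fst z, (C ** H) *v snd z + w) \<partial>\<gamma>) \<partial>\<pi>) =
    (\<integral>\<^sup>+z. (\<integral>\<^sup>+w. (\<integral>\<^sup>+n. f (fst z, C *v (H *v snd z + w) + D *v n) \<partial>\<gamma>) \<partial>\<gamma>) \<partial>\<pi>)"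
    by (intro nn_integral_cong) simp
  then show ?thesis
    by (subst nn_integral_channel[OF \<pi> f], subst nn_integral_channel[OF \<pi>]) auto
qed

lemma channel_degraded:
  fixes H :: "complex^'a^'b" and C :: "complex^'b^'e" and D :: "complex^'e^'e"
  assumes \<pi>: "joint_law V \<pi>" and D: "invertible D" and CD: "C ** C\<^sup>H + D ** D\<^sup>H = mat 1"
  shows "channel V \<pi> (C ** H) = distr (channel V \<pi> H \<Otimes>\<^sub>M \<gamma>) (V \<Otimes>\<^sub>M borel)
    (\<lambda>(z, n). (fst z, C *v snd z + D *v n))"
proof (rule measure_eqI_nn_integral)
  fix f :: "_ \<Rightarrow> ennreal" assume "f \<in> borel_measurable (channel V \<pi> (C ** H))"
  then have f [measurable]: "f \<in> borel_measurable (V \<Otimes>\<^sub>M borel)"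
    by simp
  have "(\<lambda>(z, n). f (fst z, C *v snd z + D *v n)) \<in> borel_measurable (channel V \<pi> H \<Otimes>\<^sub>M \<gamma>)"
    by measurable
  from gaussian.nn_integral_fst[OF this]
  show "(\<integral>\<^sup>+z. f z \<partial>channel V \<pi> (C ** H)) = (\<integral>\<^sup>+z. f z \<partial>distr (channel V \<pi> H \<Otimes>\<^sub>M \<gamma>) (V \<Otimes>\<^sub>M borel)
    (\<lambda>(z, n). (fst z, C *v snd z + D *v n)))"
    by (simp add: nn_integral_channel_degraded[OF \<pi> D CD f] nn_integral_distr split_beta')
qed simp

lemma rel_ent_channel_degraded:
  fixes H :: "complex^'a^'b" and C :: "complex^'b^'e" and D :: "complex^'e^'e"
  assumes \<pi>: "joint_law V \<pi>" and \<rho>: "joint_law V \<rho>"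
    and D: "invertible D" and CD: "C ** C\<^sup>H + D ** D\<^sup>H = mat 1"
  shows "rel_ent (channel V \<pi> (C ** H)) (channel V \<rho> (C ** H)) \<le> rel_ent (channel V \<pi> H) (channel V \<rho> H)"
proof -
  have "rel_ent (channel V \<pi> (C ** H)) (channel V \<rho> (C ** H)) \<le>
    rel_ent (channel V \<pi> H \<Otimes>\<^sub>M (\<gamma> :: (complex^'e) measure)) (channel V \<rho> H \<Otimes>\<^sub>M \<gamma>)"
    unfolding channel_degraded[OF \<pi> D CD] channel_degraded[OF \<rho> D CD]
    by (rule rel_ent_distr_le) (auto cong: sets_pair_measure_cong)
  also have "\<dots> \<le> rel_ent (channel V \<pi> H) (channel V \<rho> H)"
    by (rule rel_ent_pair_le) (auto intro: prob_space_channel \<pi> \<rho> prob_space_gaussian)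
  finally show ?thesis .
qed

section \<open>Independent side information and the law of the output alone\<close>

lemma joint_law_pair:
  assumes "prob_space \<mu>" "prob_space \<nu>" "sets \<mu> = sets V" "sets \<nu> = sets borel"
  shows "joint_law V (\<mu> \<Otimes>\<^sub>M \<nu>)"
proof -
  interpret \<mu>: prob_space \<mu> by fact
  interpret \<nu>: prob_space \<nu> by fact
  interpret pair_prob_space \<mu> \<nu> ..
  show ?thesis
    using assms(3,4) prob_space_axioms by (simp add: joint_law_def cong: sets_pair_measure_cong)
qed

definition output_law :: "(complex^'a) measure \<Rightarrow> complex^'a^'k \<Rightarrow> (complex^'k) measure" where
  "output_law \<nu> A = distr (\<nu> \<Otimes>\<^sub>M \<gamma>) borel (\<lambda>(x, w). A *v x + w)"

lemma sets_output_law [simp, measurable_cong]: "sets (output_law \<nu> A) = sets borel"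
  by (simp add: output_law_def)

lemma nn_integral_output_law:
  assumes s: "sets \<nu> = sets borel" and f [measurable]: "f \<in> borel_measurable borel"
  shows "(\<integral>\<^sup>+y. f y \<partial>output_law \<nu> A) = (\<integral>\<^sup>+x. (\<integral>\<^sup>+w. f (A *v x + w) \<partial>\<gamma>) \<partial>\<nu>)"
proof -
  note [measurable_cong] = s
  have "(\<lambda>(x, w). f (A *v x + w)) \<in> borel_measurable (\<nu> \<Otimes>\<^sub>M \<gamma>)"
    by measurable
  from gaussian.nn_integral_fst[OF this] show ?thesis
    unfolding output_law_def by (simp add: nn_integral_distr split_beta')
qed

lemma prob_space_output_law:
  fixes A :: "complex^'a^'k"
  assumes "prob_space \<nu>" and s [measurable_cong]: "sets \<nu> = sets borel"
  shows "prob_space (output_law \<nu> A)"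
proof -
  interpret \<nu>: prob_space \<nu> by fact
  interpret pair_prob_space \<nu> "\<gamma> :: (complex^'k) measure" ..
  show ?thesis
    unfolding output_law_def by (rule prob_space_distr) measurable
qed

lemma channel_pair:
  assumes "prob_space \<mu>" "prob_space \<nu>" and s [measurable_cong]: "sets \<mu> = sets V" "sets \<nu> = sets borel"
  shows "channel V (\<mu> \<Otimes>\<^sub>M \<nu>) A = \<mu> \<Otimes>\<^sub>M output_law \<nu> A"
proof (rule measure_eqI_nn_integral)
  interpret \<mu>: prob_space \<mu> by fact
  interpret \<nu>: prob_space \<nu> by fact
  interpret O: prob_space "output_law \<nu> A"
    by (rule prob_space_output_law) fact+
  show "sets (channel V (\<mu> \<Otimes>\<^sub>M \<nu>) A) = sets (\<mu> \<Otimes>\<^sub>M output_law \<nu> A)"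
    by (simp add: s cong: sets_pair_measure_cong)
  fix f :: "_ \<Rightarrow> ennreal" assume "f \<in> borel_measurable (channel V (\<mu> \<Otimes>\<^sub>M \<nu>) A)"
  then have f [measurable]: "f \<in> borel_measurable (V \<Otimes>\<^sub>M borel)"
    by simp
  have J: "joint_law V (\<mu> \<Otimes>\<^sub>M \<nu>)"
    by (rule joint_law_pair) fact+
  have "(\<integral>\<^sup>+z. f z \<partial>channel V (\<mu> \<Otimes>\<^sub>M \<nu>) A) =
    (\<integral>\<^sup>+z. (\<integral>\<^sup>+w. f (fst z, A *v snd z + w) \<partial>\<gamma>) \<partial>(\<mu> \<Otimes>\<^sub>M \<nu>))"
    by (rule nn_integral_channel[OF J f])
  also have "\<dots> = (\<integral>\<^sup>+v. (\<integral>\<^sup>+x. (\<integral>\<^sup>+w. f (v, A *v x + w) \<partial>\<gamma>) \<partial>\<nu>) \<partial>\<mu>)"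
    by (subst \<nu>.nn_integral_fst[symmetric]) auto
  also have "\<dots> = (\<integral>\<^sup>+v. (\<integral>\<^sup>+y. f (v, y) \<partial>output_law \<nu> A) \<partial>\<mu>)"
  proof (rule nn_integral_cong)
    fix v assume "v \<in> space \<mu>"
    then have "v \<in> space V"
      using sets_eq_imp_space_eq[OF s(1)] by simp
    then show "(\<integral>\<^sup>+x. (\<integral>\<^sup>+w. f (v, A *v x + w) \<partial>\<gamma>) \<partial>\<nu>) = (\<integral>\<^sup>+y. f (v, y) \<partial>output_law \<nu> A)"
      by (subst nn_integral_output_law) (auto simp: s)
  qed
  also have "\<dots> = (\<integral>\<^sup>+z. f z \<partial>(\<mu> \<Otimes>\<^sub>M output_law \<nu> A))"
    by (rule O.nn_integral_fst) (simp cong: measurable_cong_sets sets_pair_measure_cong add: s)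
  finally show "(\<integral>\<^sup>+z. f z \<partial>channel V (\<mu> \<Otimes>\<^sub>M \<nu>) A) = (\<integral>\<^sup>+z. f z \<partial>(\<mu> \<Otimes>\<^sub>M output_law \<nu> A))" .
qed

text \<open>The product of the marginals of \<open>u\<close> and \<open>y\<close> is itself a
  channel output, for the input in which \<open>x\<close> is made independent of \<open>u\<close>.
  Information is thus a divergence between two outputs of one channel, to which data processing and
  semicontinuity apply.\<close>

lemma channel_info_eq:
  fixes A :: "complex^'a^'k"
  assumes p: "joint_law U p"
  shows "channel_info (U, p) A =
    rel_ent (channel U p A) (channel U (distr p U fst \<Otimes>\<^sub>M distr p borel snd) A) / ereal (ln 2)"
proof -
  have s [measurable_cong]: "sets p = sets (U \<Otimes>\<^sub>M borel)"
    using p by (simp add: joint_law_def)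
  interpret p: prob_space p
    using p by (simp add: joint_law_def)
  interpret pair_prob_space p "\<gamma> :: (complex^'k) measure" ..
  let ?N = "p \<Otimes>\<^sub>M (\<gamma> :: (complex^'k) measure)"
  have sel: "(\<lambda>((u, x), w). u) = (\<lambda>z :: ('b \<times> (complex^'a)) \<times> (complex^'k). fst (fst z))"
    "(\<lambda>((u, x), w). A *v x + w) = (\<lambda>z :: ('b \<times> (complex^'a)) \<times> (complex^'k). A *v snd (fst z) + snd z)"
    by (auto simp: fun_eq_iff)
  have X: "(\<lambda>z. fst (fst z)) \<in> ?N \<rightarrow>\<^sub>M U"
    by measurable
  have Y: "(\<lambda>z. A *v snd (fst z) + snd z) \<in> ?N \<rightarrow>\<^sub>M borel"
    by measurable
  have Q1: "distr ?N U (\<lambda>z. fst (fst z)) = distr p U fst"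
  proof (rule measure_eqI_nn_integral)
    fix f :: "_ \<Rightarrow> ennreal" assume "f \<in> borel_measurable (distr ?N U (\<lambda>z. fst (fst z)))"
    then have [measurable]: "f \<in> borel_measurable U"
      by simp
    have "(\<lambda>z. f (fst (fst z))) \<in> borel_measurable ?N"
      by measurable
    from gaussian.nn_integral_fst[OF this]
    show "(\<integral>\<^sup>+z. f z \<partial>distr ?N U (\<lambda>z. fst (fst z))) = (\<integral>\<^sup>+z. f z \<partial>distr p U fst)"
      by (simp add: nn_integral_distr split_beta' gaussian.emeasure_space_1[simplified])
  qed simp
  have Q2: "distr ?N borel (\<lambda>z. A *v snd (fst z) + snd z) = output_law (distr p borel snd) A"
  proof (rule measure_eqI_nn_integral)
    fix f :: "_ \<Rightarrow> ennreal" assume "f \<in> borel_measurable (distr ?N borel (\<lambda>z. A *v snd (fst z) + snd z))"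
    then have [measurable]: "f \<in> borel_measurable borel"
      by simp
    have "(\<lambda>z. f (A *v snd (fst z) + snd z)) \<in> borel_measurable ?N"
      by measurable
    from gaussian.nn_integral_fst[OF this]
    show "(\<integral>\<^sup>+z. f z \<partial>distr ?N borel (\<lambda>z. A *v snd (fst z) + snd z)) = (\<integral>\<^sup>+z. f z \<partial>output_law (distr p borel snd) A)"
      by (simp add: nn_integral_distr split_beta' nn_integral_output_law)
  qed simp
  have pU: "prob_space (distr p U fst)" "prob_space (distr p borel snd)"
    by (auto intro!: p.prob_space_distr)
  show ?thesis
    unfolding channel_info_def prod.case sel mutual_info_eq_rel_ent[OF prob_space_axioms X Y] channel_def[symmetric] Q1 Q2
    by (simp add: channel_pair pU)
qed

section \<open>Semicontinuity in the channel matrix\<close>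

text \<open>Provides the majorant for shifted Gaussian densities; scaling by
  \<open>1 / sqrt 2\<close> reduces it to \<open>nn_integral_exp_norm\<close>.\<close>

lemma integrable_exp_half_norm: "integrable lborel (\<lambda>y :: complex^'n. exp (- (norm y)\<^sup>2 / 2))"
proof -
  let ?T = "(1 / sqrt 2) *\<^sub>R mat 1 :: complex^'n^'n"
  have "?T ** (sqrt 2 *\<^sub>R mat 1) = mat 1" "(sqrt 2 *\<^sub>R mat 1) ** ?T = mat 1"
    by (simp_all only: scaleR_matrix_mult) auto
  then have "invertible ?T"
    unfolding invertible_def by blast
  then obtain c where c: "lebesgue_scaling ?T c"
    by (rule lebesgue_scaling_exists)
  have T: "norm (?T *v y) = norm y / sqrt 2" for y :: "complex^'n"
    by (simp only: scaleR_matrix_vector) simp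
  have T2: "- (norm (?T *v y))\<^sup>2 = - (norm y)\<^sup>2 / 2" for y :: "complex^'n"
    unfolding T by (simp add: power_divide)
  have "ennreal (pi ^ CARD('n)) = ennreal c * (\<integral>\<^sup>+y. ennreal (exp (- (norm (?T *v y))\<^sup>2)) \<partial>lborel)"
    unfolding nn_integral_exp_norm[symmetric] by (rule lebesgue_scalingD[OF c]) auto
  then have "ennreal c * (\<integral>\<^sup>+(y::complex^'n). ennreal (exp (- (norm y)\<^sup>2 / 2)) \<partial>lborel) < \<infinity>"
    unfolding T2 by (metis ennreal_less_top infinity_ennreal_def)
  then have "(\<integral>\<^sup>+(y::complex^'n). ennreal (exp (- (norm y)\<^sup>2 / 2)) \<partial>lborel) < \<infinity>"
    using lebesgue_scaling_pos[OF c] by (auto simp: ennreal_mult_less_top)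
  then show ?thesis
    by (intro integrableI_bounded) auto
qed

text \<open>Since \<open>g\<close> is merely measurable, the shift is moved from \<open>g\<close> to
  the Gaussian density, which is continuous.\<close>

lemma gaussian_shift_continuous:
  fixes g :: "complex^'n \<Rightarrow> real" and a :: "nat \<Rightarrow> complex^'n"
  assumes g [measurable]: "g \<in> borel_measurable borel" and B: "\<And>y. \<bar>g y\<bar> \<le> B" and a: "a \<longlonglongrightarrow> a0"
  shows "(\<lambda>n. \<integral>w. g (a n + w) \<partial>\<gamma>) \<longlonglongrightarrow> (\<integral>w. g (a0 + w) \<partial>\<gamma>)"
proof -
  have eq: "(\<integral>w. g (b + w) \<partial>\<gamma>) = (\<integral>y. gaussian_pdf (y - b) * g y \<partial>lborel)" for b :: "complex^'n"
  proof -
    have "(\<integral>w. g (b + w) \<partial>\<gamma>) = (\<integral>w. gaussian_pdf w * g (b + w) \<partial>lborel)"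
      unfolding std_complex_gaussian_def by (rule integral_real_density) auto
    also have "\<dots> = (\<integral>w. gaussian_pdf (b + w - b) * g (b + w) \<partial>lborel)"
      by simp
    also have "\<dots> = (\<integral>y. gaussian_pdf (y - b) * g y \<partial>distr lborel borel ((+) b))"
      by (subst integral_distr) auto
    finally show ?thesis
      by (simp add: lborel_distr_plus)
  qed
  obtain c where c: "\<And>n. norm (a n) \<le> c"
    using a by (metis Bseq_def convergentI convergent_imp_Bseq)
  have B0: "0 \<le> B"
    using B[of 0] by linarith
  show ?thesis
    unfolding eq
  \<comment> \<open>\<open>c\<close> bounds all shifts. From \<open>(norm y)\<^sup>2 \<le> 2 * (norm
    (y - a n))\<^sup>2 + 2 * c\<^sup>2\<close> come the factor \<open>exp (c\<^sup>2)\<close> and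
    the halved exponent.\<close>
  proof (rule integral_dominated_convergence[where w="\<lambda>y. exp (c\<^sup>2) * B * exp (- (norm y)\<^sup>2 / 2)"])
    show "integrable lborel (\<lambda>y :: complex^'n. exp (c\<^sup>2) * B * exp (- (norm y)\<^sup>2 / 2))"
      by (intro integrable_mult_right integrable_exp_half_norm)
    show "AE y in lborel. (\<lambda>n. gaussian_pdf (y - a n) * g y) \<longlonglongrightarrow> gaussian_pdf (y - a0) * g y"
      by (intro always_eventually allI tendsto_intros a) auto
    fix n
    show "AE y in lborel. norm (gaussian_pdf (y - a n) * g y) \<le> exp (c\<^sup>2) * B * exp (- (norm y)\<^sup>2 / 2)"
    proof (intro always_eventually allI)
      fix y
      have "norm y \<le> norm (y - a n) + norm (a n)"
        by (metis diff_add_cancel norm_triangle_ineq)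
      then have "(norm y)\<^sup>2 \<le> (norm (y - a n) + norm (a n))\<^sup>2"
        by (intro power_mono) auto
      also have "\<dots> \<le> 2 * (norm (y - a n))\<^sup>2 + 2 * (norm (a n))\<^sup>2"
        using sum_squares_bound[of "norm (y - a n)" "norm (a n)"] by (simp add: power2_sum)
      also have "(norm (a n))\<^sup>2 \<le> c\<^sup>2"
        using c[of n] by (intro power_mono) auto
      finally have "exp (- (norm (y - a n))\<^sup>2) \<le> exp (c\<^sup>2) * exp (- (norm y)\<^sup>2 / 2)"
        by (simp flip: exp_add)
      moreover have "exp (- (norm (y - a n))\<^sup>2) / pi ^ CARD('n) \<le> exp (- (norm (y - a n))\<^sup>2)"
        using pi_gt3 by (simp add: divide_le_eq mult_le_cancel_left1 one_le_power)
      ultimately have "gaussian_pdf (y - a n) \<le> exp (c\<^sup>2) * exp (- (norm y)\<^sup>2 / 2)"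
        by linarith
      then have "gaussian_pdf (y - a n) * \<bar>g y\<bar> \<le> exp (c\<^sup>2) * exp (- (norm y)\<^sup>2 / 2) * B"
        using B0 B[of y] by (intro mult_mono) auto
      then show "norm (gaussian_pdf (y - a n) * g y) \<le> exp (c\<^sup>2) * B * exp (- (norm y)\<^sup>2 / 2)"
        by (simp add: abs_mult mult_ac)
    qed
  qed auto
qed

lemma tendsto_matrix_vector:
  fixes A :: "nat \<Rightarrow> complex^'a^'k"
  assumes "A \<longlonglongrightarrow> A0"
  shows "(\<lambda>n. A n *v x) \<longlonglongrightarrow> A0 *v x"
proof -
  have "linear (\<lambda>A :: complex^'a^'k. A *v x)"
    by (rule linearI) (simp_all add: matrix_vector_mult_add_rdistrib scaleR_matrix_vector)
  then have "bounded_linear (\<lambda>A :: complex^'a^'k. A *v x)"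
    by (simp add: linear_conv_bounded_linear)
  from bounded_linear.tendsto[OF this assms] show ?thesis .
qed

lemma channel_integral_continuous:
  fixes g :: "'v \<times> (complex^'k) \<Rightarrow> real"
  fixes \<pi> :: "('v \<times> (complex^'a)) measure"
  assumes \<pi>: "joint_law V \<pi>" and g [measurable]: "g \<in> borel_measurable (V \<Otimes>\<^sub>M borel)" and B: "\<And>z. \<bar>g z\<bar> \<le> B"
  shows "continuous_on UNIV (\<lambda>A. \<integral>z. g z \<partial>channel V \<pi> A)"
proof -
  have s [measurable_cong]: "sets \<pi> = sets (V \<Otimes>\<^sub>M borel)"
    using \<pi> by (simp add: joint_law_def)
  interpret \<pi>: prob_space \<pi>
    using \<pi> by (simp add: joint_law_def)
  interpret pair_prob_space \<pi> "\<gamma> :: (complex^'k) measure" ..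
  define J where "J z A = (\<integral>w. g (fst z, A *v snd z + w) \<partial>\<gamma>)" for z and A :: "complex^'a^'k"
  have eq: "(\<integral>z. g z \<partial>channel V \<pi> A) = (\<integral>z. J z A \<partial>\<pi>)" for A
  proof -
    have "(\<integral>z. g z \<partial>channel V \<pi> A) = (\<integral>z. g (fst (fst z), A *v snd (fst z) + snd z) \<partial>(\<pi> \<Otimes>\<^sub>M \<gamma>))"
      unfolding channel_def using channel_map_measurable[OF s] g by (subst integral_distr) simp_all
    also have "\<dots> = (\<integral>z. J z A \<partial>\<pi>)"
      unfolding J_def
      by (subst integral_fst'[symmetric]) (auto intro!: integrable_const_bound[of _ B] simp: B)
    finally show ?thesis .
  qed
  have [measurable]: "(\<lambda>z. J z A) \<in> borel_measurable \<pi>" for A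
    unfolding J_def by measurable
  have J_bound: "norm (J z A) \<le> B" for z A
  proof (cases "integrable \<gamma> (\<lambda>w. g (fst z, A *v snd z + w))")
    case True
    then show ?thesis
      unfolding J_def using B
      by (intro order_trans[OF integral_norm_bound] gaussian.integral_le_const) auto
  next
    case False
    then show ?thesis
      using B[of undefined] by (simp add: J_def not_integrable_integral_eq)
  qed
  show ?thesis
    unfolding continuous_on_sequentially eq comp_def
  proof (intro allI ballI impI)
    fix X and A :: "complex^'a^'k"
    assume "(\<forall>n. X n \<in> UNIV) \<and> X \<longlonglongrightarrow> A"
    then have X: "X \<longlonglongrightarrow> A"
      by simp
    show "(\<lambda>n. \<integral>z. J z (X n) \<partial>\<pi>) \<longlonglongrightarrow> (\<integral>z. J z A \<partial>\<pi>)"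
    proof (rule integral_dominated_convergence[where w="\<lambda>_. B"])
      show "AE z in \<pi>. (\<lambda>n. J z (X n)) \<longlonglongrightarrow> J z A"
      proof (rule AE_I2)
        fix z assume "z \<in> space \<pi>"
        then have "fst z \<in> space V"
          using sets_eq_imp_space_eq[OF s] by (auto simp: space_pair_measure)
        then have "(\<lambda>y. g (fst z, y)) \<in> borel_measurable borel"
          by measurable
        then show "(\<lambda>n. J z (X n)) \<longlonglongrightarrow> J z A"
          unfolding J_def by (rule gaussian_shift_continuous) (auto intro: B tendsto_matrix_vector X)
      qed
    qed (use J_bound in auto)
  qed
qed

text \<open>A supremum of continuous functions of \<open>A\<close> is lower semicontinuous. The test
  functions range over the same set for all \<open>A\<close> because the sigma-algebra of the output
  does not depend on \<open>A\<close>.\<close>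

lemma open_rel_ent_channel:
  fixes \<pi> \<rho> :: "('v \<times> (complex^'a)) measure"
  assumes "joint_law V \<pi>" "joint_law V \<rho>"
  shows "open {A :: complex^'a^'k. c < rel_ent (channel V \<pi> A) (channel V \<rho> A)}"
proof -
  let ?G = "{g :: 'v \<times> (complex^'k) \<Rightarrow> real. g \<in> borel_measurable (V \<Otimes>\<^sub>M borel) \<and> (\<exists>B. \<forall>x. \<bar>g x\<bar> \<le> B)}"
  have bm: "borel_measurable (channel V \<pi> A) = (borel_measurable (V \<Otimes>\<^sub>M borel) :: (_ \<Rightarrow> real) set)" for A :: "complex^'a^'k"
    by (rule measurable_cong_sets) auto
  have "{A :: complex^'a^'k. c < rel_ent (channel V \<pi> A) (channel V \<rho> A)} =
    (\<Union>g\<in>?G. {A. c < ereal ((\<integral>x. g x \<partial>channel V \<pi> A) - (\<integral>x. exp (g x) \<partial>channel V \<rho> A) + 1)})"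
    unfolding rel_ent_def bm less_SUP_iff by blast
  also have "open \<dots>"
  proof (intro open_UN ballI)
    fix g assume "g \<in> ?G"
    then obtain B where g: "g \<in> borel_measurable (V \<Otimes>\<^sub>M borel)" and B: "\<And>x. \<bar>g x\<bar> \<le> B"
      by auto
    have expB: "\<bar>exp (g x)\<bar> \<le> exp B" for x
      using B[of x] by simp
    have "continuous_on UNIV (\<lambda>A :: complex^'a^'k. \<integral>x. g x \<partial>channel V \<pi> A)"
      by (rule channel_integral_continuous[OF assms(1) g B])
    moreover have "continuous_on UNIV (\<lambda>A. \<integral>x. exp (g x) \<partial>channel V \<rho> A)"
      by (rule channel_integral_continuous[OF assms(2) _ expB]) (use g in measurable)
    ultimately show "open {A. c < ereal ((\<integral>x. g x \<partial>channel V \<pi> A) - (\<integral>x. exp (g x) \<partial>channel V \<rho> A) + 1)}"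
      by (intro open_Collect_less continuous_on_ereal continuous_intros)
  qed
  finally show ?thesis .
qed

lemma borel_measurable_channel_info:
  assumes "joint_law U p"
  shows "channel_info (U, p) \<in> borel_measurable borel"
proof -
  have s [measurable_cong]: "sets p = sets (U \<Otimes>\<^sub>M borel)"
    using assms by (simp add: joint_law_def)
  interpret p: prob_space p
    using assms by (simp add: joint_law_def)
  have J: "joint_law U (distr p U fst \<Otimes>\<^sub>M distr p borel snd)"
    by (intro joint_law_pair p.prob_space_distr) auto
  have "(\<lambda>A. rel_ent (channel U p A) (channel U (distr p U fst \<Otimes>\<^sub>M distr p borel snd) A)) \<in> borel_measurable borel"
  proof (rule borel_measurableI_greater)
    fix c
    show "{A \<in> space borel. c < rel_ent (channel U p A) (channel U (distr p U fst \<Otimes>\<^sub>M distr p borel snd) A)} \<in> sets borel"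
      using borel_open[OF open_rel_ent_channel[OF assms J, of c]] by simp
  qed
  then show ?thesis
    unfolding channel_info_eq[OF assms, abs_def] by (rule borel_measurable_ereal_divide) auto
qed

section \<open>The information gap under degradation\<close>

lemma output_law_degraded:
  fixes H :: "complex^'a^'b" and C :: "complex^'b^'e" and D :: "complex^'e^'e"
  assumes s: "sets \<nu> = sets borel" and D: "invertible D" and CD: "C ** C\<^sup>H + D ** D\<^sup>H = mat 1"
  shows "output_law \<nu> (C ** H) = distr (output_law \<nu> H \<Otimes>\<^sub>M \<gamma>) borel (\<lambda>z. C *v fst z + D *v snd z)"
proof (rule measure_eqI_nn_integral)
  fix f :: "_ \<Rightarrow> ennreal" assume "f \<in> borel_measurable (output_law \<nu> (C ** H))"
  then have [measurable]: "f \<in> borel_measurable borel"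
    by simp
  have "(\<lambda>z. f (C *v fst z + D *v snd z)) \<in> borel_measurable (output_law \<nu> H \<Otimes>\<^sub>M \<gamma>)"
    by measurable
  note fub = gaussian.nn_integral_fst[OF this]
  have "(\<integral>\<^sup>+w. (\<integral>\<^sup>+n. f (C *v (H *v x + w) + D *v n) \<partial>\<gamma>) \<partial>\<gamma>)
      = (\<integral>\<^sup>+w. f ((C ** H) *v x + w) \<partial>\<gamma>)" for x
    using gaussian_combination[OF D CD, of "\<lambda>y. f ((C ** H) *v x + y)"]
    by (simp add: matrix_vector_right_distrib matrix_vector_mul_assoc add.assoc)
  then show "(\<integral>\<^sup>+z. f z \<partial>output_law \<nu> (C ** H)) =
    (\<integral>\<^sup>+z. f z \<partial>distr (output_law \<nu> H \<Otimes>\<^sub>M \<gamma>) borel (\<lambda>z. C *v fst z + D *v snd z))"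
    by (simp add: nn_integral_distr nn_integral_output_law[OF s] flip: fub)
qed simp

lemma rel_ent_output_degraded:
  fixes H :: "complex^'a^'b" and C :: "complex^'b^'e" and D :: "complex^'e^'e"
  assumes \<mu>: "prob_space \<mu>" "sets \<mu> = sets borel" and \<nu>: "prob_space \<nu>" "sets \<nu> = sets borel"
    and D: "invertible D" and CD: "C ** C\<^sup>H + D ** D\<^sup>H = mat 1"
  shows "rel_ent (output_law \<mu> (C ** H)) (output_law \<nu> (C ** H)) \<le> rel_ent (output_law \<mu> H) (output_law \<nu> H)"
proof -
  have "rel_ent (output_law \<mu> (C ** H)) (output_law \<nu> (C ** H)) \<le>
    rel_ent (output_law \<mu> H \<Otimes>\<^sub>M (\<gamma> :: (complex^'e) measure)) (output_law \<nu> H \<Otimes>\<^sub>M \<gamma>)"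
    unfolding output_law_degraded[OF \<mu>(2) D CD] output_law_degraded[OF \<nu>(2) D CD]
    by (rule rel_ent_distr_le) (auto cong: sets_pair_measure_cong)
  also have "\<dots> \<le> rel_ent (output_law \<mu> H) (output_law \<nu> H)"
    by (rule rel_ent_pair_le) (auto intro!: prob_space_output_law simp: \<mu> \<nu> prob_space_gaussian)
  finally show ?thesis .
qed

text \<open>
  With \<open>u\<close> the message, \<open>(u, x) \<sim> p\<close> and a reference input law \<open>\<nu>\<close> independent of \<open>(u, x)\<close>, the divergence
  \<open>full_div A = D(u,x,y \<parallel> (u,x) \<times> y\<^sub>\<nu>)\<close> splits as \<open>D(u,x,y \<parallel> R) + I(u;y) + D(y \<parallel> y\<^sub>\<nu>)\<close>, where \<open>R\<close> makes \<open>x\<close> and \<open>y\<close>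
  conditionally independent given \<open>u\<close>. The first and last terms decrease under degradation of the channel.
\<close>

locale reference_input =
  fixes U :: "'u measure" and p :: "('u \<times> (complex^'a)) measure" and \<nu> :: "(complex^'a) measure"
  assumes p: "joint_law U p" and \<nu>: "prob_space \<nu>" and sets_\<nu> [measurable_cong, simp]: "sets \<nu> = sets borel"
begin

definition W where "W = U \<Otimes>\<^sub>M (borel :: (complex^'a) measure)"
text \<open>\<open>x\<close> is duplicated: one copy stays in the side information and the other is
  consumed by the channel, so that \<open>channel W \<pi> A\<close> is the joint law of
  \<open>(u, x)\<close> and \<open>y\<close>.\<close>

definition \<pi> where "\<pi> = distr p (W \<Otimes>\<^sub>M borel) (\<lambda>z. (z, snd z))"
definition pU where "pU = distr p U fst"
definition pX where "pX = distr p borel snd"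

definition info :: "complex^'a^'k \<Rightarrow> ereal" where
  "info A = rel_ent (channel U p A) (channel U (pU \<Otimes>\<^sub>M pX) A)"

definition full_div :: "complex^'a^'k \<Rightarrow> ereal" where
  "full_div A = rel_ent (channel W \<pi> A) (channel W (p \<Otimes>\<^sub>M \<nu>) A)"

lemma sets_p [measurable_cong]: "sets p = sets W"
  using p by (simp add: joint_law_def W_def)

lemma sets_p': "sets p = sets (U \<Otimes>\<^sub>M borel)"
  using p by (simp add: joint_law_def)

lemma sets_pU [measurable_cong, simp]: "sets pU = sets U" and sets_pX [measurable_cong, simp]: "sets pX = sets borel"
  by (simp_all add: pU_def pX_def)

lemma fst_W [measurable]: "fst \<in> W \<rightarrow>\<^sub>M U" and snd_W [measurable]: "snd \<in> W \<rightarrow>\<^sub>M borel"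
  by (simp_all add: W_def)

sublocale p: prob_space p
  using p by (simp add: joint_law_def)

sublocale \<nu>: prob_space \<nu>
  by (rule \<nu>)

sublocale pU: prob_space pU
  unfolding pU_def by (rule p.prob_space_distr) measurable

sublocale pX: prob_space pX
  unfolding pX_def by (rule p.prob_space_distr) measurable

lemma joint_law_\<pi>: "joint_law W \<pi>"
  unfolding joint_law_def \<pi>_def by (auto intro!: p.prob_space_distr)

lemma joint_law_p\<nu>: "joint_law W (p \<Otimes>\<^sub>M \<nu>)"
  by (rule joint_law_pair) (auto simp: sets_p p.prob_space_axioms \<nu>)

lemma joint_law_pU\<nu>: "joint_law U (pU \<Otimes>\<^sub>M \<nu>)"
  by (rule joint_law_pair) (auto simp: pU.prob_space_axioms \<nu>)

lemma joint_law_pUpX: "joint_law U (pU \<Otimes>\<^sub>M pX)"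
  by (rule joint_law_pair) (auto simp: pU.prob_space_axioms pX.prob_space_axioms)

lemma prob_space_output: "prob_space (output_law \<nu> A)" "prob_space (output_law pX A)"
  by (auto intro!: prob_space_output_law \<nu> pX.prob_space_axioms)

lemma channel_p\<nu>: "channel W (p \<Otimes>\<^sub>M \<nu>) A = p \<Otimes>\<^sub>M output_law \<nu> A"
  by (rule channel_pair) (auto simp: sets_p p.prob_space_axioms \<nu>)

lemma channel_pU\<nu>: "channel U (pU \<Otimes>\<^sub>M \<nu>) A = pU \<Otimes>\<^sub>M output_law \<nu> A"
  by (rule channel_pair) (auto simp: pU.prob_space_axioms \<nu>)

lemma channel_pUpX: "channel U (pU \<Otimes>\<^sub>M pX) A = pU \<Otimes>\<^sub>M output_law pX A"
  by (rule channel_pair) (auto simp: pU.prob_space_axioms pX.prob_space_axioms)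

abbreviation forget_x :: "('u \<times> (complex^'a)) \<times> (complex^'k) \<Rightarrow> 'u \<times> (complex^'k)" where
  "forget_x z \<equiv> (fst (fst z), snd z)"

text \<open>For \<open>b\<close> the density of the law of \<open>(u, y)\<close> with respect to
  \<open>pU\<close> times the reference output law, this is the law \<open>R\<close>: the weight
  sees only \<open>(u, y)\<close>, so the product structure survives given \<open>u\<close>.\<close>

abbreviation cond_indep :: "('u \<times> (complex^'k) \<Rightarrow> real) \<Rightarrow> complex^'a^'k \<Rightarrow> (('u \<times> (complex^'a)) \<times> (complex^'k)) measure" where
  "cond_indep b A \<equiv> density (channel W (p \<Otimes>\<^sub>M \<nu>) A) (\<lambda>z. ennreal (b (forget_x z)))"

lemma forget_x_measurable [measurable]: "forget_x \<in> W \<Otimes>\<^sub>M borel \<rightarrow>\<^sub>M U \<Otimes>\<^sub>M borel"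
  unfolding W_def by measurable

lemma forget_x_\<pi>: "distr (channel W \<pi> A) (U \<Otimes>\<^sub>M borel) forget_x = channel U p A"
proof -
  have m: "(\<lambda>z. (z, snd z)) \<in> p \<rightarrow>\<^sub>M W \<Otimes>\<^sub>M borel"
    by measurable
  have "distr \<pi> (U \<Otimes>\<^sub>M borel) (\<lambda>(v, x). (fst v, x)) = distr p (U \<Otimes>\<^sub>M borel) (\<lambda>z. z)"
    unfolding \<pi>_def by (subst distr_distr[OF _ m]) (auto simp: comp_def)
  also have "\<dots> = p"
    by (rule distr_id2) (simp add: sets_p')
  finally show ?thesis
    using channel_projection(2)[OF joint_law_\<pi> fst_W, of A] by (simp add: split_beta')
qed

lemma forget_x_p\<nu>: "distr (channel W (p \<Otimes>\<^sub>M \<nu>) A) (U \<Otimes>\<^sub>M borel) forget_x = channel U (pU \<Otimes>\<^sub>M \<nu>) A"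
proof -
  have "distr (p \<Otimes>\<^sub>M \<nu>) (U \<Otimes>\<^sub>M borel) (\<lambda>(v, x). (fst v, x)) = pU \<Otimes>\<^sub>M distr \<nu> borel (\<lambda>x. x)"
    unfolding pU_def split_beta'
    by (subst pair_measure_distr) (auto simp: \<nu>.sigma_finite_measure_axioms distr_id2 split_beta')
  then show ?thesis
    using channel_projection(2)[OF joint_law_p\<nu> fst_W, of A] by (simp add: split_beta' distr_id2)
qed

lemma distr_snd_channel_p: "distr (channel U p A) borel snd = output_law pX A"
proof (rule measure_eqI_nn_integral)
  fix f :: "_ \<Rightarrow> ennreal" assume "f \<in> borel_measurable (distr (channel U p A) borel snd)"
  then have [measurable]: "f \<in> borel_measurable borel"
    by simp
  show "(\<integral>\<^sup>+y. f y \<partial>distr (channel U p A) borel snd) = (\<integral>\<^sup>+y. f y \<partial>output_law pX A)"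
    by (simp add: nn_integral_distr nn_integral_channel[OF p] nn_integral_output_law pX_def)
qed simp

lemma nn_integral_pair_output:
  assumes "prob_space \<mu>" and s: "sets \<mu> = sets V" and "f \<in> borel_measurable (V \<Otimes>\<^sub>M borel)"
  shows "(\<integral>\<^sup>+z. f z \<partial>(\<mu> \<Otimes>\<^sub>M output_law \<nu> A)) = (\<integral>\<^sup>+v. (\<integral>\<^sup>+y. f (v, y) \<partial>output_law \<nu> A) \<partial>\<mu>)"
proof -
  interpret O: prob_space "output_law \<nu> A"
    by (rule prob_space_output)
  have "f \<in> borel_measurable (\<mu> \<Otimes>\<^sub>M output_law \<nu> A)"
    using assms(3) by (simp cong: measurable_cong_sets sets_pair_measure_cong add: s)
  from O.nn_integral_fst[OF this] show ?thesis
    by simp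
qed

lemma distr_snd_channel_pU\<nu>: "distr (channel U (pU \<Otimes>\<^sub>M \<nu>) A) borel snd = output_law \<nu> A"
proof (rule measure_eqI_nn_integral)
  fix f :: "_ \<Rightarrow> ennreal" assume "f \<in> borel_measurable (distr (channel U (pU \<Otimes>\<^sub>M \<nu>) A) borel snd)"
  then have [measurable]: "f \<in> borel_measurable borel"
    by simp
  show "(\<integral>\<^sup>+y. f y \<partial>distr (channel U (pU \<Otimes>\<^sub>M \<nu>) A) borel snd) = (\<integral>\<^sup>+y. f y \<partial>output_law \<nu> A)"
    by (subst nn_integral_distr, measurable)
       (simp add: channel_pU\<nu> nn_integral_pair_output[OF pU.prob_space_axioms sets_pU] pU.emeasure_space_1)
qed simp

text \<open>The chain rule twice, first forgetting \<open>x\<close>, then forgetting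
  \<open>u\<close>. By data processing each divergence met on the way is at most
  \<open>full_div A\<close>, which supplies the finiteness and the densities that the chain rule
  asks for.\<close>

lemma full_div_split:
  fixes A :: "complex^'a^'k"
  assumes fin: "full_div A < \<infinity>"
  obtains b where "prob_density (channel U p A) (channel U (pU \<Otimes>\<^sub>M \<nu>) A) b"
    and "full_div A = rel_ent (channel W \<pi> A) (cond_indep b A)
      + (info A + rel_ent (output_law pX A) (output_law \<nu> A))"
    and "prob_space (cond_indep b A)"
proof -
  note P = prob_space_channel[OF joint_law_\<pi>, of A]
  note Q = prob_space_channel[OF joint_law_p\<nu>, of A]
  note P' = prob_space_channel[OF p, of A]
  note Q' = prob_space_channel[OF joint_law_pU\<nu>, of A]
  have fin1: "rel_ent (channel W \<pi> A) (channel W (p \<Otimes>\<^sub>M \<nu>) A) < \<infinity>"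
    using fin by (simp add: full_div_def)
  have m1: "forget_x \<in> channel W (p \<Otimes>\<^sub>M \<nu>) A \<rightarrow>\<^sub>M U \<Otimes>\<^sub>M borel"
    by measurable
  have "rel_ent (channel U p A) (channel U (pU \<Otimes>\<^sub>M \<nu>) A) \<le> full_div A"
    unfolding full_div_def forget_x_\<pi>[symmetric] forget_x_p\<nu>[symmetric] by (rule rel_ent_distr_le) auto
  then have fin2: "rel_ent (channel U p A) (channel U (pU \<Otimes>\<^sub>M \<nu>) A) < \<infinity>"
    using fin by auto
  obtain b where b: "prob_density (channel U p A) (channel U (pU \<Otimes>\<^sub>M \<nu>) A) b"
    using rel_ent_finite_imp_density[OF P' Q' _ fin2] by auto
  let ?R = "cond_indep b A"
  have b1: "prob_density (distr (channel W \<pi> A) (U \<Otimes>\<^sub>M borel) forget_x) (distr (channel W (p \<Otimes>\<^sub>M \<nu>) A) (U \<Otimes>\<^sub>M borel) forget_x) b"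
    unfolding forget_x_\<pi> forget_x_p\<nu> by (rule b)
  have chain1: "full_div A = rel_ent (channel W \<pi> A) ?R + rel_ent (channel U p A) (channel U (pU \<Otimes>\<^sub>M \<nu>) A)"
    using rel_ent_chain(2)[OF P Q _ m1 b1 fin1] unfolding forget_x_\<pi> forget_x_p\<nu> by (simp add: full_div_def)
  have R: "prob_space ?R"
    using rel_ent_chain(1)[OF P Q _ m1 b1 fin1] by simp
  have "rel_ent (output_law pX A) (output_law \<nu> A) \<le> rel_ent (channel U p A) (channel U (pU \<Otimes>\<^sub>M \<nu>) A)"
    unfolding distr_snd_channel_p[symmetric] distr_snd_channel_pU\<nu>[symmetric] by (rule rel_ent_distr_le) auto
  then have fin3: "rel_ent (output_law pX A) (output_law \<nu> A) < \<infinity>"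
    using fin2 by auto
  obtain c where c: "prob_density (output_law pX A) (output_law \<nu> A) c"
    using rel_ent_finite_imp_density[OF prob_space_output(2) prob_space_output(1) _ fin3] by auto
  interpret c: prob_density "output_law pX A" "output_law \<nu> A" c
    by (rule c)
  have c1: "prob_density (distr (channel U p A) borel snd) (distr (channel U (pU \<Otimes>\<^sub>M \<nu>) A) borel snd) c"
    unfolding distr_snd_channel_p distr_snd_channel_pU\<nu> by (rule c)
  have m2: "snd \<in> channel U (pU \<Otimes>\<^sub>M \<nu>) A \<rightarrow>\<^sub>M borel"
    by measurable
  have [measurable]: "c \<in> borel_measurable borel"
    using c.f_measurable by simp
  \<comment> \<open>A weight that depends on \<open>y\<close> alone changes only the second marginal
    of a product, so the intermediate law of the second chain rule is the product of the marginals
    of \<open>u\<close> and \<open>y\<close>, and the divergence from it is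
    \<open>info A\<close>.\<close>
  have "density (channel U (pU \<Otimes>\<^sub>M \<nu>) A) (\<lambda>z. ennreal (c (snd z))) = channel U (pU \<Otimes>\<^sub>M pX) A"
  proof -
    have "channel U (pU \<Otimes>\<^sub>M pX) A = density pU (\<lambda>_. 1) \<Otimes>\<^sub>M density (output_law \<nu> A) (\<lambda>y. ennreal (c y))"
      unfolding channel_pUpX by (simp add: density_1 flip: c.P_eq)
    also have "\<dots> = density (pU \<Otimes>\<^sub>M output_law \<nu> A) (\<lambda>(x, y). 1 * ennreal (c y))"
      by (rule pair_measure_density)
         (auto simp: c.Q.sigma_finite_measure_axioms c.P.sigma_finite_measure_axioms simp flip: c.P_eq)
    finally show ?thesis
      by (simp add: channel_pU\<nu> split_beta')
  qed
  then have chain2: "rel_ent (channel U p A) (channel U (pU \<Otimes>\<^sub>M \<nu>) A) = info A + rel_ent (output_law pX A) (output_law \<nu> A)"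
    using rel_ent_chain(2)[OF P' Q' _ m2 c1 fin2] by (simp add: info_def distr_snd_channel_p distr_snd_channel_pU\<nu>)
  show thesis
    by (rule that[OF b]) (simp_all add: chain1 chain2 R)
qed

text \<open>Both sides integrate to the same law of \<open>(u, z)\<close>, which determines the conditional law of \<open>z\<close> given \<open>u\<close>.\<close>

lemma conditional_law_degraded:
  fixes H :: "complex^'a^'b" and C :: "complex^'b^'e" and D :: "complex^'e^'e"
  assumes D: "invertible D" and CD: "C ** C\<^sup>H + D ** D\<^sup>H = mat 1"
    and bH: "prob_density (channel U p H) (channel U (pU \<Otimes>\<^sub>M \<nu>) H) bH"
    and bG: "prob_density (channel U p (C ** H)) (channel U (pU \<Otimes>\<^sub>M \<nu>) (C ** H)) bG"
  shows "cond_indep bG (C ** H) =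
    distr (cond_indep bH H \<Otimes>\<^sub>M \<gamma>)
      (W \<Otimes>\<^sub>M borel) (\<lambda>z. (fst (fst z), C *v snd (fst z) + D *v snd z))" (is "?L = ?R")
proof -
  interpret bH: prob_density "channel U p H" "channel U (pU \<Otimes>\<^sub>M \<nu>) H" bH by (rule bH)
  interpret bG: prob_density "channel U p (C ** H)" "channel U (pU \<Otimes>\<^sub>M \<nu>) (C ** H)" bG by (rule bG)
  have [measurable]: "bH \<in> borel_measurable (U \<Otimes>\<^sub>M borel)" "bG \<in> borel_measurable (U \<Otimes>\<^sub>M borel)"
    using bH.f_measurable bG.f_measurable by simp_all
  have rect: "emeasure ?L (B \<times> E) = emeasure ?R (B \<times> E)" if B [measurable]: "B \<in> sets W" and E [measurable]: "E \<in> sets borel" for B E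
  proof -
    define \<kappa> where "\<kappa> y = (\<integral>\<^sup>+n. indicator E (C *v y + D *v n) \<partial>\<gamma>)" for y :: "complex^'b"
    have [measurable]: "\<kappa> \<in> borel_measurable borel"
      unfolding \<kappa>_def by measurable
    \<comment> \<open>\<open>\<kappa> y\<close> is the chance that the degraded output lies in
      \<open>E\<close> given \<open>y\<close>. So \<open>hH u\<close> and \<open>hG u\<close> are
      two versions of the conditional probability of that event given \<open>u\<close>, the first
      computed through the receiver's output, the second directly.\<close>
    define hH where "hH u = (\<integral>\<^sup>+y. ennreal (bH (u, y)) * \<kappa> y \<partial>output_law \<nu> H)" for u
    define hG where "hG u = (\<integral>\<^sup>+z. ennreal (bG (u, z)) * indicator E z \<partial>output_law \<nu> (C ** H))" for u
    interpret OH: prob_space "output_law \<nu> H" by (rule prob_space_output)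
    interpret OG: prob_space "output_law \<nu> (C ** H)" by (rule prob_space_output)
    have [measurable]: "hH \<in> borel_measurable U" "hG \<in> borel_measurable U"
      unfolding hH_def hG_def by measurable
    have marg: "(\<integral>\<^sup>+u. indicator F u * hH u \<partial>pU) = (\<integral>\<^sup>+u. indicator F u * hG u \<partial>pU)" if [measurable]: "F \<in> sets U" for F
    proof -
      have "(\<integral>\<^sup>+u. indicator F u * hH u \<partial>pU)
        = (\<integral>\<^sup>+u. (\<integral>\<^sup>+y. indicator F u * (ennreal (bH (u, y)) * \<kappa> y) \<partial>output_law \<nu> H) \<partial>pU)"
        unfolding hH_def by (intro nn_integral_cong nn_integral_cmult[symmetric]) (auto simp: pU_def)
      also have "\<dots> = (\<integral>\<^sup>+z. indicator F (fst z) * (ennreal (bH z) * \<kappa> (snd z)) \<partial>channel U (pU \<Otimes>\<^sub>M \<nu>) H)"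
        unfolding channel_pU\<nu> by (subst nn_integral_pair_output[OF pU.prob_space_axioms sets_pU]) auto
      also have "\<dots> = (\<integral>\<^sup>+z. ennreal (bH z) * (indicator F (fst z) * \<kappa> (snd z)) \<partial>channel U (pU \<Otimes>\<^sub>M \<nu>) H)"
        by (simp only: mult.left_commute)
      also have "\<dots> = (\<integral>\<^sup>+z. indicator F (fst z) * \<kappa> (snd z) \<partial>density (channel U (pU \<Otimes>\<^sub>M \<nu>) H) (\<lambda>z. ennreal (bH z)))"
        by (rule nn_integral_density[symmetric]) measurable
      also have "\<dots> = (\<integral>\<^sup>+z. indicator F (fst z) * \<kappa> (snd z) \<partial>channel U p H)"
        by (simp only: bH.P_eq[symmetric])
      also have "\<dots> = (\<integral>\<^sup>+z. (\<integral>\<^sup>+n. indicator F (fst z) * indicator E (C *v snd z + D *v n) \<partial>\<gamma>) \<partial>channel U p H)"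
        unfolding \<kappa>_def by (intro nn_integral_cong nn_integral_cmult[symmetric]) measurable
      also have "\<dots> = (\<integral>\<^sup>+z. indicator F (fst z) * indicator E (snd z) \<partial>channel U p (C ** H))"
        by (subst nn_integral_channel_degraded[OF p D CD]) auto
      also have "\<dots> = (\<integral>\<^sup>+z. indicator F (fst z) * indicator E (snd z) \<partial>density (channel U (pU \<Otimes>\<^sub>M \<nu>) (C ** H)) (\<lambda>z. ennreal (bG z)))"
        by (simp only: bG.P_eq[symmetric])
      also have "\<dots> = (\<integral>\<^sup>+z. ennreal (bG z) * (indicator F (fst z) * indicator E (snd z)) \<partial>channel U (pU \<Otimes>\<^sub>M \<nu>) (C ** H))"
        by (rule nn_integral_density) measurable
      also have "\<dots> = (\<integral>\<^sup>+z. indicator F (fst z) * (ennreal (bG z) * indicator E (snd z)) \<partial>channel U (pU \<Otimes>\<^sub>M \<nu>) (C ** H))"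
        by (simp only: mult.left_commute)
      also have "\<dots> = (\<integral>\<^sup>+u. (\<integral>\<^sup>+y. indicator F u * (ennreal (bG (u, y)) * indicator E y) \<partial>output_law \<nu> (C ** H)) \<partial>pU)"
        unfolding channel_pU\<nu> by (subst nn_integral_pair_output[OF pU.prob_space_axioms sets_pU]) auto
      also have "\<dots> = (\<integral>\<^sup>+u. indicator F u * hG u \<partial>pU)"
        unfolding hG_def by (intro nn_integral_cong nn_integral_cmult) (auto simp: pU_def)
      finally show ?thesis .
    qed
    have "density pU hH = density pU hG"
    proof (rule measure_eqI)
      fix F assume "F \<in> sets (density pU hH)"
      then have [measurable]: "F \<in> sets U"
        by simp
      show "emeasure (density pU hH) F = emeasure (density pU hG) F"
        using marg[of F] by (simp add: emeasure_density mult.commute)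
    qed simp
    \<comment> \<open>A density is determined almost everywhere by its measure once its integral is
      finite; here \<open>bH\<close> is a probability density and \<open>\<kappa>\<close> is at most
      1.\<close>
    moreover have "(\<integral>\<^sup>+u. hH u \<partial>pU) \<noteq> \<infinity>"
    proof -
      have "(\<integral>\<^sup>+u. hH u \<partial>pU) = (\<integral>\<^sup>+z. ennreal (bH z) * \<kappa> (snd z) \<partial>channel U (pU \<Otimes>\<^sub>M \<nu>) H)"
        unfolding channel_pU\<nu> hH_def by (subst nn_integral_pair_output[OF pU.prob_space_axioms sets_pU]) auto
      also have "\<dots> \<le> (\<integral>\<^sup>+z. ennreal (bH z) * 1 \<partial>channel U (pU \<Otimes>\<^sub>M \<nu>) H)"
      proof (intro nn_integral_mono mult_left_mono)
        fix z :: "'u \<times> (complex^'b)"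
        have "\<kappa> (snd z) \<le> (\<integral>\<^sup>+n. 1 \<partial>(\<gamma> :: (complex^'e) measure))"
          unfolding \<kappa>_def by (intro nn_integral_mono) (auto split: split_indicator)
        then show "\<kappa> (snd z) \<le> 1"
          by (simp add: gaussian.emeasure_space_1[simplified])
      qed simp
      also have "\<dots> < \<infinity>"
        using bH.integrable_f by (simp add: integrable_iff_bounded)
      finally show ?thesis
        by simp
    qed
    ultimately have "AE u in pU. hH u = hG u"
      by (subst (asm) finite_density_unique) auto
    then have ae: "AE z in p. hH (fst z) = hG (fst z)"
      unfolding pU_def by (subst (asm) AE_distr_iff) auto
    have "emeasure ?L (B \<times> E) = (\<integral>\<^sup>+z. ennreal (bG (forget_x z)) * indicator (B \<times> E) z \<partial>channel W (p \<Otimes>\<^sub>M \<nu>) (C ** H))"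
      by (rule emeasure_density) auto
    also have "\<dots> = (\<integral>\<^sup>+v. (\<integral>\<^sup>+z. ennreal (bG (fst v, z)) * indicator (B \<times> E) (v, z) \<partial>output_law \<nu> (C ** H)) \<partial>p)"
      unfolding channel_p\<nu> by (subst nn_integral_pair_output[OF p.prob_space_axioms sets_p]) auto
    also have "\<dots> = (\<integral>\<^sup>+v. indicator B v * hG (fst v) \<partial>p)"
    proof (rule nn_integral_cong)
      fix v assume "v \<in> space p"
      then have "fst v \<in> space U"
        using sets_eq_imp_space_eq[OF sets_p] by (auto simp: W_def space_pair_measure)
      then have [measurable]: "(\<lambda>z. ennreal (bG (fst v, z)) * indicator E z) \<in> borel_measurable (output_law \<nu> (C ** H))"
        by measurable
      show "(\<integral>\<^sup>+z. ennreal (bG (fst v, z)) * indicator (B \<times> E) (v, z) \<partial>output_law \<nu> (C ** H)) = indicator B v * hG (fst v)"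
      proof -
        have "(\<integral>\<^sup>+z. ennreal (bG (fst v, z)) * indicator (B \<times> E) (v, z) \<partial>output_law \<nu> (C ** H))
          = (\<integral>\<^sup>+z. indicator B v * (ennreal (bG (fst v, z)) * indicator E z) \<partial>output_law \<nu> (C ** H))"
          by (intro nn_integral_cong) (simp add: indicator_times ac_simps)
        also have "\<dots> = indicator B v * hG (fst v)"
          unfolding hG_def by (rule nn_integral_cmult) fact
        finally show ?thesis .
      qed
    qed
    also have "\<dots> = (\<integral>\<^sup>+v. indicator B v * hH (fst v) \<partial>p)"
      by (rule nn_integral_cong_AE) (use ae in auto)
    also have "\<dots> = (\<integral>\<^sup>+v. (\<integral>\<^sup>+y. ennreal (bH (fst v, y)) * (indicator B v * \<kappa> y) \<partial>output_law \<nu> H) \<partial>p)"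
    proof (rule nn_integral_cong)
      fix v assume "v \<in> space p"
      then have "fst v \<in> space U"
        using sets_eq_imp_space_eq[OF sets_p] by (auto simp: W_def space_pair_measure)
      then have [measurable]: "(\<lambda>y. ennreal (bH (fst v, y)) * \<kappa> y) \<in> borel_measurable (output_law \<nu> H)"
        by measurable
      show "indicator B v * hH (fst v) = (\<integral>\<^sup>+y. ennreal (bH (fst v, y)) * (indicator B v * \<kappa> y) \<partial>output_law \<nu> H)"
      proof -
        have "indicator B v * hH (fst v) = (\<integral>\<^sup>+y. indicator B v * (ennreal (bH (fst v, y)) * \<kappa> y) \<partial>output_law \<nu> H)"
          unfolding hH_def by (rule nn_integral_cmult[symmetric]) fact
        then show ?thesis
          by (simp only: mult.left_commute)
      qed
    qed
    also have "\<dots> = (\<integral>\<^sup>+z. ennreal (bH (forget_x z)) * (indicator B (fst z) * \<kappa> (snd z)) \<partial>channel W (p \<Otimes>\<^sub>M \<nu>) H)"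
      unfolding channel_p\<nu> by (subst nn_integral_pair_output[OF p.prob_space_axioms sets_p]) auto
    also have "\<dots> = (\<integral>\<^sup>+z. indicator B (fst z) * \<kappa> (snd z) \<partial>cond_indep bH H)"
      by (rule nn_integral_density[symmetric]) auto
    also have "\<dots> = (\<integral>\<^sup>+z. (\<integral>\<^sup>+n. indicator (B \<times> E) (fst z, C *v snd z + D *v n) \<partial>\<gamma>) \<partial>cond_indep bH H)"
      unfolding \<kappa>_def by (intro nn_integral_cong) (simp add: indicator_times nn_integral_cmult)
    also have "\<dots> = (\<integral>\<^sup>+z. indicator (B \<times> E) (fst (fst z), C *v snd (fst z) + D *v snd z)
        \<partial>(cond_indep bH H \<Otimes>\<^sub>M \<gamma>))"
      by (subst gaussian.nn_integral_fst[symmetric]) auto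
    also have "\<dots> = (\<integral>\<^sup>+z. indicator (B \<times> E) z \<partial>?R)"
      by (rule nn_integral_distr[symmetric]) measurable
    also have "\<dots> = emeasure ?R (B \<times> E)"
      by (rule nn_integral_indicator) simp
    finally show ?thesis .
  qed
  let ?E = "{a \<times> b |a b. a \<in> sets W \<and> b \<in> sets (borel :: (complex^'e) measure)}"
  let ?\<Omega> = "space W \<times> (UNIV :: (complex^'e) set)"
  show ?thesis
  proof (rule measure_eqI_generator_eq[OF Int_stable_pair_measure_generator[of W borel], where \<Omega>="?\<Omega>"
        and A="\<lambda>_. ?\<Omega>"])
    show "?E \<subseteq> Pow ?\<Omega>"
      using sets.space_closed[of W] by auto
    show "sets ?L = sigma_sets ?\<Omega> ?E"
      "sets ?R = sigma_sets ?\<Omega> ?E"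
      by (simp_all add: sets_pair_measure)
    show "range (\<lambda>_. ?\<Omega>) \<subseteq> ?E"
    proof -
      have "?\<Omega> \<in> ?E"
        unfolding mem_Collect_eq by (intro exI conjI, rule refl) auto
      then show ?thesis
        by (rule image_subsetI)
    qed
    have "emeasure ?L ?\<Omega> = (\<integral>\<^sup>+z. ennreal (bG (forget_x z)) \<partial>channel W (p \<Otimes>\<^sub>M \<nu>) (C ** H))"
      using emeasure_density[of "\<lambda>z. ennreal (bG (forget_x z))" "channel W (p \<Otimes>\<^sub>M \<nu>) (C ** H)" "?\<Omega>"]
      by (auto simp: channel_p\<nu> space_pair_measure intro!: nn_integral_cong split: split_indicator)
        (metis sets_eq_imp_space_eq sets_p)
    also have "\<dots> = (\<integral>\<^sup>+z. ennreal (bG z) \<partial>channel U (pU \<Otimes>\<^sub>M \<nu>) (C ** H))"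
      by (subst forget_x_p\<nu>[symmetric]) (simp add: nn_integral_distr)
    also have "\<dots> < \<infinity>"
      using bG.integrable_f by (simp add: integrable_iff_bounded)
    finally show "emeasure ?L ?\<Omega> \<noteq> \<infinity>"
      by simp
  qed (use rect in auto)
qed

text \<open>Subtracting the two three-term splittings, \<open>lH - lG\<close> exceeds
  \<open>iH - iG\<close> by the decrease of the first and last terms, which data processing makes
  nonnegative. All summands are nonnegative with finite sum, hence finite, and the subtraction takes
  place in the reals.\<close>

lemma information_gap_degraded:
  fixes H :: "complex^'a^'b" and C :: "complex^'b^'e" and D :: "complex^'e^'e"
  assumes D: "invertible D" and CD: "C ** C\<^sup>H + D ** D\<^sup>H = mat 1"
    and H: "full_div H = ereal lH" and G: "full_div (C ** H) = ereal lG"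
  obtains iH iG where "info H = ereal iH" "info (C ** H) = ereal iG" "iH - iG \<le> lH - lG"
proof -
  have fin: "full_div H < \<infinity>" "full_div (C ** H) < \<infinity>"
    using H G by auto
  obtain bH where bH: "prob_density (channel U p H) (channel U (pU \<Otimes>\<^sub>M \<nu>) H) bH"
    and sH: "full_div H = rel_ent (channel W \<pi> H) (cond_indep bH H)
      + (info H + rel_ent (output_law pX H) (output_law \<nu> H))"
    and RH: "prob_space (cond_indep bH H)"
    by (rule full_div_split[OF fin(1)])
  obtain bG where bG: "prob_density (channel U p (C ** H)) (channel U (pU \<Otimes>\<^sub>M \<nu>) (C ** H)) bG"
    and sG: "full_div (C ** H) = rel_ent (channel W \<pi> (C ** H)) (cond_indep bG (C ** H))
      + (info (C ** H) + rel_ent (output_law pX (C ** H)) (output_law \<nu> (C ** H)))"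
    and RG: "prob_space (cond_indep bG (C ** H))"
    by (rule full_div_split[OF fin(2)])
  let ?RH = "cond_indep bH H"
  let ?RG = "cond_indep bG (C ** H)"
  have nH: "0 \<le> rel_ent (channel W \<pi> H) ?RH" and nG: "0 \<le> rel_ent (channel W \<pi> (C ** H)) ?RG"
    by (intro rel_ent_nonneg prob_space_channel joint_law_\<pi> RH RG)+
  have info_nonneg: "0 \<le> info A" for A :: "complex^'a^'k"
    unfolding info_def by (intro rel_ent_nonneg prob_space_channel p joint_law_pUpX)
  have out_nonneg: "0 \<le> rel_ent (output_law pX A) (output_law \<nu> A)" for A :: "complex^'a^'k"
    by (rule rel_ent_nonneg) (rule prob_space_output)+
  have "rel_ent (channel W \<pi> (C ** H)) ?RG \<le> rel_ent (channel W \<pi> H \<Otimes>\<^sub>M (\<gamma> :: (complex^'e) measure)) (?RH \<Otimes>\<^sub>M \<gamma>)"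
    unfolding conditional_law_degraded[OF D CD bH bG] channel_degraded[OF joint_law_\<pi> D CD] split_beta'
    by (rule rel_ent_distr_le) (auto cong: sets_pair_measure_cong)
  also have "\<dots> \<le> rel_ent (channel W \<pi> H) ?RH"
    by (rule rel_ent_pair_le) (auto intro: prob_space_channel joint_law_\<pi> RH prob_space_gaussian)
  finally have R_le: "rel_ent (channel W \<pi> (C ** H)) ?RG \<le> rel_ent (channel W \<pi> H) ?RH" .
  have O_le: "rel_ent (output_law pX (C ** H)) (output_law \<nu> (C ** H)) \<le> rel_ent (output_law pX H) (output_law \<nu> H)"
    by (rule rel_ent_output_degraded[OF _ _ _ _ D CD]) (auto simp: \<nu> pX.prob_space_axioms)
  have fin_split: "\<exists>a' i' y'. a = ereal a' \<and> i = ereal i' \<and> y = ereal y' \<and> l = a' + i' + y'"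
    if "ereal l = a + (i + y)" "0 \<le> a" "0 \<le> i" "0 \<le> y" for l and a i y :: ereal
    using that by (cases a; cases i; cases y) auto
  obtain aH iH yH where 1: "rel_ent (channel W \<pi> H) ?RH = ereal aH" "info H = ereal iH"
      "rel_ent (output_law pX H) (output_law \<nu> H) = ereal yH" "lH = aH + iH + yH"
    using fin_split[OF sH[unfolded H] nH info_nonneg out_nonneg] by blast
  obtain aG iG yG where 2: "rel_ent (channel W \<pi> (C ** H)) ?RG = ereal aG" "info (C ** H) = ereal iG"
      "rel_ent (output_law pX (C ** H)) (output_law \<nu> (C ** H)) = ereal yG" "lG = aG + iG + yG"
    using fin_split[OF sG[unfolded G] nG info_nonneg out_nonneg] by blast
  show thesis
    using R_le O_le 1 2 by (intro that[of iH iG]) auto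
qed

end

section \<open>The Gaussian reference input\<close>

lemma prob_space_shifted_gaussian:
  fixes F :: "complex^'a^'a"
  shows "prob_space (distr \<gamma> borel (\<lambda>w. m + F *v w))"
  by (rule gaussian.prob_space_distr) measurable

text \<open>\<open>N\<close> whitens the output: \<open>N (A F w + n)\<close> is standard by
  \<open>gaussian_combination\<close> with \<open>C = N A F\<close> and \<open>D = N\<close>, so the
  output has the law of \<open>A m + T w\<close>. The channel noise makes \<open>T\<close>
  invertible even for singular \<open>F\<close>, so there is always a density.\<close>

lemma nn_integral_output_law_gaussian:
  fixes A :: "complex^'a^'k" and F :: "complex^'a^'a" and T N :: "complex^'k^'k"
  assumes T: "det_scaling T" "T ** T\<^sup>H = mat 1 + (A ** F) ** (A ** F)\<^sup>H" and N: "N ** T = mat 1"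
    and f [measurable]: "f \<in> borel_measurable borel"
  shows "(\<integral>\<^sup>+y. f y \<partial>output_law (distr \<gamma> borel (\<lambda>w. m + F *v w)) A) =
    (\<integral>\<^sup>+y. ennreal (gaussian_pdf (N *v (y - A *v m)) / (cmod (det T))\<^sup>2) * f y \<partial>lborel)"
proof -
  have TN: "T ** N = mat 1"
    using N by (simp add: matrix_left_right_inverse)
  have inv: "T *v (N *v y) = y" "N *v (T *v y) = y" for y
    by (simp_all add: matrix_vector_mul_assoc N TN)
  define d where "d = (cmod (det T))\<^sup>2"
  have scal: "lebesgue_scaling T d"
    using T(1) by (simp add: det_scaling_def d_def)
  have d: "0 < d"
    by (rule lebesgue_scaling_pos[OF scal])
  have iN: "invertible N"
    using N TN by (auto simp: invertible_def)
  have NN: "(N ** (A ** F)) ** (N ** (A ** F))\<^sup>H + N ** N\<^sup>H = mat 1"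
  proof -
    have "(N ** (A ** F)) ** (N ** (A ** F))\<^sup>H + N ** N\<^sup>H = N ** (mat 1 + (A ** F) ** (A ** F)\<^sup>H) ** N\<^sup>H"
      by (simp add: matrix_mult_distribs ctranspose_mul matrix_mul_assoc add.commute)
    also have "\<dots> = (N ** T) ** (N ** T)\<^sup>H"
      unfolding T(2)[symmetric] by (simp only: ctranspose_mul matrix_mul_assoc)
    finally show ?thesis
      by (simp add: N)
  qed
  have "(\<integral>\<^sup>+y. f y \<partial>output_law (distr \<gamma> borel (\<lambda>w. m + F *v w)) A)
    = (\<integral>\<^sup>+w. (\<integral>\<^sup>+n. f (A *v (m + F *v w) + n) \<partial>\<gamma>) \<partial>\<gamma>)"
    by (subst nn_integral_output_law) (simp_all add: nn_integral_distr)
  also have "\<dots> = (\<integral>\<^sup>+w. (\<integral>\<^sup>+n. f (A *v m + T *v ((N ** (A ** F)) *v w + N *v n)) \<partial>\<gamma>) \<partial>\<gamma>)"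
    by (simp add: matrix_vector_right_distrib inv add.assoc flip: matrix_vector_mul_assoc)
  also have "\<dots> = (\<integral>\<^sup>+w. f (A *v m + T *v w) \<partial>\<gamma>)"
    by (rule gaussian_combination[OF iN NN]) measurable
  also have "\<dots> = (\<integral>\<^sup>+w. ennreal (gaussian_pdf (N *v (T *v w))) * f (A *v m + T *v w) \<partial>lborel)"
    by (subst nn_integral_gaussian) (simp_all add: inv)
  also have "\<dots> = ennreal (1 / d) * (ennreal d * (\<integral>\<^sup>+w. ennreal (gaussian_pdf (N *v (T *v w))) * f (A *v m + T *v w) \<partial>lborel))"
  proof -
    have "ennreal (1 / d) * ennreal d = 1"
      using d by (simp flip: ennreal_mult)
    then show ?thesis
      by (simp flip: mult.assoc)
  qed
  also have "ennreal d * (\<integral>\<^sup>+w. ennreal (gaussian_pdf (N *v (T *v w))) * f (A *v m + T *v w) \<partial>lborel)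
      = (\<integral>\<^sup>+v. ennreal (gaussian_pdf (N *v v)) * f (A *v m + v) \<partial>lborel)"
    by (rule lebesgue_scalingD[OF scal, symmetric]) measurable
  also have "\<dots> = (\<integral>\<^sup>+v. ennreal (gaussian_pdf (N *v ((A *v m + v) - A *v m))) * f (A *v m + v) \<partial>lborel)"
    by simp
  also have "\<dots> = (\<integral>\<^sup>+y. ennreal (gaussian_pdf (N *v (y - A *v m))) * f y \<partial>lborel)"
    by (rule nn_integral_lborel_translate) measurable
  also have "ennreal (1 / d) * \<dots> = (\<integral>\<^sup>+y. ennreal (1 / d) * (ennreal (gaussian_pdf (N *v (y - A *v m))) * f y) \<partial>lborel)"
    by (rule nn_integral_cmult[symmetric]) measurable
  also have "\<dots> = (\<integral>\<^sup>+y. ennreal (gaussian_pdf (N *v (y - A *v m)) / d) * f y \<partial>lborel)"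
  proof (rule nn_integral_cong)
    fix y
    have "ennreal (1 / d) * ennreal (gaussian_pdf (N *v (y - A *v m))) = ennreal (gaussian_pdf (N *v (y - A *v m)) / d)"
      using d by (simp add: mult.commute flip: ennreal_mult)
    then show "ennreal (1 / d) * (ennreal (gaussian_pdf (N *v (y - A *v m))) * f y) = ennreal (gaussian_pdf (N *v (y - A *v m)) / d) * f y"
      by (simp only: mult.assoc[symmetric])
  qed
  finally show ?thesis
    by (simp add: d_def)
qed

text \<open>With an invertible factor \<open>T\<close> the determinant is
  \<open>(cmod (det T))\<^sup>2\<close>. Positivity keeps the logarithm in
  \<open>gaussian_rate\<close> away from the default values of \<open>ln\<close>.\<close>

lemma det_one_plus_mul_ctranspose:
  fixes B :: "complex^'k^'n"
  shows "det (mat 1 + B ** B\<^sup>H) = of_real (Re (det (mat 1 + B ** B\<^sup>H)))" "0 < Re (det (mat 1 + B ** B\<^sup>H))"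
proof -
  obtain T :: "complex^'n^'n" where T: "det_scaling T" "T ** T\<^sup>H = mat 1 + B ** B\<^sup>H"
    by (rule one_plus_factor)
  have "det (mat 1 + B ** B\<^sup>H) = of_real ((cmod (det T))\<^sup>2)"
    unfolding T(2)[symmetric] by (rule det_mul_ctranspose)
  moreover have "0 < (cmod (det T))\<^sup>2"
    using T(1) unfolding det_scaling_def by (blast dest: lebesgue_scaling_pos)
  ultimately show "det (mat 1 + B ** B\<^sup>H) = of_real (Re (det (mat 1 + B ** B\<^sup>H)))" "0 < Re (det (mat 1 + B ** B\<^sup>H))"
    by (simp_all del: of_real_power)
qed

definition gaussian_rate :: "complex^'a^'a \<Rightarrow> complex^'a^'k \<Rightarrow> real" where
  "gaussian_rate K A = ln (Re (det (mat 1 + A ** K ** A\<^sup>H)))"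

lemma integral_pair_fst:
  fixes f :: "'s \<Rightarrow> real"
  assumes "prob_space M1" "prob_space M2" and f: "integrable M1 f"
  shows "integrable (M1 \<Otimes>\<^sub>M M2) (\<lambda>z. f (fst z))" "(\<integral>z. f (fst z) \<partial>(M1 \<Otimes>\<^sub>M M2)) = (\<integral>x. f x \<partial>M1)"
proof -
  interpret M1: prob_space M1 by fact
  interpret M2: prob_space M2 by fact
  interpret pair_prob_space M1 M2 ..
  have [measurable]: "f \<in> borel_measurable M1"
    using f by simp
  show int: "integrable (M1 \<Otimes>\<^sub>M M2) (\<lambda>z. f (fst z))"
    by (rule Fubini_integrable) (use f in \<open>simp_all add: M2.prob_space\<close>)
  show "(\<integral>z. f (fst z) \<partial>(M1 \<Otimes>\<^sub>M M2)) = (\<integral>x. f x \<partial>M1)"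
    using integral_fst'[OF int] by (simp add: M2.prob_space)
qed

lemma integral_pair_snd:
  fixes f :: "'s \<Rightarrow> real"
  assumes "prob_space M1" "prob_space M2" and f: "integrable M2 f"
  shows "integrable (M1 \<Otimes>\<^sub>M M2) (\<lambda>z. f (snd z))" "(\<integral>z. f (snd z) \<partial>(M1 \<Otimes>\<^sub>M M2)) = (\<integral>x. f x \<partial>M2)"
proof -
  interpret M1: prob_space M1 by fact
  interpret M2: prob_space M2 by fact
  interpret pair_prob_space M1 M2 ..
  have [measurable]: "f \<in> borel_measurable M2"
    using f by simp
  show int: "integrable (M1 \<Otimes>\<^sub>M M2) (\<lambda>z. f (snd z))"
    by (rule Fubini_integrable) (use f in \<open>simp_all add: M1.prob_space\<close>)
  show "(\<integral>z. f (snd z) \<partial>(M1 \<Otimes>\<^sub>M M2)) = (\<integral>x. f x \<partial>M2)"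
    using integral_fst'[OF int] by (simp add: M1.prob_space)
qed

lemma gaussian_integral_inner: "(\<integral>n. b \<bullet> (N *v n) \<partial>(\<gamma> :: (complex^'n) measure)) = 0"
proof -
  let ?U = "(-1) *\<^sub>R mat 1 :: complex^'n^'n"
  have "?U\<^sup>H ** ?U = mat 1"
    by (simp only: ctranspose_scaleR scaleR_matrix_mult) simp
  from gaussian_integral_unitary[OF this, of "\<lambda>n. b \<bullet> (N *v n)"]
  have "(\<integral>n. - (b \<bullet> (N *v n)) \<partial>(\<gamma> :: (complex^'n) measure)) = (\<integral>n. b \<bullet> (N *v n) \<partial>\<gamma>)"
    by (simp only: scaleR_matrix_vector) (simp add: linear_neg[OF matrix_vector_mul_linear])
  then show ?thesis
    by simp
qed

lemma mean_matrix_vector: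
  fixes X :: "'w \<Rightarrow> complex^'n" and A :: "complex^'n^'m"
  assumes "prob_space M" "X \<in> borel_measurable M" "integrable M (\<lambda>\<omega>. (norm (X \<omega>))\<^sup>2)"
  shows "(\<chi> i. \<integral>\<omega>. (A *v X \<omega>) $ i \<partial>M) = A *v (\<chi> i. \<integral>\<omega>. X \<omega> $ i \<partial>M)"
  using integrable_norm_square_nth(1)[OF assms]
  by (simp add: vec_eq_iff matrix_vector_mult_def)

text \<open>The quadratic terms cancel since \<open>N (A (x - m) + n)\<close> and \<open>n\<close> have the same covariance.\<close>

lemma expectation_whitened_noise:
  fixes X :: "'w \<Rightarrow> complex^'a" and A :: "complex^'a^'k" and N :: "complex^'k^'k"
  assumes M: "prob_space M" and X [measurable]: "X \<in> borel_measurable M" and cov: "has_covariance M X K"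
    and N: "N ** (mat 1 + A ** K ** A\<^sup>H) ** N\<^sup>H = mat 1"
  defines "m \<equiv> \<chi> i. \<integral>\<omega>. X \<omega> $ i \<partial>M"
  shows "integrable (M \<Otimes>\<^sub>M \<gamma>) (\<lambda>z. (norm (N *v (A *v (X (fst z) - m) + snd z)))\<^sup>2 - (norm (snd z))\<^sup>2)" (is "integrable _ ?\<phi>")
    "(\<integral>z. (norm (N *v (A *v (X (fst z) - m) + snd z)))\<^sup>2 - (norm (snd z))\<^sup>2 \<partial>(M \<Otimes>\<^sub>M \<gamma>)) = 0"
proof -
  define \<phi> where "\<phi> = ?\<phi>"
  interpret M: prob_space M by fact
  let ?G = "\<gamma> :: (complex^'k) measure"
  interpret pair_prob_space M ?G ..
  define a where "a \<omega> = (N ** A) *v X \<omega> - (N ** A) *v m" for \<omega>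
  have [measurable]: "a \<in> borel_measurable M"
    unfolding a_def by measurable
  have sq: "integrable M (\<lambda>\<omega>. (norm (X \<omega>))\<^sup>2)"
    using cov by (simp add: has_covariance_def)
  have meas: "(\<lambda>\<omega>. (N ** A) *v X \<omega>) \<in> borel_measurable M" "(\<lambda>w. N *v w) \<in> borel_measurable ?G" "(\<lambda>w. w) \<in> borel_measurable ?G"
    by measurable
  note covA = has_covariance_matrix_vector[OF M X cov, of "N ** A"]
  have "integrable M (\<lambda>\<omega>. (norm (a \<omega>))\<^sup>2)" "(\<integral>\<omega>. (norm (a \<omega>))\<^sup>2 \<partial>M) = Re (trace (N ** A ** K ** (N ** A)\<^sup>H))"
    using expectation_norm_square[OF M meas(1) covA] unfolding mean_matrix_vector[OF M X sq] a_def m_def by auto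
  note E1 = integral_pair_fst[OF M prob_space_gaussian this(1)] this(2)
  have zero: "(\<chi> i. \<integral>w. w $ i \<partial>?G) = 0"
    by (simp add: vec_eq_iff gaussian_mean)
  have G1: "integrable ?G (\<lambda>n. (norm n)\<^sup>2)" "(\<integral>n. (norm n)\<^sup>2 \<partial>?G) = Re (trace (mat 1 :: complex^'k^'k))"
    using expectation_norm_square[OF prob_space_gaussian meas(3) gaussian_has_covariance] unfolding zero by auto
  have covN: "has_covariance ?G (\<lambda>w. N *v w) (N ** mat 1 ** N\<^sup>H)"
    by (rule has_covariance_matrix_vector[OF prob_space_gaussian meas(3) gaussian_has_covariance])
  have G2: "integrable ?G (\<lambda>n. (norm (N *v n))\<^sup>2)" "(\<integral>n. (norm (N *v n))\<^sup>2 \<partial>?G) = Re (trace (N ** N\<^sup>H))"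
    using expectation_norm_square[OF prob_space_gaussian meas(2) covN]
    unfolding mean_matrix_vector[OF prob_space_gaussian meas(3) gaussian_integrable_norm_square] zero by auto
  note E2 = integral_pair_snd[OF M prob_space_gaussian G1(1)] G1(2)
  note E3 = integral_pair_snd[OF M prob_space_gaussian G2(1)] G2(2)
  have cross_int: "integrable (M \<Otimes>\<^sub>M ?G) (\<lambda>z. 2 * (a (fst z) \<bullet> (N *v snd z)))"
  proof (rule Bochner_Integration.integrable_bound[OF Bochner_Integration.integrable_add[OF E1(1) E3(1)]])
    show "AE z in M \<Otimes>\<^sub>M ?G. norm (2 * (a (fst z) \<bullet> (N *v snd z))) \<le> norm ((norm (a (fst z)))\<^sup>2 + (norm (N *v snd z))\<^sup>2)"
    proof (intro always_eventually allI)
      fix z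
      have "\<bar>a (fst z) \<bullet> (N *v snd z)\<bar> \<le> norm (a (fst z)) * norm (N *v snd z)"
        by (rule Cauchy_Schwarz_ineq2)
      then show "norm (2 * (a (fst z) \<bullet> (N *v snd z))) \<le> norm ((norm (a (fst z)))\<^sup>2 + (norm (N *v snd z))\<^sup>2)"
        using sum_squares_bound[of "norm (a (fst z))" "norm (N *v snd z)"] by simp
    qed
  qed measurable
  have cross: "(\<integral>z. 2 * (a (fst z) \<bullet> (N *v snd z)) \<partial>(M \<Otimes>\<^sub>M ?G)) = 0"
    using integral_fst'[OF cross_int] by (simp add: gaussian_integral_inner)
  have \<phi>: "\<phi> = (\<lambda>z. (norm (a (fst z)))\<^sup>2 + 2 * (a (fst z) \<bullet> (N *v snd z)) + (norm (N *v snd z))\<^sup>2 - (norm (snd z))\<^sup>2)"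
  proof
    fix z
    have "N *v (A *v (X (fst z) - m) + snd z) = a (fst z) + N *v snd z"
      by (simp add: a_def matrix_vector_right_distrib matrix_vector_mult_diff_distrib matrix_vector_mul_assoc)
    then show "\<phi> z = (norm (a (fst z)))\<^sup>2 + 2 * (a (fst z) \<bullet> (N *v snd z)) + (norm (N *v snd z))\<^sup>2 - (norm (snd z))\<^sup>2"
      by (simp add: \<phi>_def power2_norm_eq_inner inner_add_left inner_add_right inner_commute)
  qed
  have "integrable (M \<Otimes>\<^sub>M ?G) \<phi>"
    unfolding \<phi> by (intro Bochner_Integration.integrable_add Bochner_Integration.integrable_diff E1(1) E2(1) E3(1) cross_int)
  then show "integrable (M \<Otimes>\<^sub>M ?G) ?\<phi>"
    by (simp add: \<phi>_def)
  have "(\<integral>z. \<phi> z \<partial>(M \<Otimes>\<^sub>M ?G)) = Re (trace (N ** A ** K ** (N ** A)\<^sup>H)) + Re (trace (N ** N\<^sup>H)) - Re (trace (mat 1 :: complex^'k^'k))"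
    unfolding \<phi>
    by (simp only: Bochner_Integration.integral_add Bochner_Integration.integral_diff Bochner_Integration.integrable_add
        E1 E2 E3 cross cross_int add_0_right)
  also have "\<dots> = Re (trace (N ** A ** K ** (N ** A)\<^sup>H + N ** N\<^sup>H)) - Re (trace (mat 1 :: complex^'k^'k))"
    by (simp add: trace_add)
  also have "N ** A ** K ** (N ** A)\<^sup>H + N ** N\<^sup>H = N ** (mat 1 + A ** K ** A\<^sup>H) ** N\<^sup>H"
    by (simp add: matrix_mult_distribs ctranspose_mul matrix_mul_assoc add.commute)
  finally show "(\<integral>z. (norm (N *v (A *v (X (fst z) - m) + snd z)))\<^sup>2 - (norm (snd z))\<^sup>2 \<partial>(M \<Otimes>\<^sub>M ?G)) = 0"
    by (simp add: N \<phi>_def)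
qed

context reference_input
begin

lemma nn_integral_channel_\<pi>:
  assumes f [measurable]: "f \<in> borel_measurable (W \<Otimes>\<^sub>M borel)"
  shows "(\<integral>\<^sup>+z. f z \<partial>channel W \<pi> A) = (\<integral>\<^sup>+v. (\<integral>\<^sup>+n. f (v, A *v snd v + n) \<partial>\<gamma>) \<partial>p)"
proof -
  have "(\<lambda>z. \<integral>\<^sup>+n. f (fst z, A *v snd z + n) \<partial>\<gamma>) \<in> borel_measurable (W \<Otimes>\<^sub>M borel)"
    by measurable
  then show ?thesis
    unfolding nn_integral_channel[OF joint_law_\<pi> f] by (simp add: \<pi>_def nn_integral_distr)
qed

lemma channel_\<pi>:
  "channel W \<pi> A = distr (p \<Otimes>\<^sub>M \<gamma>) (W \<Otimes>\<^sub>M borel) (\<lambda>z. (fst z, A *v snd (fst z) + snd z))"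
proof (rule measure_eqI_nn_integral)
  fix f :: "_ \<Rightarrow> ennreal" assume "f \<in> borel_measurable (channel W \<pi> A)"
  then have f [measurable]: "f \<in> borel_measurable (W \<Otimes>\<^sub>M borel)"
    by simp
  have "(\<lambda>z. f (fst z, A *v snd (fst z) + snd z)) \<in> borel_measurable (p \<Otimes>\<^sub>M \<gamma>)"
    by measurable
  from gaussian.nn_integral_fst[OF this]
  show "(\<integral>\<^sup>+z. f z \<partial>channel W \<pi> A) = (\<integral>\<^sup>+z. f z \<partial>distr (p \<Otimes>\<^sub>M \<gamma>) (W \<Otimes>\<^sub>M borel) (\<lambda>z. (fst z, A *v snd (fst z) + snd z)))"
    by (simp add: nn_integral_channel_\<pi>[OF f] nn_integral_distr)
qed simp

text \<open>The logarithm of the density \<open>r\<close> is \<open>ln d\<close> plus a quadratic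
  expression with vanishing expectation, by \<open>expectation_whitened_noise\<close>. Only the mean
  and covariance of \<open>x\<close> enter, so the value is shared by all inputs with covariance
  \<open>K\<close>.\<close>

lemma full_div_gaussian:
  fixes A :: "complex^'a^'k" and F :: "complex^'a^'a"
  assumes cov: "has_covariance p snd K" and F: "F ** F\<^sup>H = K"
    and \<nu>_eq: "\<nu> = distr \<gamma> borel (\<lambda>w. (\<chi> i. \<integral>z. snd z $ i \<partial>p) + F *v w)"
  shows "full_div A = ereal (gaussian_rate K A)"
proof -
  define m where "m = (\<chi> i. \<integral>z. snd z $ i \<partial>p)"
  obtain T :: "complex^'k^'k" where T: "det_scaling T" "T ** T\<^sup>H = mat 1 + (A ** F) ** (A ** F)\<^sup>H"
    by (rule one_plus_factor)
  obtain N where N: "N ** T = mat 1"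
    using T(1) by (auto simp: det_scaling_def invertible_def)
  define d where "d = (cmod (det T))\<^sup>2"
  have d: "0 < d"
    using T(1) unfolding det_scaling_def d_def by (blast dest: lebesgue_scaling_pos)
  have TT: "T ** T\<^sup>H = mat 1 + A ** K ** A\<^sup>H"
    by (simp add: T(2) F[symmetric] ctranspose_mul matrix_mul_assoc)
  have NN: "N ** (mat 1 + A ** K ** A\<^sup>H) ** N\<^sup>H = mat 1"
  proof -
    have "N ** (T ** T\<^sup>H) ** N\<^sup>H = (N ** T) ** (N ** T)\<^sup>H"
      by (simp only: ctranspose_mul matrix_mul_assoc)
    then show ?thesis
      by (simp add: N TT)
  qed
  \<comment> \<open>The noise density at \<open>y - A x\<close> divided by the density of the
    reference output; the powers of \<open>pi\<close> cancel and \<open>d\<close> is the Jacobian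
    factor of the whitening.\<close>
  define r where "r z = exp (ln d + (norm (N *v (snd z - A *v m)))\<^sup>2 - (norm (snd z - A *v snd (fst z)))\<^sup>2)"
    for z :: "('u \<times> (complex^'a)) \<times> (complex^'k)"
  have [measurable]: "r \<in> borel_measurable (W \<Otimes>\<^sub>M borel)"
    unfolding r_def by measurable
  have out: "(\<integral>\<^sup>+y. f y \<partial>output_law \<nu> A) = (\<integral>\<^sup>+y. ennreal (gaussian_pdf (N *v (y - A *v m)) / d) * f y \<partial>lborel)"
    if "f \<in> borel_measurable borel" for f
    unfolding \<nu>_eq d_def m_def by (rule nn_integral_output_law_gaussian[OF T N that])
  have "channel W \<pi> A = density (channel W (p \<Otimes>\<^sub>M \<nu>) A) (\<lambda>z. ennreal (r z))"
  proof (rule measure_eqI_nn_integral)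
    fix f :: "_ \<Rightarrow> ennreal" assume "f \<in> borel_measurable (channel W \<pi> A)"
    then have f [measurable]: "f \<in> borel_measurable (W \<Otimes>\<^sub>M borel)"
      by simp
    have "(\<integral>\<^sup>+z. f z \<partial>density (channel W (p \<Otimes>\<^sub>M \<nu>) A) (\<lambda>z. ennreal (r z)))
      = (\<integral>\<^sup>+z. ennreal (r z) * f z \<partial>channel W (p \<Otimes>\<^sub>M \<nu>) A)"
      by (rule nn_integral_density) measurable
    also have "\<dots> = (\<integral>\<^sup>+v. (\<integral>\<^sup>+y. ennreal (r (v, y)) * f (v, y) \<partial>output_law \<nu> A) \<partial>p)"
      unfolding channel_p\<nu> by (rule nn_integral_pair_output[OF p.prob_space_axioms sets_p]) measurable
    also have "\<dots> = (\<integral>\<^sup>+v. (\<integral>\<^sup>+n. f (v, A *v snd v + n) \<partial>\<gamma>) \<partial>p)"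
    proof (rule nn_integral_cong)
      fix v assume "v \<in> space p"
      then have v: "v \<in> space W"
        using sets_eq_imp_space_eq[OF sets_p] by simp
      have fv [measurable]: "(\<lambda>y. f (v, y)) \<in> borel_measurable borel" and rv [measurable]: "(\<lambda>y. r (v, y)) \<in> borel_measurable borel"
        using v by measurable
      have "(\<integral>\<^sup>+y. ennreal (r (v, y)) * f (v, y) \<partial>output_law \<nu> A)
        = (\<integral>\<^sup>+y. ennreal (gaussian_pdf (N *v (y - A *v m)) / d) * (ennreal (r (v, y)) * f (v, y)) \<partial>lborel)"
        by (rule out) measurable
      also have "\<dots> = (\<integral>\<^sup>+y. ennreal (gaussian_pdf (y - A *v snd v)) * f (v, y) \<partial>lborel)"
      proof (rule nn_integral_cong)
        fix y
        have "gaussian_pdf (N *v (y - A *v m)) / d * r (v, y) = gaussian_pdf (y - A *v snd v)"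
          using d by (simp add: r_def exp_add exp_diff exp_minus field_simps)
        then have "ennreal (gaussian_pdf (N *v (y - A *v m)) / d) * ennreal (r (v, y)) = ennreal (gaussian_pdf (y - A *v snd v))"
          using d by (subst ennreal_mult[symmetric]) (simp_all add: r_def)
        then show "ennreal (gaussian_pdf (N *v (y - A *v m)) / d) * (ennreal (r (v, y)) * f (v, y)) = ennreal (gaussian_pdf (y - A *v snd v)) * f (v, y)"
          by (simp only: mult.assoc[symmetric])
      qed
      also have "\<dots> = (\<integral>\<^sup>+n. ennreal (gaussian_pdf ((A *v snd v + n) - A *v snd v)) * f (v, A *v snd v + n) \<partial>lborel)"
        by (rule nn_integral_lborel_translate[symmetric]) measurable
      also have "\<dots> = (\<integral>\<^sup>+n. ennreal (gaussian_pdf n) * f (v, A *v snd v + n) \<partial>lborel)"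
        by simp
      also have "\<dots> = (\<integral>\<^sup>+n. f (v, A *v snd v + n) \<partial>\<gamma>)"
        by (rule nn_integral_gaussian[symmetric]) measurable
      finally show "(\<integral>\<^sup>+y. ennreal (r (v, y)) * f (v, y) \<partial>output_law \<nu> A) = (\<integral>\<^sup>+n. f (v, A *v snd v + n) \<partial>\<gamma>)" .
    qed
    also have "\<dots> = (\<integral>\<^sup>+z. f z \<partial>channel W \<pi> A)"
      by (rule nn_integral_channel_\<pi>[symmetric]) fact
    finally show "(\<integral>\<^sup>+z. f z \<partial>channel W \<pi> A) = (\<integral>\<^sup>+z. f z \<partial>density (channel W (p \<Otimes>\<^sub>M \<nu>) A) (\<lambda>z. ennreal (r z)))" ..
  qed simp
  then interpret r: prob_density "channel W \<pi> A" "channel W (p \<Otimes>\<^sub>M \<nu>) A" r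
    using prob_space_channel[OF joint_law_\<pi>, of A] prob_space_channel[OF joint_law_p\<nu>, of A]
    unfolding prob_density_def prob_density_axioms_def by (auto simp: r_def)
  have snd_p: "snd \<in> borel_measurable p"
    by measurable
  note E = expectation_whitened_noise[OF p.prob_space_axioms snd_p cov NN]
  interpret pair_prob_space p "\<gamma> :: (complex^'k) measure" ..
  have ln_r: "ln (r (fst z, A *v snd (fst z) + snd z)) =
    ln d + ((norm (N *v (A *v (snd (fst z) - (\<chi> i. \<integral>z. snd z $ i \<partial>p)) + snd z)))\<^sup>2 - (norm (snd z))\<^sup>2)" for z
    by (simp add: r_def m_def matrix_vector_mult_diff_distrib algebra_simps)
  have m1: "(\<lambda>z. (fst z, A *v snd (fst z) + snd z)) \<in> p \<Otimes>\<^sub>M \<gamma> \<rightarrow>\<^sub>M W \<Otimes>\<^sub>M borel"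
    by measurable
  have m2: "(\<lambda>z. ln (r z)) \<in> borel_measurable (W \<Otimes>\<^sub>M borel)"
    by measurable
  have int: "integrable (channel W \<pi> A) (\<lambda>z. ln (r z))"
    unfolding channel_\<pi> integrable_distr_eq[OF m1 m2] ln_r using E(1) by simp
  have "(\<integral>z. ln (r z) \<partial>channel W \<pi> A) = ln d"
    unfolding channel_\<pi> integral_distr[OF m1 m2] ln_r using E by (simp add: prob_space)
  moreover have "gaussian_rate K A = ln d"
    unfolding gaussian_rate_def TT[symmetric] det_mul_ctranspose by (simp add: d_def)
  ultimately show ?thesis
    using r.rel_ent_eq[OF int] by (simp add: full_div_def)
qed

end

section \<open>The information gap\<close>

lemma tendsto_gaussian_rate:
  fixes G :: "complex^'a^'e" and F :: "complex^'a^'a"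
  assumes t: "t \<longlonglongrightarrow> 1"
  shows "(\<lambda>n. gaussian_rate (F ** F\<^sup>H) (t n *\<^sub>R G)) \<longlonglongrightarrow> gaussian_rate (F ** F\<^sup>H) G"
proof -
  have eq: "(t n *\<^sub>R G) ** (F ** F\<^sup>H) ** (t n *\<^sub>R G)\<^sup>H = (t n)\<^sup>2 *\<^sub>R (G ** (F ** F\<^sup>H) ** G\<^sup>H)" for n
    using scaleR_matrix_mult[of "t n" "G ** (F ** F\<^sup>H)" "t n" "G\<^sup>H"] scaleR_matrix_mult[of "t n" G 1 "F ** F\<^sup>H"]
    by (simp add: ctranspose_scaleR power2_eq_square)
  have "(\<lambda>n. mat 1 + (t n)\<^sup>2 *\<^sub>R (G ** (F ** F\<^sup>H) ** G\<^sup>H)) \<longlonglongrightarrow> mat 1 + 1\<^sup>2 *\<^sub>R (G ** (F ** F\<^sup>H) ** G\<^sup>H)"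
    by (intro tendsto_intros t)
  then have "(\<lambda>n. Re (det (mat 1 + (t n)\<^sup>2 *\<^sub>R (G ** (F ** F\<^sup>H) ** G\<^sup>H)))) \<longlonglongrightarrow> Re (det (mat 1 + 1\<^sup>2 *\<^sub>R (G ** (F ** F\<^sup>H) ** G\<^sup>H)))"
    unfolding det_def by (intro tendsto_intros t)
  moreover have "0 < Re (det (mat 1 + G ** (F ** F\<^sup>H) ** G\<^sup>H))"
    using det_one_plus_mul_ctranspose(2)[of "G ** F"] by (simp add: ctranspose_mul matrix_mul_assoc)
  ultimately show ?thesis
    unfolding gaussian_rate_def eq by (intro tendsto_ln) auto
qed

text \<open>\<open>channel_info\<close> in nats, as a bare divergence without the case distinction
  of \<open>mutual_info\<close>.\<close>

definition input_info :: "('u, 'a::finite) input \<Rightarrow> complex^'a^'k \<Rightarrow> ereal" where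
  "input_info = (\<lambda>(U, p) A. rel_ent (channel U p A) (channel U (distr p U fst \<Otimes>\<^sub>M distr p borel snd) A))"

text \<open>Two degradations for each \<open>t < 1\<close>: from \<open>H\<close> to
  \<open>t G\<close>, which gives the bound on the gap, and from \<open>G\<close> to
  \<open>t G\<close>, which gives \<open>info (t *\<^sub>R G) \<le> info G\<close> and so puts
  \<open>G\<close> on the left. On the right \<open>t\<close> tends to 1.\<close>

lemma information_gap:
  fixes H :: "complex^'a^'b" and G :: "complex^'a^'e"
  assumes p: "joint_law U p" and cov: "has_covariance p snd K" and K: "hermitian_psd K"
    and le: "\<And>v. norm (G *v v) \<le> norm (H *v v)"
  obtains iH iG where "input_info (U, p) H = ereal iH" "input_info (U, p) G = ereal iG"
    "iH - iG \<le> gaussian_rate K H - gaussian_rate K G"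
proof -
  obtain F :: "complex^'a^'a" where F: "F ** F\<^sup>H = K"
    using K by (rule hermitian_psd_factor)
  define \<nu> where "\<nu> = distr \<gamma> borel (\<lambda>w. (\<chi> i. \<integral>z. snd z $ i \<partial>p) + F *v w)"
  interpret reference_input U p \<nu>
    unfolding reference_input_def by (auto simp: p \<nu>_def prob_space_shifted_gaussian)
  have info: "input_info (U, p) A = info A" for A :: "complex^'a^'k"
    by (simp add: input_info_def info_def pU_def pX_def)
  have rate: "full_div A = ereal (gaussian_rate K A)" for A :: "complex^'a^'k"
    by (rule full_div_gaussian[OF cov F \<nu>_def])
  have C1: "norm ((mat 1 :: complex^'e^'e) *v y) \<le> norm y" for y
    by simp
  have scaled: "(t *\<^sub>R mat 1) ** G = t *\<^sub>R G" for t
    using scaleR_matrix_mult[of t "mat 1" 1 G] by simp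
  \<comment> \<open>Degrading \<open>G\<close> by the factor 1/2 serves for a by-product, the
    finiteness of \<open>info G\<close>; any factor in \<open>[0, 1)\<close> would do.\<close>
  obtain iG where iG: "info G = ereal iG"
  proof -
    obtain D :: "complex^'e^'e" where D: "invertible D" "((1/2) *\<^sub>R (mat 1 :: complex^'e^'e)) ** ((1/2) *\<^sub>R mat 1)\<^sup>H + D ** D\<^sup>H = mat 1"
      using strict_contraction_complement[of "mat 1 :: complex^'e^'e" "1/2"] C1 by auto
    show thesis
      by (rule information_gap_degraded[OF D rate rate]) (rule that)
  qed
  obtain C where C: "C ** H = G" "\<And>y. norm (C *v y) \<le> norm y"
    by (rule contraction_factor[OF le]) blast
  have step: "\<exists>iH. info H = ereal iH \<and> iH - iG \<le> gaussian_rate K H - gaussian_rate K (t *\<^sub>R G)"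
    if t: "0 \<le> t" "t < 1" for t
  proof -
    obtain D :: "complex^'e^'e" where D: "invertible D" "(t *\<^sub>R C) ** (t *\<^sub>R C)\<^sup>H + D ** D\<^sup>H = mat 1"
      using strict_contraction_complement[OF C(2) t] by auto
    obtain E :: "complex^'e^'e" where E: "invertible E" "(t *\<^sub>R (mat 1 :: complex^'e^'e)) ** (t *\<^sub>R mat 1)\<^sup>H + E ** E\<^sup>H = mat 1"
      using strict_contraction_complement[OF C1 t] by auto
    have tC: "(t *\<^sub>R C) ** H = t *\<^sub>R G"
      using scaleR_matrix_mult[of t C 1 H] by (simp add: C(1))
    obtain iH it where it: "info H = ereal iH" "info (t *\<^sub>R G) = ereal it"
      "iH - it \<le> gaussian_rate K H - gaussian_rate K (t *\<^sub>R G)"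
      unfolding tC[symmetric] by (rule information_gap_degraded[OF D rate rate])
    have "info (t *\<^sub>R G) \<le> info G"
      using rel_ent_channel_degraded[OF p joint_law_pUpX E, of G] unfolding scaled info_def .
    then have "it \<le> iG"
      by (simp add: it iG)
    then show ?thesis
      using it by auto
  qed
  obtain iH where iH: "info H = ereal iH"
    using step[of 0] by auto
  have le_t: "iH - iG \<le> gaussian_rate K H - gaussian_rate K (t *\<^sub>R G)" if "0 \<le> t" "t < 1" for t
    using step[OF that] iH by auto
  define t where "t n = 1 - inverse (real (Suc n))" for n
  have "(\<lambda>n. 1 - inverse (real (Suc n))) \<longlonglongrightarrow> 1 - 0"
    by (intro tendsto_intros LIMSEQ_inverse_real_of_nat)
  then have t_lim: "t \<longlonglongrightarrow> 1"
    by (simp only: t_def[abs_def] diff_0_right)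
  have t: "0 \<le> t n" "t n < 1" for n
    by (auto simp: t_def divide_simps)
  have "(\<lambda>n. gaussian_rate K H - gaussian_rate K (t n *\<^sub>R G)) \<longlonglongrightarrow> gaussian_rate K H - gaussian_rate K G"
    unfolding F[symmetric] by (intro tendsto_intros tendsto_gaussian_rate t_lim)
  then have "iH - iG \<le> gaussian_rate K H - gaussian_rate K G"
    by (rule LIMSEQ_le_const) (use le_t t in auto)
  then show thesis
    using that[of iH iG] by (simp add: info iH iG)
qed

section \<open>The Gaussian input\<close>

lemma complex_gaussian_factor:
  fixes K :: "complex^'n^'n"
  assumes "hermitian_psd K"
  obtains F :: "complex^'n^'n" where "F ** F\<^sup>H = K" "complex_gaussian K = distr \<gamma> borel ((*v) F)"
proof -
  have "\<exists>A :: complex^'n^'n. A ** A\<^sup>H = K"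
    using hermitian_psd_factor[OF assms] by metis
  from someI_ex[OF this] show thesis
    by (intro that) (auto simp: complex_gaussian_def)
qed

text \<open>The reference law is now the law of \<open>x\<close> itself, and \<open>u\<close>
  determines \<open>x\<close>, so \<open>(u, y)\<close> carries as much divergence as
  \<open>(u, x, y)\<close>: forgetting \<open>x\<close> gives one inequality, reconstructing it as
  \<open>inv \<iota> u\<close> the other. Hence \<open>info\<close> equals
  \<open>full_div\<close>.\<close>

lemma gaussian_input_attains_rate:
  fixes \<iota> :: "complex^'a \<Rightarrow> 'u"
  assumes \<iota>: "inj \<iota>" and K: "hermitian_psd K"
  shows "joint_law (embed_measure borel \<iota>) (snd (gaussian_input \<iota> K))"
    and "has_covariance (snd (gaussian_input \<iota> K)) snd K"
    and "input_info (gaussian_input \<iota> K) A = ereal (gaussian_rate K A)"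
proof -
  obtain F :: "complex^'a^'a" where F: "F ** F\<^sup>H = K" and cg: "complex_gaussian K = distr \<gamma> borel ((*v) F)"
    using K by (rule complex_gaussian_factor)
  define U where "U = embed_measure (borel :: (complex^'a) measure) \<iota>"
  define p where "p = distr (complex_gaussian K) (U \<Otimes>\<^sub>M borel) (\<lambda>x. (\<iota> x, x))"
  have input: "gaussian_input \<iota> K = (U, p)"
    by (simp add: gaussian_input_def U_def p_def)
  have [measurable]: "\<iota> \<in> borel \<rightarrow>\<^sub>M U"
    unfolding U_def by (rule measurable_embed_measure2[OF \<iota>])
  have inv [measurable]: "inv \<iota> \<in> U \<rightarrow>\<^sub>M borel"
    unfolding U_def by (rule measurable_embed_measure1) (simp add: inv_f_f[OF \<iota>])
  have sets_cg [measurable_cong, simp]: "sets (complex_gaussian K) = sets borel"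
    by (simp add: cg)
  interpret cg: prob_space "complex_gaussian K"
    unfolding cg by (rule gaussian.prob_space_distr) measurable
  have p_std: "p = distr \<gamma> (U \<Otimes>\<^sub>M borel) (\<lambda>w. (\<iota> (F *v w), F *v w))"
    unfolding p_def cg by (subst distr_distr) (auto simp: comp_def)
  have J: "joint_law U p"
    unfolding joint_law_def p_def by (auto intro!: cg.prob_space_distr)
  then show "joint_law (embed_measure borel \<iota>) (snd (gaussian_input \<iota> K))"
    by (simp add: input U_def)
  have m1: "(\<lambda>w. (\<iota> (F *v w), F *v w)) \<in> \<gamma> \<rightarrow>\<^sub>M U \<Otimes>\<^sub>M borel"
    by measurable
  have covF: "has_covariance \<gamma> (\<lambda>w. F *v w) K"
    using has_covariance_matrix_vector[OF prob_space_gaussian _ gaussian_has_covariance, of F] by (simp add: F)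
  have mean: "(\<integral>z. snd z $ i \<partial>p) = (\<integral>w. (F *v w) $ i \<partial>\<gamma>)" for i
    unfolding p_std by (subst integral_distr[OF m1]) auto
  have zero: "(\<chi> i. \<integral>z. snd z $ i \<partial>p) = 0"
  proof -
    have "(\<chi> i. \<integral>w. (F *v w) $ i \<partial>\<gamma>) = F *v (\<chi> i. \<integral>w. w $ i \<partial>\<gamma>)"
      by (rule mean_matrix_vector[OF prob_space_gaussian _ gaussian_integrable_norm_square]) measurable
    also have "(\<chi> i. \<integral>w. w $ i \<partial>(\<gamma> :: (complex^'a) measure)) = 0"
      by (simp add: vec_eq_iff gaussian_mean)
    finally show ?thesis
      by (simp add: mean)
  qed
  have "has_covariance p snd K"
    unfolding has_covariance_def mean
  proof (intro conjI allI)
    show "integrable p (\<lambda>\<omega>. (norm (snd \<omega>))\<^sup>2)"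
      unfolding p_std using covF by (subst integrable_distr_eq[OF m1]) (auto simp: has_covariance_def)
    show "(\<integral>\<omega>. (snd \<omega> $ i - (\<integral>w. (F *v w) $ i \<partial>\<gamma>)) * cnj (snd \<omega> $ j - (\<integral>w. (F *v w) $ j \<partial>\<gamma>)) \<partial>p) = K $ i $ j" for i j
      unfolding p_std using covF by (subst integral_distr[OF m1]) (auto simp: has_covariance_def)
  qed
  then show cov: "has_covariance (snd (gaussian_input \<iota> K)) snd K"
    by (simp add: input)
  define \<nu> where "\<nu> = distr \<gamma> borel (\<lambda>w. (\<chi> i. \<integral>z. snd z $ i \<partial>p) + F *v w)"
  interpret reference_input U p \<nu>
    unfolding reference_input_def by (auto simp: J \<nu>_def prob_space_shifted_gaussian)
  have \<nu>_cg: "\<nu> = complex_gaussian K"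
    by (simp add: \<nu>_def zero cg)
  have pX: "pX = \<nu>"
    unfolding pX_def \<nu>_cg unfolding p_def by (subst distr_distr) (auto simp: comp_def distr_id2)
  have pU_cg: "pU = distr (complex_gaussian K) U \<iota>"
    unfolding pU_def unfolding p_def by (subst distr_distr) (auto simp: comp_def)
  have rate: "full_div A = ereal (gaussian_rate K A)"
    using cov by (intro full_div_gaussian[OF _ F \<nu>_def]) (simp add: input)
  have "info A \<le> full_div A"
    unfolding info_def full_div_def pX forget_x_\<pi>[symmetric] forget_x_p\<nu>[symmetric] by (rule rel_ent_distr_le) auto
  moreover have "full_div A \<le> info A"
  proof -
    let ?h = "\<lambda>u. (u, inv \<iota> u)"
    have h [measurable]: "?h \<in> U \<rightarrow>\<^sub>M W"
      unfolding W_def by measurable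
    have m2: "(\<lambda>x. (\<iota> x, x)) \<in> complex_gaussian K \<rightarrow>\<^sub>M U \<Otimes>\<^sub>M borel" and m3: "(\<lambda>x. (\<iota> x, x)) \<in> complex_gaussian K \<rightarrow>\<^sub>M W"
      unfolding W_def by measurable
    have m4: "(\<lambda>z. (z, snd z)) \<in> W \<rightarrow>\<^sub>M W \<Otimes>\<^sub>M borel"
      by measurable
    have 1: "distr p (W \<Otimes>\<^sub>M borel) (\<lambda>(v, x). (?h v, x)) = \<pi>"
    proof -
      have "distr p (W \<Otimes>\<^sub>M borel) (\<lambda>(v, x). (?h v, x)) = distr (complex_gaussian K) (W \<Otimes>\<^sub>M borel) (\<lambda>x. ((\<iota> x, x), x))"
        unfolding p_def by (subst distr_distr[OF _ m2]) (auto simp: comp_def inv_f_f[OF \<iota>])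
      also have "\<dots> = \<pi>"
        unfolding \<pi>_def unfolding p_def by (subst distr_distr[OF _ m2]) (auto simp: comp_def m4 simp flip: W_def)
      finally show ?thesis .
    qed
    have 2: "distr (pU \<Otimes>\<^sub>M pX) (W \<Otimes>\<^sub>M borel) (\<lambda>(v, x). (?h v, x)) = p \<Otimes>\<^sub>M \<nu>"
    proof -
      have "distr pU W ?h = p"
        unfolding pU_cg by (subst distr_distr[OF h]) (auto simp: comp_def inv_f_f[OF \<iota>] p_def W_def)
      moreover have "distr pX borel (\<lambda>x. x) = \<nu>"
        unfolding pX by (rule distr_id2) simp
      moreover have "distr pU W ?h \<Otimes>\<^sub>M distr pX borel (\<lambda>x. x) = distr (pU \<Otimes>\<^sub>M pX) (W \<Otimes>\<^sub>M borel) (\<lambda>(v, x). (?h v, x))"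
        by (rule pair_measure_distr) (auto simp: calculation(2) \<nu>.sigma_finite_measure_axioms)
      ultimately show ?thesis
        by simp
    qed
    show ?thesis
      using rel_ent_channel_projection[OF J joint_law_pUpX h, of A] unfolding 1 2 info_def full_div_def .
  qed
  ultimately have "info A = full_div A"
    by (rule antisym)
  then show "input_info (gaussian_input \<iota> K) A = ereal (gaussian_rate K A)"
    by (simp add: input rate input_info_def info_def pU_def pX_def)
qed

lemma channel_info_eq_input_info:
  "joint_law (fst inp) (snd inp) \<Longrightarrow> channel_info inp A = input_info inp A / ereal (ln 2)"
  by (cases inp) (simp add: channel_info_eq input_info_def)

section \<open>Possible channels\<close>

text \<open>The complement of the support is a union of open sets of probability zero, and by second
  countability countably many of them cover it.\<close>

lemma AE_possible_channels:
  fixes H :: "'w \<Rightarrow> complex^'a^'b" and G :: "'w \<Rightarrow> complex^'a^'e"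
  assumes M: "prob_space M" and [measurable]: "H \<in> borel_measurable M" "G \<in> borel_measurable M"
  shows "AE \<omega> in M. (H \<omega>, G \<omega>) \<in> possible_channels M H G"
proof -
  interpret prob_space M by fact
  let ?N = "{V. open V \<and> measure M {\<omega> \<in> space M. (H \<omega>, G \<omega>) \<in> V} = 0}"
  obtain N' where N': "N' \<subseteq> ?N" "countable N'" "\<Union>N' = \<Union>?N"
    by (rule Lindelof[of ?N]) auto
  have "AE \<omega> in M. \<forall>V\<in>N'. (H \<omega>, G \<omega>) \<notin> V"
    unfolding AE_ball_countable[OF N'(2)]
  proof
    fix V assume "V \<in> N'"
    then have V: "open V" "measure M {\<omega> \<in> space M. (H \<omega>, G \<omega>) \<in> V} = 0"
      using N'(1) by auto
    have [measurable]: "V \<in> sets borel"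
      using V(1) by simp
    have "{\<omega> \<in> space M. (H \<omega>, G \<omega>) \<in> V} \<in> sets M"
      by measurable
    then have "{\<omega> \<in> space M. (H \<omega>, G \<omega>) \<in> V} \<in> null_sets M"
      using V(2) by (simp add: null_sets_def emeasure_eq_measure)
    from AE_not_in[OF this] show "AE \<omega> in M. (H \<omega>, G \<omega>) \<notin> V"
      by auto
  qed
  then show ?thesis
  proof eventually_elim
    case (elim \<omega>)
    then have "(H \<omega>, G \<omega>) \<notin> \<Union>?N"
      using N'(3) by auto
    then show ?case
      by (auto simp: possible_channels_def zero_less_measure_iff)
  qed
qed

text \<open>A Gaussian input with covariance \<open>v v\<^sup>H\<close> sends one scalar along
  \<open>v\<close>; its information is \<open>log (1 + |A v|\<^sup>2)\<close>, an increasing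
  function of the norm of \<open>A v\<close>.\<close>

lemma uniformly_less_noisy_contraction:
  fixes H :: "'w \<Rightarrow> complex^'a^'b" and G :: "'w \<Rightarrow> complex^'a^'e" and \<iota> :: "complex^'a \<Rightarrow> 'u"
  assumes \<iota>: "inj \<iota>" and less: "uniformly_less_noisy TYPE('u) M H G" and HG: "(H0, G0) \<in> possible_channels M H G"
  shows "norm (G0 *v v) \<le> norm (H0 *v v)"
proof -
  let ?inp = "gaussian_input \<iota> (outer v v)"
  note g = gaussian_input_attains_rate[OF \<iota> hermitian_psd_outer, of v]
  have J: "joint_law (fst ?inp) (snd ?inp)"
    using g(1) by (simp add: gaussian_input_def)
  then have "input_distribution ?inp"
    by (simp add: input_distribution_def joint_law_def split_beta')
  then have "channel_info ?inp G0 \<le> channel_info ?inp H0"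
    using less HG unfolding uniformly_less_noisy_def by blast
  then have "gaussian_rate (outer v v) G0 / ln 2 \<le> gaussian_rate (outer v v) H0 / ln 2"
    by (simp add: channel_info_eq_input_info[OF J] g(3))
  then have le: "gaussian_rate (outer v v) G0 \<le> gaussian_rate (outer v v) H0"
    by (simp add: divide_le_cancel)
  have rate: "gaussian_rate (outer v v) A = ln (1 + (norm (A *v v))\<^sup>2)" for A :: "complex^'a^'k"
    by (simp add: gaussian_rate_def matrix_mult_outer outer_matrix_mult det_one_plus_outer del: of_real_add)
  have "(norm (G0 *v v))\<^sup>2 \<le> (norm (H0 *v v))\<^sup>2"
    using le unfolding rate by (simp add: add_pos_nonneg)
  then show ?thesis
    by (rule power2_le_imp_le) simp
qed

theorem theorem1:
  fixes M :: "'w measure"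
    and H :: "'w \<Rightarrow> complex^'a^'b"
    and G :: "'w \<Rightarrow> complex^'a^'e"
    and K :: "complex^'a^'a"
    and \<iota> :: "complex^'a \<Rightarrow> 'u"
    and r :: real
  assumes "prob_space M"
    and "H \<in> borel_measurable M"
    and "G \<in> borel_measurable M"
    and "0 \<le> r"
    and "hermitian_psd K"
    and "inj \<iota>"
    and "uniformly_less_noisy TYPE('u) M H G"
  shows "is_arg_min (SOP M H G r) (\<lambda>inp. inp \<in> inputs_with_cov K) (gaussian_input \<iota> K)
    \<and> (INF inp \<in> (inputs_with_cov K :: ('u, 'a) input set). SOP M H G r inp) =
        measure M {\<omega> \<in> space M.
          log 2 (Re (det (mat 1 + H \<omega> ** K ** (H \<omega>)\<^sup>H) /
                     det (mat 1 + G \<omega> ** K ** (G \<omega>)\<^sup>H))) < r}"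
proof -
  interpret prob_space M by fact
  note [measurable] = assms(2,3)
  let ?g = "gaussian_input \<iota> K :: ('u, 'a) input"
  note g = gaussian_input_attains_rate[OF assms(6,5)]
  have Jg: "joint_law (fst ?g) (snd ?g)"
    using g(1) by (simp add: gaussian_input_def)
  have in_iff: "inp \<in> inputs_with_cov K \<longleftrightarrow> joint_law (fst inp) (snd inp) \<and> has_covariance (snd inp) snd K" for inp :: "('u, 'a) input"
    by (cases inp) (auto simp: inputs_with_cov_def input_distribution_def joint_law_def)
  have g_in: "?g \<in> inputs_with_cov K"
    unfolding in_iff using Jg g(2) by simp
  have info_g: "channel_info ?g A = ereal (gaussian_rate K A / ln 2)" for A :: "complex^'a^'k"
    by (simp add: channel_info_eq_input_info[OF Jg] g(3))
  have minimal: "SOP M H G r ?g \<le> SOP M H G r inp" if inp: "inp \<in> inputs_with_cov K" for inp :: "('u, 'a) input"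
  proof -
    have J: "joint_law (fst inp) (snd inp)" and cov: "has_covariance (snd inp) snd K"
      using inp by (auto simp: in_iff)
    have [measurable]: "channel_info inp \<in> borel_measurable (borel :: (complex^'a^'k) measure)"
      using borel_measurable_channel_info[OF J] by simp
    \<comment> \<open>At every possible channel pair, hence almost surely, the Gaussian input has
      the largest gap; so its outage event is contained, up to a null set, in that of
      \<open>inp\<close>.\<close>
    have "AE \<omega> in M. channel_info inp (H \<omega>) - channel_info inp (G \<omega>) \<le> channel_info ?g (H \<omega>) - channel_info ?g (G \<omega>)"
      using AE_possible_channels[OF assms(1-3)]
    proof eventually_elim
      case (elim \<omega>)
      have "norm (G \<omega> *v v) \<le> norm (H \<omega> *v v)" for v
        by (rule uniformly_less_noisy_contraction[OF assms(6,7) elim])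
      then obtain iH iG where i: "input_info inp (H \<omega>) = ereal iH" "input_info inp (G \<omega>) = ereal iG"
        "iH - iG \<le> gaussian_rate K (H \<omega>) - gaussian_rate K (G \<omega>)"
        using information_gap[OF J cov assms(5), of "G \<omega>" "H \<omega>"] by auto
      have "(iH - iG) / ln 2 \<le> (gaussian_rate K (H \<omega>) - gaussian_rate K (G \<omega>)) / ln 2"
        using i(3) by (intro divide_right_mono) auto
      then show ?case
        by (simp add: channel_info_eq_input_info[OF J] i info_g diff_divide_distrib)
    qed
    then have "AE \<omega> in M. channel_info ?g (H \<omega>) - channel_info ?g (G \<omega>) < ereal r \<longrightarrow> channel_info inp (H \<omega>) - channel_info inp (G \<omega>) < ereal r"
      by eventually_elim auto
    then show ?thesis
      unfolding SOP_def by (intro finite_measure_mono_AE) (auto intro: AE_mp)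
  qed
  have SOP_g: "SOP M H G r ?g = measure M {\<omega> \<in> space M. log 2 (Re (det (mat 1 + H \<omega> ** K ** (H \<omega>)\<^sup>H) /
                     det (mat 1 + G \<omega> ** K ** (G \<omega>)\<^sup>H))) < r}"
  proof -
    obtain F :: "complex^'a^'a" where F: "F ** F\<^sup>H = K"
      using assms(5) by (rule hermitian_psd_factor)
    \<comment> \<open>Both determinants are positive reals, so \<open>Re\<close> passes through the
      complex quotient and the logarithm splits.\<close>
    have det: "det (mat 1 + A ** K ** A\<^sup>H) = of_real (Re (det (mat 1 + A ** K ** A\<^sup>H)))" "0 < Re (det (mat 1 + A ** K ** A\<^sup>H))"
      for A :: "complex^'a^'k"
      using det_one_plus_mul_ctranspose[of "A ** F"] by (simp_all add: ctranspose_mul matrix_mul_assoc flip: F)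
    have "gaussian_rate K A / ln 2 - gaussian_rate K B / ln 2 = log 2 (Re (det (mat 1 + A ** K ** A\<^sup>H) / det (mat 1 + B ** K ** B\<^sup>H)))"
      for A :: "complex^'a^'b" and B :: "complex^'a^'e"
    proof -
      have "Re (det (mat 1 + A ** K ** A\<^sup>H) / det (mat 1 + B ** K ** B\<^sup>H)) = Re (det (mat 1 + A ** K ** A\<^sup>H)) / Re (det (mat 1 + B ** K ** B\<^sup>H))"
        by (subst det(1)[of A], subst det(1)[of B]) (simp flip: of_real_divide)
      then show ?thesis
        using det(2)[of A] det(2)[of B] by (simp add: gaussian_rate_def log_def ln_div diff_divide_distrib)
    qed
    then show ?thesis
      by (simp add: SOP_def info_g)
  qed
  have "(INF inp \<in> (inputs_with_cov K :: ('u, 'a) input set). SOP M H G r inp) = SOP M H G r ?g"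
  proof (rule antisym)
    \<comment> \<open>The infimum is taken in the reals, where it is a genuine lower bound only of a
      set bounded below; probabilities are at least 0.\<close>
    have "bdd_below (SOP M H G r ` (inputs_with_cov K :: ('u, 'a) input set))"
      by (rule bdd_belowI2[of _ 0]) (simp add: SOP_def)
    then show "(INF inp \<in> (inputs_with_cov K :: ('u, 'a) input set). SOP M H G r inp) \<le> SOP M H G r ?g"
      using g_in by (rule cINF_lower)
    show "SOP M H G r ?g \<le> (INF inp \<in> (inputs_with_cov K :: ('u, 'a) input set). SOP M H G r inp)"
      using g_in minimal by (intro cINF_greatest) auto
  qed
  moreover have "is_arg_min (SOP M H G r) (\<lambda>inp. inp \<in> inputs_with_cov K) ?g"
    using g_in minimal by (auto simp: is_arg_min_def not_less)
  ultimately show ?thesis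
    by (simp add: SOP_g)
qed

end
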